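(* Let $D$ be a c-union of two (plane) c-alternating dimaps $S_1$ and $S_2$. Then $T_c(D;x,y)=T_c(S_1;x,y)\cdot T_c(S_2;x,y)$.
   Context: An alternating dimap is a directed graph (loops and multiple edges allowed) 2-cell embedded in a disjoint union of orientable closed surfaces such that around every vertex the incident edge-ends alternate between incoming and outgoing; every face is a c-face (clockwise boundary) or an a-face (anticlockwise boundary). Here alternating dimaps are plane. For an edge $e=uv$, its right (resp. left) successor is the next edge after $e$ around the c-face (resp. a-face) containing $e$. A block is a maximal connected alternating subdimap without cutvertex (every loop is a block). Block $B_1$ is within a face $g$ of block $B_2$ if there is a face $g'$ of $D$ with $g'\subseteq g$ (as point sets) and $\partial g'\cap E(g)\neq\emptyset$, where $\partial$ denotes the boundary. A c-cycle block is a block that is a clockwise face with as many vertices as edges. For a plane graph $G$, $\mathrm{alt}_c(G)$ replaces each edge of $G$ by two oppositely directed edges forming a clockwise face of size two; $\mathrm{alt}_c(\mathcal{G})$ is the set of all such dimaps for plane graphs $G$. A multiloop is a set of loops $e_1,\dots,e_m$ ($m\ge1$) that can be ordered so that all are incident with one common vertex, for $j<k\le m$ the loop $e_j$ is within a face of $e_k$, and every face of size $s$ is formed by $s$ distinct loops that are consecutive in the ordering; it is a c-multiloop if $e_m$ and some $e_j$ form a clockwise face. A c-simple alternating dimap is a loopless alternating dimap every block of which is a c-cycle block or an element of $\mathrm{alt}_c(\mathcal{G})$, with no block within a clockwise face of any other block. A c-alternating dimap is obtained from a c-simple alternating dimap by adding some c-multiloops within some of its anticlockwise faces. A c-union $S_1\cup_c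 S_2$ is obtained by identifying at most one pair of vertices $u\in V(S_1)$, $v\in V(S_2)$ such that neither of $S_1,S_2$ lies within a clockwise face of the other. Edge types: 1-loop (head has degree 2); $\omega$-loop (alone forms an a-face); $\omega^2$-loop (alone forms a c-face); ultraloop (all three); triloop; proper $\mu$-loop (not an ultraloop). 1-semiloop: ordinary loop. $\omega$-semiloop: a loop that is its own right successor, or $e$ and its right successor distinct forming a cutset or whose removal decreases genus. $\omega^2$-semiloop: an $\omega$-loop that is its own left successor, or $e$ and its left successor distinct forming a cutset or whose removal decreases genus. Proper $\mu$-semiloop: not a triloop. Reductions of $e=uv$: if $e$ is an $\omega$- or $\omega^2$-loop, all reductions delete $e$. Otherwise $D[1]e$ contracts a non-loop $e$; for a loop $e$ at $v$ with cyclic order of edge-ends $e,a_1,b_1,\dots,a_s,b_s,e,c_1,d_1,\dots,c_t,d_t$ (from the outgoing end of $e$), $e$ is removed and $v$ split into $v_1$ (incident with $c_i,d_i$) and $v_2$ (incident with $a_i,b_i$). $D[\omega]e$: with left successor $\ell=vn$, delete $e,\ell$, add $un$ in their place, remove $v$ if $\deg(v)=2$. $D[\omega^2]e$: same with right successor $r=vm$, adding $um$. c-Tutte invariant ($x,y$ indeterminates): $T_c(\emptyset)=1$, multiplicative over disjoint unions, and for $e\in E(D)$: $T_c(D)=T_c(D\setminus e)$ if $e$ is an ultraloop; $=x\,T_c(D[\omega^2]e)$ if a proper 1-loop or proper $\omega$-semiloop; $=y\,T_c(D[1]e)$ if a proper $\omega$-loop or proper 1-semiloop; $=T_c(D[\omega]e)$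 if a proper $\omega^2$-loop or proper $\omega^2$-semiloop; $=T_c(D[1]e)+T_c(D[\omega^2]e)$ otherwise. *)

theory Defs
  imports "HOL-Combinatorics.Combinatorics" "HOL-Computational_Algebra.Polynomial"
begin

section \<open>Embedded directed graphs\<close>

text \<open>
  A directed graph without isolated vertices, 2-cell embedded in a disjoint union of oriented
  closed surfaces (one for each component), is given by its rotation system.
  The edge \<open>e\<close> has two edge-ends: \<open>(e, Tail)\<close>, where it leaves its tail vertex, and
  \<open>(e, Head)\<close>, where it enters its head vertex.  The permutation \<open>rot\<close> maps an edge-end to the
  next edge-end in anticlockwise order around the same vertex.  The vertices are the orbits of
  \<open>rot\<close>; a vertex that loses its last edge-end disappears.
\<close>

datatype side = Tail | Head

type_synonym 'e edge_end = "'e \<times> side"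

record 'e emap =
  edges :: "'e set"
  rot :: "'e edge_end \<Rightarrow> 'e edge_end"

definition ends :: "'e emap \<Rightarrow> 'e edge_end set" where
  "ends M = edges M \<times> UNIV"

definition embedded_digraph :: "'e emap \<Rightarrow> bool" where
  "embedded_digraph M \<longleftrightarrow> finite (edges M) \<and> rot M permutes ends M"

definition verts :: "'e emap \<Rightarrow> 'e edge_end set set" where
  "verts M = orbit (rot M) ` ends M"

definition head :: "'e emap \<Rightarrow> 'e \<Rightarrow> 'e edge_end set" where
  "head M e = orbit (rot M) (e, Head)"

definition tail :: "'e emap \<Rightarrow> 'e \<Rightarrow> 'e edge_end set" where
  "tail M e = orbit (rot M) (e, Tail)"

definition is_loop :: "'e emap \<Rightarrow> 'e \<Rightarrow> bool" where
  "is_loop M e \<longleftrightarrow> head M e = tail M e"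

definition loopless :: "'e emap \<Rightarrow> bool" where
  "loopless M \<longleftrightarrow> (\<forall>e\<in>edges M. \<not> is_loop M e)"

fun opp :: "'e edge_end \<Rightarrow> 'e edge_end" where
  "opp (e, Tail) = (e, Head)"
| "opp (e, Head) = (e, Tail)"

text \<open>
  An edge-end \<open>d\<close> also stands for its edge traversed starting from \<open>d\<close>.  Walking along it, arriving
  at \<open>opp d\<close> and leaving along the anticlockwise next edge-end, one follows the boundary
  of the face on the right-hand side.  Hence the faces are the orbits of \<open>face_step\<close>.  The face on
  the right of the directed edge \<open>e\<close> is the orbit of \<open>(e, Tail)\<close>, the face on its left is the
  orbit of \<open>(e, Head)\<close> (where \<open>e\<close> is traversed against its direction).
\<close>

definition face_step :: "'e emap \<Rightarrow> 'e edge_end \<Rightarrow> 'e edge_end" where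
  "face_step M d = rot M (opp d)"

definition face_of :: "'e emap \<Rightarrow> 'e edge_end \<Rightarrow> 'e edge_end set" where
  "face_of M d = orbit (face_step M) d"

definition faces :: "'e emap \<Rightarrow> 'e edge_end set set" where
  "faces M = face_of M ` ends M"

text \<open>Connected components of the graph with vertex set \<open>V\<close> whose edges are the members of \<open>F\<close>
  that have both end vertices in \<open>V\<close>.\<close>

definition components :: "'e emap \<Rightarrow> 'e edge_end set set \<Rightarrow> 'e set \<Rightarrow> 'e edge_end set set set" where
  "components M V F =
     V // {(u, v) \<in> V \<times> V. \<exists>e\<in>F. {u, v} = {head M e, tail M e}}\<^sup>*"

definition n_components :: "'e emap \<Rightarrow> nat" where
  "n_components M = card (components M (verts M) (edges M))"

definition connected_map :: "'e emap \<Rightarrow> bool" where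
  "connected_map M \<longleftrightarrow> n_components M = 1"

definition plane :: "'e emap \<Rightarrow> bool" where
  "plane M \<longleftrightarrow> card (verts M) + card (faces M) = card (edges M) + 2 * n_components M"

text \<open>Total genus, from the Euler formula \<open>V - E + F = 2 k - 2 g\<close>.\<close>

definition genus :: "'e emap \<Rightarrow> nat" where
  "genus M = (2 * n_components M + card (edges M) - (card (verts M) + card (faces M))) div 2"

definition cutset :: "'e emap \<Rightarrow> 'e set \<Rightarrow> bool" where
  "cutset M A \<longleftrightarrow> card (components M (verts M) (edges M - A)) > n_components M"

definition cutvertex :: "'e emap \<Rightarrow> 'e edge_end set \<Rightarrow> bool" where
  "cutvertex M v \<longleftrightarrow>
     v \<in> verts M \<and> card (components M (verts M - {v}) (edges M)) > n_components M"

text \<open>The first point of \<open>A\<close> met when iterating \<open>p\<close> from \<open>x\<close>: the permutation obtained from \<open>p\<close> by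
  erasing the points outside \<open>A\<close> from its cycles.\<close>

definition first_return :: "'a set \<Rightarrow> ('a \<Rightarrow> 'a) \<Rightarrow> 'a \<Rightarrow> 'a" where
  "first_return A p x =
     (if x \<in> A then (p ^^ (LEAST n. 0 < n \<and> (p ^^ n) x \<in> A)) x else x)"

definition submap :: "'e emap \<Rightarrow> 'e set \<Rightarrow> 'e emap" where
  "submap M A = \<lparr>edges = A, rot = first_return (A \<times> UNIV) (rot M)\<rparr>"

definition delete :: "'e emap \<Rightarrow> 'e set \<Rightarrow> 'e emap" where
  "delete M A = submap M (edges M - A)"

definition disjoint_union :: "'e emap \<Rightarrow> 'e emap \<Rightarrow> 'e emap" where
  "disjoint_union M N =
     \<lparr>edges = edges M \<union> edges N,
      rot = (\<lambda>d. if d \<in> ends M then rot M d else if d \<in> ends N then rot N d else d)\<rparr>"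

text \<open>Identify the vertex of the edge-end \<open>d\<close> of \<open>M\<close> with the vertex of the edge-end \<open>d'\<close> of \<open>N\<close>,
  placing \<open>N\<close> in the corner of \<open>M\<close> that follows \<open>d\<close>, and \<open>M\<close> in the corner of \<open>N\<close> that
  follows \<open>d'\<close>.\<close>

definition identify :: "'e emap \<Rightarrow> 'e edge_end \<Rightarrow> 'e emap \<Rightarrow> 'e edge_end \<Rightarrow> 'e emap" where
  "identify M d N d' =
     \<lparr>edges = edges M \<union> edges N,
      rot = (rot (disjoint_union M N))(d := rot N d', d' := rot M d)\<rparr>"

definition map_iso :: "'e emap \<Rightarrow> 'f emap \<Rightarrow> bool" where
  "map_iso M N \<longleftrightarrow>
     (\<exists>f. bij_betw f (edges M) (edges N) \<and>
          (\<forall>d\<in>ends M. rot N (map_prod f id d) = map_prod f id (rot M d)))"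


section \<open>Alternating dimaps\<close>

definition alternating_dimap :: "'e emap \<Rightarrow> bool" where
  "alternating_dimap M \<longleftrightarrow> embedded_digraph M \<and> (\<forall>d\<in>ends M. snd (rot M d) \<noteq> snd d)"

definition c_face :: "'e emap \<Rightarrow> 'e edge_end set \<Rightarrow> bool" where
  "c_face M g \<longleftrightarrow> g \<in> faces M \<and> (\<forall>d\<in>g. snd d = Tail)"

definition a_face :: "'e emap \<Rightarrow> 'e edge_end set \<Rightarrow> bool" where
  "a_face M g \<longleftrightarrow> g \<in> faces M \<and> (\<forall>d\<in>g. snd d = Head)"

text \<open>The inverse of \<open>face_step\<close> occurs because it traverses an a-face against the direction of
  the edges.\<close>

definition rsucc :: "'e emap \<Rightarrow> 'e \<Rightarrow> 'e" where
  "rsucc M e = fst (face_step M (e, Tail))"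

definition lsucc :: "'e emap \<Rightarrow> 'e \<Rightarrow> 'e" where
  "lsucc M e = fst (inv (face_step M) (e, Head))"


subsection \<open>Edge types\<close>

definition one_loop :: "'e emap \<Rightarrow> 'e \<Rightarrow> bool" where
  "one_loop M e \<longleftrightarrow> card (head M e) = 2"

definition omega_loop :: "'e emap \<Rightarrow> 'e \<Rightarrow> bool" where
  "omega_loop M e \<longleftrightarrow> a_face M {(e, Head)}"

definition omega2_loop :: "'e emap \<Rightarrow> 'e \<Rightarrow> bool" where
  "omega2_loop M e \<longleftrightarrow> c_face M {(e, Tail)}"

definition ultraloop :: "'e emap \<Rightarrow> 'e \<Rightarrow> bool" where
  "ultraloop M e \<longleftrightarrow> one_loop M e \<and> omega_loop M e \<and> omega2_loop M e"

definition triloop :: "'e emap \<Rightarrow> 'e \<Rightarrow> bool" where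
  "triloop M e \<longleftrightarrow> one_loop M e \<or> omega_loop M e \<or> omega2_loop M e"

definition one_semiloop :: "'e emap \<Rightarrow> 'e \<Rightarrow> bool" where
  "one_semiloop M e \<longleftrightarrow> is_loop M e"

definition omega_semiloop :: "'e emap \<Rightarrow> 'e \<Rightarrow> bool" where
  "omega_semiloop M e \<longleftrightarrow>
     (is_loop M e \<and> rsucc M e = e) \<or>
     (rsucc M e \<noteq> e \<and>
        (cutset M {e, rsucc M e} \<or> genus (delete M {e, rsucc M e}) < genus M))"

definition omega2_semiloop :: "'e emap \<Rightarrow> 'e \<Rightarrow> bool" where
  "omega2_semiloop M e \<longleftrightarrow>
     (omega_loop M e \<and> lsucc M e = e) \<or>
     (lsucc M e \<noteq> e \<and>
        (cutset M {e, lsucc M e} \<or> genus (delete M {e, lsucc M e}) < genus M))"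

definition proper_loop :: "('e emap \<Rightarrow> 'e \<Rightarrow> bool) \<Rightarrow> 'e emap \<Rightarrow> 'e \<Rightarrow> bool" where
  "proper_loop type M e \<longleftrightarrow> type M e \<and> \<not> ultraloop M e"

definition proper_semiloop :: "('e emap \<Rightarrow> 'e \<Rightarrow> bool) \<Rightarrow> 'e emap \<Rightarrow> 'e \<Rightarrow> bool" where
  "proper_semiloop type M e \<longleftrightarrow> type M e \<and> \<not> triloop M e"


subsection \<open>Reductions\<close>

text \<open>
  Exchanging the two ends of \<open>e\<close> before \<open>rot\<close> and then erasing \<open>e\<close> joins the two cyclic orders at
  the end vertices of \<open>e\<close> if these are distinct, which is contraction.
  If \<open>e\<close> is a loop with cyclic order \<open>e a\<^sub>1 b\<^sub>1 \<dots> a\<^sub>s b\<^sub>s e c\<^sub>1 d\<^sub>1 \<dots> c\<^sub>t d\<^sub>t\<close>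
  around its vertex, it splits that order into \<open>a\<^sub>1 b\<^sub>1 \<dots> a\<^sub>s b\<^sub>s\<close> and
  \<open>c\<^sub>1 d\<^sub>1 \<dots> c\<^sub>t d\<^sub>t\<close>.
\<close>

definition reduce1 :: "'e emap \<Rightarrow> 'e \<Rightarrow> 'e emap" where
  "reduce1 M e =
     (if omega_loop M e \<or> omega2_loop M e then delete M {e}
      else \<lparr>edges = edges M - {e},
            rot = first_return ((edges M - {e}) \<times> UNIV)
                    (rot M \<circ> transpose (e, Tail) (e, Head))\<rparr>)"

text \<open>
  Let \<open>e = uv\<close> and \<open>f = vw\<close> be distinct.  Delete \<open>e\<close> and \<open>f\<close> and insert an edge \<open>uw\<close> whose tail end
  takes the place of the tail end of \<open>e\<close> and whose head end takes the place of the head end of \<open>f\<close>.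
  The new edge inherits the name \<open>f\<close>: conjugation by the transposition moves the tail end named
  \<open>f\<close> to its new place, and the two ends still named \<open>e\<close>, which were the head end of \<open>e\<close> and the
  tail end of \<open>f\<close> at \<open>v\<close>, are erased.
\<close>

definition bypass :: "'e emap \<Rightarrow> 'e \<Rightarrow> 'e \<Rightarrow> 'e emap" where
  "bypass M e f =
     (let t = transpose (e, Tail) (f, Tail)
      in \<lparr>edges = edges M - {e},
          rot = first_return ((edges M - {e}) \<times> UNIV) (t \<circ> rot M \<circ> t)\<rparr>)"

definition reduce_omega :: "'e emap \<Rightarrow> 'e \<Rightarrow> 'e emap" where
  "reduce_omega M e =
     (if omega_loop M e \<or> omega2_loop M e then delete M {e} else bypass M e (lsucc M e))"

definition reduce_omega2 :: "'e emap \<Rightarrow> 'e \<Rightarrow> 'e emap" where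
  "reduce_omega2 M e =
     (if omega_loop M e \<or> omega2_loop M e then delete M {e} else bypass M e (rsucc M e))"


section \<open>The c-Tutte invariant\<close>

text \<open>Polynomials in the two indeterminates \<open>x\<close> and \<open>y\<close> are polynomials in \<open>y\<close> whose
  coefficients are polynomials in \<open>x\<close>.\<close>

definition var_x :: "int poly poly" where
  "var_x = [:[:0, 1:]:]"

definition var_y :: "int poly poly" where
  "var_y = [:0, 1:]"

text \<open>
  The recursive equations of the c-Tutte invariant are not consistent on the class of all
  alternating dimaps.  Therefore \<open>Tc_value M p\<close> states that \<open>p\<close> is obtained from \<open>M\<close> by some
  sequence of applications of the equations, with any choice of the edge at each step and any choice
  of an equation if several apply.  The invariant is well defined for \<open>M\<close> if all choices
  give the same result, and this result is then \<open>Tc M\<close>.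
\<close>

inductive Tc_value :: "'e emap \<Rightarrow> int poly poly \<Rightarrow> bool" where
  empty: "edges M = {} \<Longrightarrow> Tc_value M 1"
| disjoint_union:
    "alternating_dimap M \<Longrightarrow> alternating_dimap N \<Longrightarrow> edges M \<inter> edges N = {} \<Longrightarrow>
     Tc_value M p \<Longrightarrow> Tc_value N q \<Longrightarrow> Tc_value (disjoint_union M N) (p * q)"
| ultraloop:
    "e \<in> edges M \<Longrightarrow> ultraloop M e \<Longrightarrow> Tc_value (delete M {e}) p \<Longrightarrow> Tc_value M p"
| x_step:
    "e \<in> edges M \<Longrightarrow> proper_loop one_loop M e \<or> proper_semiloop omega_semiloop M e \<Longrightarrow>
     Tc_value (reduce_omega2 M e) p \<Longrightarrow> Tc_value M (var_x * p)"
| y_step: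
    "e \<in> edges M \<Longrightarrow> proper_loop omega_loop M e \<or> proper_semiloop one_semiloop M e \<Longrightarrow>
     Tc_value (reduce1 M e) p \<Longrightarrow> Tc_value M (var_y * p)"
| unit_step:
    "e \<in> edges M \<Longrightarrow> proper_loop omega2_loop M e \<or> proper_semiloop omega2_semiloop M e \<Longrightarrow>
     Tc_value (reduce_omega M e) p \<Longrightarrow> Tc_value M p"
| sum_step:
    "e \<in> edges M \<Longrightarrow> \<not> ultraloop M e \<Longrightarrow>
     \<not> (proper_loop one_loop M e \<or> proper_semiloop omega_semiloop M e) \<Longrightarrow>
     \<not> (proper_loop omega_loop M e \<or> proper_semiloop one_semiloop M e) \<Longrightarrow>
     \<not> (proper_loop omega2_loop M e \<or> proper_semiloop omega2_semiloop M e) \<Longrightarrow>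
     Tc_value (reduce1 M e) p \<Longrightarrow> Tc_value (reduce_omega2 M e) q \<Longrightarrow> Tc_value M (p + q)"

definition Tc_well_defined :: "'e emap \<Rightarrow> bool" where
  "Tc_well_defined M \<longleftrightarrow> (\<exists>!p. Tc_value M p)"

definition Tc :: "'e emap \<Rightarrow> int poly poly" where
  "Tc M = (THE p. Tc_value M p)"


section \<open>Blocks and position within faces\<close>

definition nonseparable :: "'e emap \<Rightarrow> bool" where
  "nonseparable M \<longleftrightarrow> connected_map M \<and> loopless M \<and> (\<nexists>v. cutvertex M v)"

text \<open>The edge sets of the blocks: the single loops and, among the loopless submaps, the maximal
  connected alternating ones without cutvertex.\<close>

definition is_block :: "'e emap \<Rightarrow> 'e set \<Rightarrow> bool" where
  "is_block M A \<longleftrightarrow>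
     (\<exists>e\<in>edges M. is_loop M e \<and> A = {e}) \<or>
     (A \<subseteq> edges M \<and> alternating_dimap (submap M A) \<and> nonseparable (submap M A) \<and>
      (\<forall>A'. A \<subset> A' \<and> A' \<subseteq> edges M \<and> alternating_dimap (submap M A') \<longrightarrow>
            \<not> nonseparable (submap M A')))"

text \<open>
  Erasing the edges outside \<open>A\<close> merges the faces of \<open>D\<close> on the two sides of each erased edge.
  So \<open>g' \<subseteq> g\<close> as point sets, for a face \<open>g'\<close> of \<open>D\<close> and a face \<open>g\<close> of \<open>submap D A\<close>, if \<open>g'\<close> can be
  reached by crossing edges outside \<open>A\<close> from a face of \<open>D\<close> that lies along a boundary edge of \<open>g\<close>
  on the side of \<open>g\<close>.
\<close>

definition face_crossing :: "'e emap \<Rightarrow> 'e set \<Rightarrow> ('e edge_end set \<times> 'e edge_end set) set" where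
  "face_crossing D F = {(face_of D d, face_of D (opp d)) | d. fst d \<in> F}"

definition subface :: "'e emap \<Rightarrow> 'e set \<Rightarrow> 'e edge_end set \<Rightarrow> 'e edge_end set \<Rightarrow> bool" where
  "subface D A g' g \<longleftrightarrow>
     g' \<in> faces D \<and> (\<exists>d\<in>g. (face_of D d, g') \<in> (face_crossing D (edges D - A))\<^sup>*)"

text \<open>The part of \<open>D\<close> with edge set \<open>B\<close> is within the face \<open>g\<close> of \<open>submap D A\<close>.\<close>

definition within_face :: "'e emap \<Rightarrow> 'e set \<Rightarrow> 'e set \<Rightarrow> 'e edge_end set \<Rightarrow> bool" where
  "within_face D B A g \<longleftrightarrow>
     g \<in> faces (submap D A) \<and> (\<exists>g'. subface D A g' g \<and> fst ` g' \<inter> B \<noteq> {})"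

definition within_c_face :: "'e emap \<Rightarrow> 'e set \<Rightarrow> 'e set \<Rightarrow> bool" where
  "within_c_face D B A \<longleftrightarrow> (\<exists>g. c_face (submap D A) g \<and> within_face D B A g)"

definition within_a_face :: "'e emap \<Rightarrow> 'e set \<Rightarrow> 'e set \<Rightarrow> bool" where
  "within_a_face D B A \<longleftrightarrow> (\<exists>g. a_face (submap D A) g \<and> within_face D B A g)"


section \<open>c-simple and c-alternating dimaps\<close>

definition c_cycle :: "'e emap \<Rightarrow> bool" where
  "c_cycle B \<longleftrightarrow> (\<exists>g. c_face B g \<and> fst ` g = edges B) \<and> card (verts B) = card (edges B)"

text \<open>
  For an undirected embedded graph we take any orientation \<open>G\<close> of it.  Its edge-ends are then
  the darts of the undirected graph, and the definition does not depend on the orientation.  The edge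
  \<open>h\<close> of \<open>alt_c G\<close> is directed from the vertex of the dart \<open>h\<close> to that of \<open>opp h\<close>.  At the position
  of the dart \<open>h\<close>, the end \<open>(opp h, Head)\<close> comes first, in anticlockwise order, and then
  \<open>(h, Tail)\<close>, so that \<open>h\<close> and \<open>opp h\<close> form a clockwise face.
\<close>

definition alt_c :: "'e emap \<Rightarrow> 'e edge_end emap" where
  "alt_c G =
     \<lparr>edges = ends G,
      rot = (\<lambda>(h, s). if h \<in> ends G
                      then (case s of Head \<Rightarrow> (opp h, Tail) | Tail \<Rightarrow> (opp (rot G h), Head))
                      else (h, s))\<rparr>"

definition in_alt_c :: "'e emap \<Rightarrow> bool" where
  "in_alt_c B \<longleftrightarrow> (\<exists>G :: 'e emap. embedded_digraph G \<and> plane G \<and> map_iso (alt_c G) B)"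

definition c_simple :: "'e emap \<Rightarrow> bool" where
  "c_simple D \<longleftrightarrow>
     alternating_dimap D \<and> plane D \<and> loopless D \<and>
     (\<forall>A. is_block D A \<longrightarrow> c_cycle (submap D A) \<or> in_alt_c (submap D A)) \<and>
     (\<forall>A B. is_block D A \<and> is_block D B \<and> A \<noteq> B \<longrightarrow> \<not> within_c_face D B A)"

definition multiloop_ordering :: "'e emap \<Rightarrow> 'e list \<Rightarrow> bool" where
  "multiloop_ordering M es \<longleftrightarrow>
     distinct es \<and> set es = edges M \<and> es \<noteq> [] \<and>
     (\<exists>v\<in>verts M. \<forall>e\<in>set es. head M e = v \<and> tail M e = v) \<and>
     (\<forall>k<length es. \<forall>j<k. \<exists>g. within_face M {es ! j} {es ! k} g) \<and>
     (\<forall>f\<in>faces M. card (fst ` f) = card f \<and>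
        (\<exists>i. i + card f \<le> length es \<and> fst ` f = set (take (card f) (drop i es))))"

definition multiloop :: "'e emap \<Rightarrow> bool" where
  "multiloop M \<longleftrightarrow> alternating_dimap M \<and> plane M \<and> (\<exists>es. multiloop_ordering M es)"

text \<open>
  The last loop lies on a clockwise face together with one or more of the preceding ones; a single
  loop alone forms a clockwise face.
\<close>

definition c_multiloop :: "'e emap \<Rightarrow> bool" where
  "c_multiloop M \<longleftrightarrow>
     multiloop M \<and>
     (\<exists>es. multiloop_ordering M es \<and>
           (length es = 1 \<or>
            (\<exists>f e. c_face M f \<and> e \<in> set (butlast es) \<and> {last es, e} \<subseteq> fst ` f)))"

text \<open>
  Since the corner is taken after an edge-end \<open>d\<close> of \<open>S\<close>, the multiloop is attached in a face of \<open>S\<close>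
  itself and not inside a multiloop added earlier; several multiloops may be attached in the same
  corner of \<open>S\<close>.
\<close>

inductive adds_c_multiloops :: "'e emap \<Rightarrow> 'e emap \<Rightarrow> bool" for S where
  base: "adds_c_multiloops S S"
| add: "adds_c_multiloops S D \<Longrightarrow> c_multiloop L \<Longrightarrow> edges D \<inter> edges L = {} \<Longrightarrow>
        d \<in> ends S \<Longrightarrow> d' \<in> ends L \<Longrightarrow> alternating_dimap (identify D d L d') \<Longrightarrow>
        within_a_face (identify D d L d') (edges L) (edges S) \<Longrightarrow>
        adds_c_multiloops S (identify D d L d')"

definition c_alternating :: "'e emap \<Rightarrow> bool" where
  "c_alternating D \<longleftrightarrow> (\<exists>S. c_simple S \<and> adds_c_multiloops S D)"

definition c_union :: "'e emap \<Rightarrow> 'e emap \<Rightarrow> 'e emap \<Rightarrow> bool" where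
  "c_union D S1 S2 \<longleftrightarrow>
     alternating_dimap D \<and> edges S1 \<inter> edges S2 = {} \<and>
     (D = disjoint_union S1 S2 \<or> (\<exists>d\<in>ends S1. \<exists>d'\<in>ends S2. D = identify S1 d S2 d')) \<and>
     \<not> within_c_face D (edges S1) (edges S2) \<and> \<not> within_c_face D (edges S2) (edges S1)"

end

theory Submission
  imports Defs
begin

text \<open>
  Each c-face of a c-alternating dimap has two edges, or consists of loops, or meets every
  component of the rest of the map in one vertex only.  This property and planarity are
  preserved by all reductions that the recursive equations use.  A map with this property becomes an
  undirected graph if each of its c-faces is replaced by a path through the vertices of
  the c-face: a c-face of \<open>k\<close> edges contributes \<open>k - 1\<close> bridges, or \<open>k - 1\<close> loops,
  or a single edge.  The Tutte polynomial of this graph, as a rank generating function, satisfies every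
  equation that applies to any edge, so each evaluation of the c-Tutte invariant yields it.  A c-union
  is a disjoint union or identifies one pair of vertices in the corners of two a-faces, which leaves the
  c-faces unchanged, and the Tutte polynomial is multiplicative for both.
\<close>

section \<open>Equivalence closures and their classes\<close>

text \<open>The definition by blocks and multiloops does not lend itself to an induction over
  reductions, so the induction runs over a class described by planarity and the c-faces alone. Its
  three kinds of c-faces come from the building material: pairs of edges from \<open>alt_c\<close>,
  multiloops, and c-cycle blocks, where the maximality of a block keeps two vertices of its c-face
  from being connected elsewhere.

  Planarity is needed at two points. Splitting the vertex of a loop has to disconnect the map, and
  rerouting at a non-bridge has to merge two a-faces. Both follow from Euler counts together with
  the nonnegativity of the genus.

  The undirected graph is never built. Its vertices are the cycles of \<open>s \<circ> r\<close>,
  its edges are the edges of the dimap except one on each c-face, and only component counts of edge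
  sets enter the polynomial. The freedom to choose the omitted edges is essential: when
  \<open>e\<close> is reduced and is not alone on its c-face, \<open>r e\<close> is omitted, which
  makes the edge sets before and after the reduction comparable.\<close>

definition eqcl :: "'a rel \<Rightarrow> 'a rel" where
  "eqcl P = (P \<union> P\<inverse>)\<^sup>*"

text \<open>Only classes that meet \<open>E\<close> are counted, because the relations used later,
  such as graphs of permutations, live on the whole type.\<close>

definition ncl :: "'a set \<Rightarrow> 'a rel \<Rightarrow> nat" where
  "ncl E P = card ((\<lambda>x. eqcl P `` {x}) ` E)"

lemma eqcl_refl [simp, intro]: "(x, x) \<in> eqcl P"
  by (simp add: eqcl_def)

lemma eqcl_sym: "(x, y) \<in> eqcl P \<Longrightarrow> (y, x) \<in> eqcl P"
  unfolding eqcl_def by (metis converse_Un converse_converse rtrancl_converseI sup_commute)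

lemma eqcl_trans [trans]: "(x, y) \<in> eqcl P \<Longrightarrow> (y, z) \<in> eqcl P \<Longrightarrow> (x, z) \<in> eqcl P"
  unfolding eqcl_def by simp

lemma eqcl_base: "(x, y) \<in> P \<Longrightarrow> (x, y) \<in> eqcl P"
  unfolding eqcl_def by blast

text \<open>To separate two points, or to carry a property along a closure, it suffices to name a
  function that is constant on the generating pairs. Most arguments about connection below have this
  form.\<close>

lemma eqcl_invariant:
  assumes "(x, y) \<in> eqcl P" and "\<And>a b. (a, b) \<in> P \<Longrightarrow> \<phi> a = \<phi> b"
  shows "\<phi> x = \<phi> y"
  using assms(1) unfolding eqcl_def
  by (induction rule: rtrancl_induct) (use assms(2) in auto)

lemma eqcl_class_eq_iff: "eqcl P `` {x} = eqcl P `` {y} \<longleftrightarrow> (x, y) \<in> eqcl P"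
  by (auto intro: eqcl_trans eqcl_sym)

lemma eqcl_least: "(\<And>a b. (a, b) \<in> P \<Longrightarrow> (a, b) \<in> eqcl Q) \<Longrightarrow> eqcl P \<subseteq> eqcl Q"
  using eqcl_invariant[of _ _ P "\<lambda>x. eqcl Q `` {x}"] by (auto simp only: eqcl_class_eq_iff)

lemma eqcl_mono: "P \<subseteq> Q \<Longrightarrow> eqcl P \<subseteq> eqcl Q"
  by (intro eqcl_least eqcl_base) auto

lemma eqcl_eqI:
  "(\<And>a b. (a, b) \<in> P \<Longrightarrow> (a, b) \<in> eqcl Q) \<Longrightarrow> (\<And>a b. (a, b) \<in> Q \<Longrightarrow> (a, b) \<in> eqcl P) \<Longrightarrow>
    eqcl P = eqcl Q"
  by (intro equalityI eqcl_least)

lemma eqcl_insert_redundant: "(a, b) \<in> eqcl P \<Longrightarrow> eqcl (insert (a, b) P) = eqcl P"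
  by (intro eqcl_eqI) (auto intro: eqcl_base)

lemma eqcl_insert_cases:
  assumes "(x, y) \<in> eqcl (insert (a, b) P)"
  shows "(x, y) \<in> eqcl P \<or> (x, a) \<in> eqcl P \<and> (b, y) \<in> eqcl P \<or>
    (x, b) \<in> eqcl P \<and> (a, y) \<in> eqcl P"
proof -
  \<comment> \<open>The class map after the class of \<open>b\<close> has been glued to that of
    \<open>a\<close>.\<close>
  define \<phi> where "\<phi> z = eqcl P `` {if (z, b) \<in> eqcl P then a else z}" for z
  have "\<phi> x = \<phi> y"
    using assms
  proof (rule eqcl_invariant)
    fix c d assume "(c, d) \<in> insert (a, b) P"
    then consider "c = a" "d = b" | "(c, d) \<in> eqcl P"
      by (auto intro: eqcl_base)
    then show "\<phi> c = \<phi> d"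
    proof cases
      case 2
      then have "(c, b) \<in> eqcl P \<longleftrightarrow> (d, b) \<in> eqcl P"
        by (meson eqcl_sym eqcl_trans)
      then show ?thesis
        using 2 by (auto simp: \<phi>_def eqcl_class_eq_iff simp del: Image_singleton_iff)
    qed (simp add: \<phi>_def)
  qed
  then show ?thesis
    unfolding \<phi>_def eqcl_class_eq_iff by (auto split: if_splits intro: eqcl_sym eqcl_trans)
qed

lemma card_image_cong_kernel:
  assumes "\<And>x y. x \<in> E \<Longrightarrow> y \<in> E \<Longrightarrow> f x = f y \<longleftrightarrow> g x = g y"
  shows "card (f ` E) = card (g ` E)"
proof -
  have "bij_betw (\<lambda>c. g (inv_into E f c)) (f ` E) (g ` E)"
    unfolding bij_betw_def
  proof
    have *: "g (inv_into E f (f x)) = g x" if "x \<in> E" for x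
      using assms[of "inv_into E f (f x)" x] that by (simp add: f_inv_into_f inv_into_into)
    show "inj_on (\<lambda>c. g (inv_into E f c)) (f ` E)"
      by (rule inj_onI) (auto simp: * assms)
    show "(\<lambda>c. g (inv_into E f c)) ` f ` E = g ` E"
      by (simp add: image_image * cong: image_cong)
  qed
  then show ?thesis
    by (rule bij_betw_same_card)
qed

lemma ncl_cong_eqcl: "eqcl P = eqcl Q \<Longrightarrow> ncl E P = ncl E Q"
  by (simp add: ncl_def)

lemma ncl_eq_card_image:
  assumes "\<And>x y. x \<in> E \<Longrightarrow> y \<in> E \<Longrightarrow> (x, y) \<in> eqcl P \<longleftrightarrow> f x = f y"
  shows "ncl E P = card (f ` E)"
  unfolding ncl_def by (rule card_image_cong_kernel) (simp add: eqcl_class_eq_iff assms)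

lemma ncl_insert:
  assumes "finite E" "a \<in> E" "b \<in> E" "(a, b) \<notin> eqcl P"
  shows "ncl E P = Suc (ncl E (insert (a, b) P))"
proof -
  let ?Q = "insert (a, b) P"
  let ?f = "\<lambda>x. eqcl P `` {x}" and ?g = "\<lambda>x. eqcl ?Q `` {x}"
  \<comment> \<open>The points outside the class of \<open>b\<close>. Every class of the enlarged
    relation contains such a point, since the class of \<open>b\<close> is absorbed by that of
    \<open>a\<close>, and on these points both relations agree.\<close>
  define E0 where "E0 = {x \<in> E. (x, b) \<notin> eqcl P}"
  have PQ: "eqcl P \<subseteq> eqcl ?Q" and ab: "(a, b) \<in> eqcl ?Q"
    by (auto intro: eqcl_mono[THEN subsetD] eqcl_base)
  have "?g ` E0 = ?g ` E"
  proof -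
    have "?g x \<in> ?g ` E0" if "x \<in> E" for x
    proof (cases "(x, b) \<in> eqcl P")
      case True
      then have "?g x = ?g a"
        unfolding eqcl_class_eq_iff using PQ ab by (meson eqcl_sym eqcl_trans subsetD)
      then show ?thesis
        using assms by (auto simp: E0_def)
    qed (use that in \<open>auto simp: E0_def\<close>)
    then show ?thesis
      by (auto simp: E0_def)
  qed
  moreover have "card (?g ` E0) = card (?f ` E0)"
  proof (rule card_image_cong_kernel, unfold eqcl_class_eq_iff)
    fix x y assume "x \<in> E0" "y \<in> E0"
    then show "(x, y) \<in> eqcl ?Q \<longleftrightarrow> (x, y) \<in> eqcl P"
      using PQ eqcl_insert_cases[of x y a b P] by (auto simp: E0_def intro: eqcl_sym)
  qed
  moreover have "?f ` E = insert (?f b) (?f ` E0)"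
  proof -
    have "?f x \<in> insert (?f b) (?f ` E0)" if "x \<in> E" for x
      using that by (cases "(x, b) \<in> eqcl P") (auto simp: E0_def eqcl_class_eq_iff
        simp del: Image_singleton_iff)
    then show ?thesis
      using assms(3) by (auto simp: E0_def)
  qed
  moreover have "?f b \<notin> ?f ` E0"
    by (auto simp: E0_def eqcl_class_eq_iff simp del: Image_singleton_iff intro: eqcl_sym)
  moreover have "finite E0"
    using assms(1) by (simp add: E0_def)
  ultimately show ?thesis
    by (simp add: ncl_def)
qed

lemma ncl_insert_redundant: "(a, b) \<in> eqcl P \<Longrightarrow> ncl E (insert (a, b) P) = ncl E P"
  by (simp add: ncl_def eqcl_insert_redundant)

lemma ncl_insert_le:
  "finite E \<Longrightarrow> a \<in> E \<Longrightarrow> b \<in> E \<Longrightarrow> ncl E P \<le> Suc (ncl E (insert (a, b) P))"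
  by (cases "(a, b) \<in> eqcl P") (simp_all add: ncl_insert_redundant ncl_insert)

lemma ncl_antimono:
  assumes "finite E" "eqcl P \<subseteq> eqcl Q"
  shows "ncl E Q \<le> ncl E P"
proof -
  have "(\<lambda>x. eqcl Q `` {x}) ` E = (\<lambda>c. eqcl Q `` c) ` (\<lambda>x. eqcl P `` {x}) ` E"
    unfolding image_image
  proof (rule image_cong)
    fix x
    show "eqcl Q `` {x} = eqcl Q `` (eqcl P `` {x})"
      using assms(2) by (auto intro: eqcl_trans)
  qed simp
  then show ?thesis
    unfolding ncl_def using assms(1) by (metis card_image_le finite_imageI)
qed

text \<open>If the pair were missing, adding it to \<open>P\<close> would cost one class while
  staying below \<open>Q\<close>, which has as many classes as \<open>P\<close>. This turns
  component counts, as in \<open>cutset\<close>, into connections between single edges.\<close>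

lemma ncl_eq_imp_eqcl:
  assumes "finite E" "eqcl P \<subseteq> eqcl Q" "ncl E P = ncl E Q"
    and "x \<in> E" "y \<in> E" "(x, y) \<in> eqcl Q"
  shows "(x, y) \<in> eqcl P"
proof (rule ccontr)
  assume "(x, y) \<notin> eqcl P"
  then have "ncl E P = Suc (ncl E (insert (x, y) P))"
    using assms by (intro ncl_insert)
  moreover have "eqcl (insert (x, y) P) \<subseteq> eqcl Q"
    using assms(2,6) by (intro eqcl_least) (auto dest: eqcl_base)
  then have "ncl E Q \<le> ncl E (insert (x, y) P)"
    by (rule ncl_antimono[OF assms(1)])
  ultimately show False
    using assms(3) by simp
qed

lemma eqcl_isolated:
  assumes "\<And>a b. (a, b) \<in> P \<Longrightarrow> a = e \<longleftrightarrow> b = e" and "(e, x) \<in> eqcl P \<or> (x, e) \<in> eqcl P"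
  shows "x = e"
  using assms(2) eqcl_invariant[of e x P "\<lambda>z. z = e"] eqcl_invariant[of x e P "\<lambda>z. z = e"]
    assms(1) by auto

lemma ncl_isolated:
  assumes "finite E" "e \<in> E" "\<And>a b. (a, b) \<in> P \<Longrightarrow> a = e \<longleftrightarrow> b = e"
  shows "ncl E P = Suc (ncl (E - {e}) P)"
proof -
  have "eqcl P `` {e} \<notin> (\<lambda>x. eqcl P `` {x}) ` (E - {e})"
    using eqcl_isolated[of P e] assms(3)
    by (auto simp: eqcl_class_eq_iff simp del: Image_singleton_iff)
  moreover have "(\<lambda>x. eqcl P `` {x}) ` E =
      insert (eqcl P `` {e}) ((\<lambda>x. eqcl P `` {x}) ` (E - {e}))"
    using assms(2) by auto
  ultimately show ?thesis
    using assms(1) by (simp add: ncl_def)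
qed

lemma eqcl_restrict:
  assumes "\<And>a b. a \<in> F \<Longrightarrow> (a, b) \<in> P \<Longrightarrow> (a, b) \<in> eqcl P'"
    and "\<And>a b. (a, b) \<in> P \<Longrightarrow> a \<in> F \<longleftrightarrow> b \<in> F"
    and "x \<in> F" "(x, y) \<in> eqcl P"
  shows "(x, y) \<in> eqcl P' \<and> y \<in> F"
proof -
  define \<phi> where "\<phi> z = (if z \<in> F then eqcl P' `` {z} else {})" for z
  have "\<phi> x = \<phi> y"
    using assms(4)
  proof (rule eqcl_invariant)
    fix a b assume "(a, b) \<in> P"
    then show "\<phi> a = \<phi> b"
      using assms(1)[of a b] assms(2)[of a b]
      by (auto simp: \<phi>_def eqcl_class_eq_iff simp del: Image_singleton_iff)
  qed
  then have "y \<in> F" "(x, y) \<in> eqcl P'"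
    using assms(3) by (auto simp: \<phi>_def eqcl_class_eq_iff simp del: Image_singleton_iff
      split: if_splits)
  then show ?thesis
    by simp
qed

lemma eqcl_closed_superset:
  assumes "\<And>a b. (a, b) \<in> P \<Longrightarrow> a \<in> F \<longleftrightarrow> b \<in> F" and "(x, y) \<in> eqcl P"
  shows "x \<in> F \<longleftrightarrow> y \<in> F"
  using eqcl_invariant[OF assms(2), of "\<lambda>z. z \<in> F"] assms(1) by auto

lemma ncl_Un:
  assumes "finite E" "finite F" "E \<inter> F = {}"
    and "\<And>a b. (a, b) \<in> P \<Longrightarrow> a \<in> E \<longleftrightarrow> b \<in> E"
  shows "ncl (E \<union> F) P = ncl E P + ncl F P"
proof -
  have "(\<lambda>x. eqcl P `` {x}) ` E \<inter> (\<lambda>x. eqcl P `` {x}) ` F = {}"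
    using eqcl_closed_superset[of P E] assms(3,4)
    by (auto simp: eqcl_class_eq_iff simp del: Image_singleton_iff)
  then show ?thesis
    unfolding ncl_def image_Un using assms by (simp add: card_Un_disjoint)
qed

lemma ncl_le_card: "finite E \<Longrightarrow> ncl E P \<le> card E"
  by (simp add: ncl_def card_image_le)

section \<open>Cycles of permutations\<close>

definition gr :: "('a \<Rightarrow> 'a) \<Rightarrow> 'a rel" where
  "gr p = {(x, p x) | x. True}"

lemma mem_gr [simp]: "(x, y) \<in> gr p \<longleftrightarrow> y = p x"
  by (auto simp: gr_def)

lemma gr_id: "eqcl (gr id \<union> P) = eqcl P"
  by (intro eqcl_eqI) (auto intro: eqcl_base)

lemma eqcl_step: "(x, p x) \<in> P \<Longrightarrow> (z, x) \<in> eqcl P \<Longrightarrow> (z, p x) \<in> eqcl P"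
  by (meson eqcl_base eqcl_trans)

lemma eqcl_gr_comp: "gr p \<subseteq> P \<Longrightarrow> gr p' \<subseteq> P \<Longrightarrow> (x, p (p' x)) \<in> eqcl P"
  by (rule eqcl_step[OF _ eqcl_base]) auto

lemma eqcl_gr_iff_orbit:
  assumes "permutation p"
  shows "(x, y) \<in> eqcl (gr p) \<longleftrightarrow> y \<in> orbit p x"
proof
  assume "(x, y) \<in> eqcl (gr p)"
  then have "orbit p x = orbit p y"
    by (rule eqcl_invariant) (simp add: permutation_orbit_step assms)
  then show "y \<in> orbit p x"
    using permutation_self_in_orbit[OF assms] by auto
next
  assume "y \<in> orbit p x"
  then show "(x, y) \<in> eqcl (gr p)"
    by induction (auto intro: eqcl_base eqcl_step)
qed

lemma orbit_eqI_eqcl: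
  assumes "permutation p"
  shows "orbit p x = orbit p y \<longleftrightarrow> (x, y) \<in> eqcl (gr p)"
  unfolding eqcl_gr_iff_orbit[OF assms]
  by (metis assms eqcl_gr_iff_orbit eqcl_sym orbit_cyclic_eq3 cyclic_on_orbit' permutation_self_in_orbit)

text \<open>A transposition only exchanges \<open>a\<close> and \<open>b\<close>, so once these two
  are glued it no longer shows.\<close>

lemma eqcl_transpose:
  "eqcl (insert (a, b) (gr (p \<circ> transpose a b) \<union> P)) = eqcl (insert (a, b) (gr p \<union> P))"
proof -
  have *: "(x, (p \<circ> transpose a b) x) \<in> eqcl (insert (a, b) (gr p \<union> P))" for x p
  proof -
    have "(x, transpose a b x) \<in> eqcl (insert (a, b) (gr p \<union> P))"
      by (cases "x = a"; cases "x = b") (auto intro: eqcl_base eqcl_sym)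
    then show ?thesis
      using eqcl_step[of "transpose a b x" p] by auto
  qed
  have "p = (p \<circ> transpose a b) \<circ> transpose a b"
    by (simp add: comp_assoc)
  then show ?thesis
    using *[of _ p] *[of _ "p \<circ> transpose a b"]
    by (intro eqcl_eqI) (auto intro: eqcl_base)
qed

text \<open>Started at \<open>b\<close>, the permutation \<open>p \<circ> transpose a b\<close>
  walks as \<open>p\<close> does from \<open>a\<close>, and the walks agree until they first meet
  \<open>a\<close> or \<open>b\<close>. Which of the two is met decides both sides.\<close>

lemma transpose_cycles:
  assumes p: "permutation p" and ab: "a \<noteq> b"
  shows "(a, b) \<in> eqcl (gr (p \<circ> transpose a b)) \<longleftrightarrow> (a, b) \<notin> eqcl (gr p)"
proof -
  let ?p = "p \<circ> transpose a b"
  have p': "permutation ?p"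
    using p by (simp add: permutation_compose permutation_swap_id)
  have "\<exists>n>0. (p ^^ n) a = a"
    using permutation_self_in_orbit[OF p, of a] by (auto simp: orbit_altdef)
  then have ex: "\<exists>n. 0 < n \<and> (p ^^ n) a \<in> {a, b}"
    by blast
  define n where "n = (LEAST n. 0 < n \<and> (p ^^ n) a \<in> {a, b})"
  have n: "0 < n" "(p ^^ n) a \<in> {a, b}"
    using LeastI_ex[OF ex] by (auto simp: n_def)
  have before: "(p ^^ i) a \<notin> {a, b}" if "0 < i" "i < n" for i
    using not_less_Least[of i "\<lambda>n. 0 < n \<and> (p ^^ n) a \<in> {a, b}"] that by (auto simp: n_def)
  have iter: "(?p ^^ i) b = (p ^^ i) a" if "0 < i" "i \<le> n" for i
    using that
  proof (induction i)
    case (Suc i)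
    then show ?case
      using before[of i] by (cases "i = 0") auto
  qed simp
  have periodic: "y \<in> {(f ^^ i) x | i. 0 < i \<and> i \<le> n}"
    if "y \<in> orbit f x" "(f ^^ n) x = x" for f :: "'a \<Rightarrow> 'a" and x y
    using that(1)
  proof induction
    case base
    then show ?case
      using n(1) by (auto intro!: exI[of _ 1])
  next
    case (step y)
    then obtain i where i: "0 < i" "i \<le> n" "y = (f ^^ i) x"
      by blast
    show ?case
    proof (cases "i = n")
      case True
      then show ?thesis
        using i that(2) n(1) by (auto intro!: exI[of _ 1])
    next
      case False
      then show ?thesis
        using i by (auto intro!: exI[of _ "Suc i"])
    qed
  qed
  show ?thesis
  proof (cases "(p ^^ n) a = b")
    case True
    have "b \<in> orbit p a"
      using True n(1) by (auto simp: orbit_altdef)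
    moreover have "a \<notin> orbit ?p b"
      using periodic[of a ?p b] iter before True n(1) ab
      by (auto simp: le_less) (metis before insertI1 iter le_less)
    ultimately show ?thesis
      by (metis eqcl_gr_iff_orbit eqcl_sym p p')
  next
    case False
    then have a: "(p ^^ n) a = a"
      using n(2) by simp
    have "a \<in> orbit ?p b"
      using iter[of n] a n(1) unfolding orbit_altdef by (metis (mono_tags, lifting) le_refl mem_Collect_eq)
    moreover have "b \<notin> orbit p a"
      using periodic[of b p a] before a ab by (auto simp: le_less) (metis before insert_iff)
    ultimately show ?thesis
      by (metis eqcl_gr_iff_orbit eqcl_sym p p')
  qed
qed

lemma ncl_transpose_split:
  assumes "permutation p" "finite E" "a \<in> E" "b \<in> E" "a \<noteq> b" "(a, b) \<in> eqcl (gr p)"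
  shows "ncl E (gr (p \<circ> transpose a b)) = Suc (ncl E (gr p))"
proof -
  have "ncl E (gr (p \<circ> transpose a b)) = Suc (ncl E (insert (a, b) (gr (p \<circ> transpose a b))))"
    using assms transpose_cycles[of p a b] by (intro ncl_insert) auto
  also have "ncl E (insert (a, b) (gr (p \<circ> transpose a b))) = ncl E (insert (a, b) (gr p))"
    using eqcl_transpose[of a b p "{}"] by (intro ncl_cong_eqcl) simp
  also have "\<dots> = ncl E (gr p)"
    using assms(6) by (rule ncl_insert_redundant)
  finally show ?thesis .
qed

lemma ncl_transpose_join:
  assumes "permutation p" "finite E" "a \<in> E" "b \<in> E" "(a, b) \<notin> eqcl (gr p)"
  shows "ncl E (gr p) = Suc (ncl E (gr (p \<circ> transpose a b)))"
proof -
  have ab: "a \<noteq> b"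
    using assms(5) by auto
  have "ncl E (gr p) = Suc (ncl E (insert (a, b) (gr p)))"
    using assms by (intro ncl_insert) auto
  also have "ncl E (insert (a, b) (gr p)) = ncl E (insert (a, b) (gr (p \<circ> transpose a b)))"
    using eqcl_transpose[of a b p "{}"] by (intro ncl_cong_eqcl) simp
  also have "\<dots> = ncl E (gr (p \<circ> transpose a b))"
    using transpose_cycles[OF assms(1) ab] assms(5) by (intro ncl_insert_redundant) auto
  finally show ?thesis .
qed

lemma transpose_comp_eq_comp_transpose:
  assumes "bij p"
  shows "transpose a b \<circ> p = p \<circ> transpose (inv p a) (inv p b)"
proof
  fix x
  show "(transpose a b \<circ> p) x = (p \<circ> transpose (inv p a) (inv p b)) x"
    using assms by (auto simp: transpose_def bij_is_surj surj_f_inv_f bij_is_inj inv_f_f)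
qed

lemma eqcl_gr_inv:
  assumes "bij p"
  shows "(inv p a, inv p b) \<in> eqcl (gr p) \<longleftrightarrow> (a, b) \<in> eqcl (gr p)"
proof -
  have "(inv p x, x) \<in> eqcl (gr p)" for x
    using assms by (intro eqcl_base) (simp add: bij_is_surj surj_f_inv_f)
  then show ?thesis
    by (meson eqcl_sym eqcl_trans)
qed

text \<open>The genus is nonnegative: \<open>\<sigma>\<close> is built up from transpositions each of which joins two of its cycles.\<close>

lemma euler_inequality:
  assumes E: "finite E" and \<tau>: "\<tau> permutes E" and "\<sigma> permutes F" "F \<subseteq> E"
  shows "ncl E (gr \<sigma>) + ncl E (gr \<tau>) + ncl E (gr (\<sigma> \<circ> \<tau>)) \<le>
    card E + 2 * ncl E (gr \<sigma> \<union> gr \<tau>)"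
proof -
  have "finite F"
    using assms(4) E by (rule finite_subset)
  then show ?thesis
    using assms(3,4)
  proof (induction F arbitrary: \<sigma>)
    case empty
    then have [simp]: "\<sigma> = id"
      by simp
    show ?case
      using ncl_le_card[OF E, of "gr id"] ncl_cong_eqcl[OF gr_id[of "gr \<tau>"], of E]
      by (simp del: id_apply add: id_def[symmetric])
  next
    case (insert a F)
    define b where "b = \<sigma> a"
    define \<sigma>0 where "\<sigma>0 = transpose a b \<circ> \<sigma>"
    have F: "\<sigma>0 permutes F"
      using permutes_insert_lemma[OF insert.prems(1)] by (simp add: \<sigma>0_def b_def)
    have \<sigma>: "\<sigma> = transpose a b \<circ> \<sigma>0"
      by (simp add: \<sigma>0_def comp_assoc[symmetric])
    have IH: "ncl E (gr \<sigma>0) + ncl E (gr \<tau>) + ncl E (gr (\<sigma>0 \<circ> \<tau>)) \<le>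
        card E + 2 * ncl E (gr \<sigma>0 \<union> gr \<tau>)"
      using insert.IH[OF F] insert.prems(2) by blast
    show ?case
    proof (cases "a = b")
      case True
      then have "\<sigma> = \<sigma>0"
        using \<sigma> by simp
      then show ?thesis
        using IH by metis
    next
      case False
      have \<sigma>0E: "\<sigma>0 permutes E"
        using F insert.prems(2) by (auto intro: permutes_subset)
      have abE: "a \<in> E" "b \<in> E"
        using insert.prems permutes_in_image[OF insert.prems(1), of a] by (auto simp: b_def)
      have perm: "permutation \<sigma>0" "permutation (\<sigma>0 \<circ> \<tau>)"
        using \<sigma>0E \<tau> E by (auto intro: permutes_imp_permutation permutation_compose)
      have bij: "bij \<sigma>0" "bij (\<sigma>0 \<circ> \<tau>)"
        using perm by (auto intro: permutation_bijective)
      have invE: "inv \<pi> x \<in> E" if "\<pi> permutes E" "x \<in> E" for \<pi> x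
        using that by (metis permutes_in_image permutes_inv)
      have "\<sigma>0 a = a"
        using F insert.hyps by (simp add: permutes_def)
      have "(a, b) \<notin> eqcl (gr \<sigma>0)"
      proof
        assume "(a, b) \<in> eqcl (gr \<sigma>0)"
        then have "b = a"
          using \<open>\<sigma>0 a = a\<close> bij(1) by (intro eqcl_isolated[of "gr \<sigma>0" a b])
            (auto simp: bij_def inj_def)
        then show False
          using False by simp
      qed
      then have z\<sigma>: "ncl E (gr \<sigma>0) = Suc (ncl E (gr \<sigma>))"
        unfolding \<sigma> transpose_comp_eq_comp_transpose[OF bij(1)]
        using perm E invE[OF \<sigma>0E] abE eqcl_gr_inv[OF bij(1)]
        by (intro ncl_transpose_join) auto
      have \<sigma>\<tau>: "\<sigma> \<circ> \<tau> = transpose a b \<circ> (\<sigma>0 \<circ> \<tau>)"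
        by (simp add: \<sigma> comp_assoc)
      have "eqcl (insert (a, b) (gr \<sigma> \<union> gr \<tau>)) = eqcl (insert (a, b) (gr \<sigma>0 \<union> gr \<tau>))"
      proof -
        have x: "(x, transpose a b y) \<in> eqcl (insert (a, b) P)" if "(x, y) \<in> P" for x y P
        proof -
          have "(y, transpose a b y) \<in> eqcl (insert (a, b) P)"
            by (cases "y = a"; cases "y = b") (auto intro: eqcl_base eqcl_sym)
          moreover have "(x, y) \<in> eqcl (insert (a, b) P)"
            using that by (auto intro: eqcl_base)
          ultimately show ?thesis
            by (rule eqcl_trans[rotated])
        qed
        have "(c, \<sigma> c) \<in> eqcl (insert (a, b) (gr \<sigma>0 \<union> gr \<tau>))" for c
          using x[of c "\<sigma>0 c" "gr \<sigma>0 \<union> gr \<tau>"] by (simp add: \<sigma>)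
        moreover have "(c, \<sigma>0 c) \<in> eqcl (insert (a, b) (gr \<sigma> \<union> gr \<tau>))" for c
          using x[of c "\<sigma> c" "gr \<sigma> \<union> gr \<tau>"] by (simp add: \<sigma>0_def)
        ultimately show ?thesis
          by (intro eqcl_eqI) (auto intro: eqcl_base)
      qed
      moreover have "(a, b) \<in> eqcl (gr \<sigma> \<union> gr \<tau>)"
        by (intro eqcl_base) (simp add: b_def)
      ultimately have eq: "eqcl (gr \<sigma> \<union> gr \<tau>) = eqcl (insert (a, b) (gr \<sigma>0 \<union> gr \<tau>))"
        by (simp add: eqcl_insert_redundant)
      have \<sigma>\<tau>E: "\<sigma>0 \<circ> \<tau> permutes E"
        using \<sigma>0E \<tau> by (simp add: permutes_compose)
      show ?thesis
      \<comment> \<open>\<sigma> has one cycle fewer than \<open>\<sigma>0\<close>. Either the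
        product gains a cycle and the components stay, so the left side is unchanged; or the product
        loses a cycle, the left side drops by two, and the right side drops by at most two.\<close>
      proof (cases "(a, b) \<in> eqcl (gr (\<sigma>0 \<circ> \<tau>))")
        case True
        have "eqcl (gr (\<sigma>0 \<circ> \<tau>)) \<subseteq> eqcl (gr \<sigma>0 \<union> gr \<tau>)"
          by (intro eqcl_least) (auto intro: eqcl_gr_comp)
        then have "ncl E (gr \<sigma> \<union> gr \<tau>) = ncl E (gr \<sigma>0 \<union> gr \<tau>)"
          using True eq by (intro ncl_cong_eqcl) (auto simp: eqcl_insert_redundant)
        moreover have "ncl E (gr (\<sigma> \<circ> \<tau>)) = Suc (ncl E (gr (\<sigma>0 \<circ> \<tau>)))"
          unfolding \<sigma>\<tau> transpose_comp_eq_comp_transpose[OF bij(2)]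
          using perm E invE[OF \<sigma>\<tau>E] abE eqcl_gr_inv[OF bij(2)] True False bij(2)
          by (intro ncl_transpose_split) (auto simp: inj_eq[OF bij_is_inj[OF bij_imp_bij_inv]])
        ultimately show ?thesis
          using IH z\<sigma> by linarith
      next
        case f: False
        have "ncl E (gr (\<sigma>0 \<circ> \<tau>)) = Suc (ncl E (gr (\<sigma> \<circ> \<tau>)))"
          unfolding \<sigma>\<tau> transpose_comp_eq_comp_transpose[OF bij(2)]
          using perm E invE[OF \<sigma>\<tau>E] abE eqcl_gr_inv[OF bij(2)] f
          by (intro ncl_transpose_join) auto
        moreover have "ncl E (gr \<sigma>0 \<union> gr \<tau>) \<le> Suc (ncl E (gr \<sigma> \<union> gr \<tau>))"
          unfolding ncl_cong_eqcl[OF eq, of E] using E abE by (intro ncl_insert_le)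
        ultimately show ?thesis
          using IH z\<sigma> by linarith
      qed
    qed
  qed
qed

section \<open>Rank generating polynomials\<close>

text \<open>With \<open>\<kappa> A\<close> the number of components of the spanning subgraph with
  edge set \<open>A\<close>, this is Whitney's form of the Tutte polynomial:
  \<open>\<kappa> {}\<close> is the number of vertices, and the exponents are corank and nullity.
  The differences are truncated, which is why monotonicity bounds appear as assumptions
  below.\<close>

definition rank_poly :: "'e set \<Rightarrow> ('e set \<Rightarrow> nat) \<Rightarrow> int poly poly" where
  "rank_poly R \<kappa> =
     (\<Sum>A\<in>Pow R. (var_x - 1) ^ (\<kappa> A - \<kappa> R) * (var_y - 1) ^ (card A + \<kappa> A - \<kappa> {}))"

lemma sum_Pow_insert:
  assumes "finite R" "e \<in> R"
  shows "(\<Sum>A\<in>Pow R. f A) = (\<Sum>A\<in>Pow (R - {e}). f A + f (insert e A))"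
proof -
  have R: "R = insert e (R - {e})"
    using assms(2) by auto
  have "(\<Sum>A\<in>Pow R. f A) = (\<Sum>A\<in>Pow (R - {e}). f A) + (\<Sum>A\<in>insert e ` Pow (R - {e}). f A)"
    by (subst R, subst Pow_insert, rule sum.union_disjoint) (use assms(1) in auto)
  also have "(\<Sum>A\<in>insert e ` Pow (R - {e}). f A) = (\<Sum>A\<in>Pow (R - {e}). f (insert e A))"
    by (subst sum.reindex) (auto simp: inj_on_def insert_ident)
  finally show ?thesis
    by (simp add: sum.distrib)
qed

text \<open>Both exponents are differences of values of \<kappa>. A constant shift arises when a
  reduction changes the component count of all edge sets alike; one constant on each side allows a
  shift in either direction.\<close>

lemma rank_poly_shift:
  assumes "\<And>A. A \<subseteq> R \<Longrightarrow> \<kappa>' A + c = \<kappa> A + d"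
  shows "rank_poly R \<kappa>' = rank_poly R \<kappa>"
  unfolding rank_poly_def
proof (rule sum.cong)
  fix A assume "A \<in> Pow R"
  then have *: "\<kappa>' A + c = \<kappa> A + d" "\<kappa>' R + c = \<kappa> R + d" "\<kappa>' {} + c = \<kappa> {} + d"
    using assms by auto
  then have "\<kappa>' A - \<kappa>' R = \<kappa> A - \<kappa> R" "card A + \<kappa>' A - \<kappa>' {} = card A + \<kappa> A - \<kappa> {}"
    by linarith+
  then show "(var_x - 1) ^ (\<kappa>' A - \<kappa>' R) * (var_y - 1) ^ (card A + \<kappa>' A - \<kappa>' {}) =
      (var_x - 1) ^ (\<kappa> A - \<kappa> R) * (var_y - 1) ^ (card A + \<kappa> A - \<kappa> {})"
    by simp
qed simp

text \<open>Leaving out \<open>e\<close> raises the corank by one and keeps the nullity, so the two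
  terms add up to \<open>(var_x - 1) + 1\<close> times one of them. On the right \<kappa> is
  unchanged: the bridge is deleted, not contracted.\<close>

lemma rank_poly_bridge:
  assumes "finite R" "e \<in> R"
    and ins: "\<And>A. A \<subseteq> R - {e} \<Longrightarrow> \<kappa> A = Suc (\<kappa> (insert e A))"
    and anti: "\<And>A. A \<subseteq> R \<Longrightarrow> \<kappa> R \<le> \<kappa> A"
  shows "rank_poly R \<kappa> = var_x * rank_poly (R - {e}) \<kappa>"
  unfolding rank_poly_def sum_Pow_insert[OF assms(1,2)] sum_distrib_left
proof (rule sum.cong)
  fix A assume "A \<in> Pow (R - {e})"
  then have A: "A \<subseteq> R - {e}" "e \<notin> A" "finite A"
    using assms(1) finite_subset by auto
  have R: "insert e R = R"
    using assms(2) by auto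
  have "\<kappa> R \<le> \<kappa> (insert e A)"
    using A assms(2) by (intro anti) auto
  then have "\<kappa> A - \<kappa> R = Suc (\<kappa> (insert e A) - \<kappa> R)" "\<kappa> A - \<kappa> (R - {e}) = \<kappa> (insert e A) - \<kappa> R"
    "card (insert e A) + \<kappa> (insert e A) = card A + \<kappa> A"
    using ins[OF A(1)] ins[of "R - {e}"] A by (simp_all add: R)
  then show "(var_x - 1) ^ (\<kappa> A - \<kappa> R) * (var_y - 1) ^ (card A + \<kappa> A - \<kappa> {}) +
      (var_x - 1) ^ (\<kappa> (insert e A) - \<kappa> R) *
        (var_y - 1) ^ (card (insert e A) + \<kappa> (insert e A) - \<kappa> {}) =
      var_x * ((var_x - 1) ^ (\<kappa> A - \<kappa> (R - {e})) * (var_y - 1) ^ (card A + \<kappa> A - \<kappa> {}))"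
    by (simp add: algebra_simps)
qed simp

text \<open>Adding \<open>e\<close> raises the nullity by one and keeps the corank, which gives the
  factor \<open>1 + (var_y - 1)\<close>. The bound \<open>low\<close> makes the truncated nullity
  register this increase.\<close>

lemma rank_poly_loop:
  assumes "finite R" "e \<in> R"
    and ins: "\<And>A. A \<subseteq> R - {e} \<Longrightarrow> \<kappa> (insert e A) = \<kappa> A"
    and low: "\<And>A. A \<subseteq> R \<Longrightarrow> \<kappa> {} \<le> card A + \<kappa> A"
  shows "rank_poly R \<kappa> = var_y * rank_poly (R - {e}) \<kappa>"
  unfolding rank_poly_def sum_Pow_insert[OF assms(1,2)] sum_distrib_left
proof (rule sum.cong)
  fix A assume "A \<in> Pow (R - {e})"
  then have A: "A \<subseteq> R - {e}" "e \<notin> A" "finite A" "A \<subseteq> R"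
    using assms(1) finite_subset by auto
  have R: "insert e R = R"
    using assms(2) by auto
  have "\<kappa> R = \<kappa> (R - {e})" "\<kappa> (insert e A) = \<kappa> A"
    "card (insert e A) + \<kappa> A - \<kappa> {} = Suc (card A + \<kappa> A - \<kappa> {})"
    using ins[OF A(1)] ins[of "R - {e}"] A low[of A] by (simp_all add: R)
  then show "(var_x - 1) ^ (\<kappa> A - \<kappa> R) * (var_y - 1) ^ (card A + \<kappa> A - \<kappa> {}) +
      (var_x - 1) ^ (\<kappa> (insert e A) - \<kappa> R) *
        (var_y - 1) ^ (card (insert e A) + \<kappa> (insert e A) - \<kappa> {}) =
      var_y * ((var_x - 1) ^ (\<kappa> A - \<kappa> (R - {e})) * (var_y - 1) ^ (card A + \<kappa> A - \<kappa> {}))"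
    by (simp add: algebra_simps)
qed simp

text \<open>Sets with \<open>e\<close> give the first summand, with contraction expressed by the
  function \<open>\<lambda>A. \<kappa> (insert e A)\<close>; the other sets give the second. The
  corank matches in the deletion as \<open>e\<close> is no bridge, the nullity in the contraction as
  \<open>e\<close> is no loop.\<close>

lemma rank_poly_deletion_contraction:
  assumes "finite R" "e \<in> R" and "\<kappa> (R - {e}) = \<kappa> R" and "\<kappa> {} = Suc (\<kappa> {e})"
  shows "rank_poly R \<kappa> =
    rank_poly (R - {e}) (\<lambda>A. \<kappa> (insert e A)) + rank_poly (R - {e}) \<kappa>"
  unfolding rank_poly_def sum_Pow_insert[OF assms(1,2)] sum.distrib[symmetric]
proof (rule sum.cong)
  fix A assume "A \<in> Pow (R - {e})"
  then have A: "e \<notin> A" "finite A"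
    using assms(1) finite_subset by auto
  have R: "insert e R = R"
    using assms(2) by auto
  have "card (insert e A) + \<kappa> (insert e A) - \<kappa> {} = card A + \<kappa> (insert e A) - \<kappa> {e}"
    using A assms(4) by simp
  then show "(var_x - 1) ^ (\<kappa> A - \<kappa> R) * (var_y - 1) ^ (card A + \<kappa> A - \<kappa> {}) +
      (var_x - 1) ^ (\<kappa> (insert e A) - \<kappa> R) *
        (var_y - 1) ^ (card (insert e A) + \<kappa> (insert e A) - \<kappa> {}) =
      (var_x - 1) ^ (\<kappa> (insert e A) - \<kappa> (insert e (R - {e}))) *
        (var_y - 1) ^ (card A + \<kappa> (insert e A) - \<kappa> {e}) +
      (var_x - 1) ^ (\<kappa> A - \<kappa> (R - {e})) * (var_y - 1) ^ (card A + \<kappa> A - \<kappa> {})"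
    using assms(3) by (simp add: R)
qed simp

lemma rank_poly_swap:
  assumes "finite R" "f \<in> R" "g \<notin> R"
    and swap: "\<And>A. A \<subseteq> R - {f} \<Longrightarrow> \<kappa> (insert g A) = \<kappa> (insert f A)"
  shows "rank_poly (insert g (R - {f})) \<kappa> = rank_poly R \<kappa>"
proof -
  have R: "insert g (R - {f}) - {g} = R - {f}" "insert f R = R"
    using assms by auto
  have \<kappa>R: "\<kappa> (insert g (R - {f})) = \<kappa> R"
    using swap[of "R - {f}"] by (simp add: R)
  have fin: "finite (insert g (R - {f}))"
    using assms(1) by simp
  show ?thesis
    unfolding rank_poly_def \<kappa>R
    unfolding sum_Pow_insert[OF assms(1,2)] sum_Pow_insert[OF fin insertI1] R
  proof (rule sum.cong)
    fix A assume "A \<in> Pow (R - {f})"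
    then have "f \<notin> A" "g \<notin> A" "finite A" "A \<subseteq> R - {f}"
      using assms(1,3) finite_subset[of A R] by auto
    then have "card (insert g A) = card (insert f A)" "\<kappa> (insert g A) = \<kappa> (insert f A)"
      using swap by simp_all
    then show "(var_x - 1) ^ (\<kappa> A - \<kappa> R) * (var_y - 1) ^ (card A + \<kappa> A - \<kappa> {}) +
        (var_x - 1) ^ (\<kappa> (insert g A) - \<kappa> R) *
          (var_y - 1) ^ (card (insert g A) + \<kappa> (insert g A) - \<kappa> {}) =
        (var_x - 1) ^ (\<kappa> A - \<kappa> R) * (var_y - 1) ^ (card A + \<kappa> A - \<kappa> {}) +
        (var_x - 1) ^ (\<kappa> (insert f A) - \<kappa> R) *
          (var_y - 1) ^ (card (insert f A) + \<kappa> (insert f A) - \<kappa> {})"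
      by simp
  qed simp
qed

text \<open>A subset of the union is a unique pair of subsets, and both exponents are additive; the
  bounds transfer this to the truncated differences.\<close>

lemma rank_poly_Un:
  assumes "finite R" "finite R'" "R \<inter> R' = {}"
    and add: "\<And>A B. A \<subseteq> R \<Longrightarrow> B \<subseteq> R' \<Longrightarrow> \<kappa> (A \<union> B) = \<kappa>1 A + \<kappa>2 B"
    and anti: "\<And>A. A \<subseteq> R \<Longrightarrow> \<kappa>1 R \<le> \<kappa>1 A" "\<And>B. B \<subseteq> R' \<Longrightarrow> \<kappa>2 R' \<le> \<kappa>2 B"
    and low: "\<And>A. A \<subseteq> R \<Longrightarrow> \<kappa>1 {} \<le> card A + \<kappa>1 A" "\<And>B. B \<subseteq> R' \<Longrightarrow> \<kappa>2 {} \<le> card B + \<kappa>2 B"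
  shows "rank_poly (R \<union> R') \<kappa> = rank_poly R \<kappa>1 * rank_poly R' \<kappa>2"
proof -
  have inj: "inj_on (\<lambda>(A, B). A \<union> B) (Pow R \<times> Pow R')"
  proof (rule inj_onI, clarify)
    fix A B A' B' assume "A \<subseteq> R" "B \<subseteq> R'" "A' \<subseteq> R" "B' \<subseteq> R'" and eq: "A \<union> B = A' \<union> B'"
    then have "A = (A \<union> B) \<inter> R" "B = (A \<union> B) \<inter> R'" "A' = (A' \<union> B') \<inter> R" "B' = (A' \<union> B') \<inter> R'"
      using assms(3) by auto
    then show "A = A' \<and> B = B'"
      by (metis eq)
  qed
  have "(\<Sum>(A, B)\<in>Pow R \<times> Pow R'. f (A \<union> B)) = (\<Sum>C\<in>Pow (R \<union> R'). f C)" for f :: "'a set \<Rightarrow> int poly poly"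
  proof -
    have "(\<lambda>(A, B). A \<union> B) ` (Pow R \<times> Pow R') = Pow (R \<union> R')"
    proof -
      have "C \<in> (\<lambda>(A, B). A \<union> B) ` (Pow R \<times> Pow R')" if "C \<subseteq> R \<union> R'" for C
        using that by (intro image_eqI[of _ _ "(C \<inter> R, C \<inter> R')"]) auto
      then show ?thesis
        by auto
    qed
    then show ?thesis
      using sum.reindex[OF inj, of f] by (simp add: comp_def case_prod_unfold)
  qed
  note this[symmetric]
  moreover have "(var_x - 1) ^ (\<kappa> (A \<union> B) - \<kappa> (R \<union> R')) *
      (var_y - 1) ^ (card (A \<union> B) + \<kappa> (A \<union> B) - \<kappa> {}) =
      (var_x - 1) ^ (\<kappa>1 A - \<kappa>1 R) * (var_y - 1) ^ (card A + \<kappa>1 A - \<kappa>1 {}) *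
      ((var_x - 1) ^ (\<kappa>2 B - \<kappa>2 R') * (var_y - 1) ^ (card B + \<kappa>2 B - \<kappa>2 {}))"
    if "A \<subseteq> R" "B \<subseteq> R'" for A B
  proof -
    have "card (A \<union> B) = card A + card B"
      using that assms(1-3) by (intro card_Un_disjoint) (auto intro: finite_subset)
    then have "card (A \<union> B) + \<kappa> (A \<union> B) - \<kappa> {} = (card A + \<kappa>1 A - \<kappa>1 {}) + (card B + \<kappa>2 B - \<kappa>2 {})"
      "\<kappa> (A \<union> B) - \<kappa> (R \<union> R') = (\<kappa>1 A - \<kappa>1 R) + (\<kappa>2 B - \<kappa>2 R')"
      using add[OF that] add[of R R'] add[of "{}" "{}"] anti(1)[OF that(1)] anti(2)[OF that(2)]
        low(1)[OF that(1)] low(2)[OF that(2)] by simp_all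
    then show ?thesis
      by (simp add: power_add)
  qed
  ultimately show ?thesis
    unfolding rank_poly_def sum_product by (simp add: sum.cartesian_product)
      (intro sum.cong, auto)
qed

section \<open>Erasing a point from a permutation\<close>

text \<open>The point \<open>e\<close> becomes a fixed point instead of leaving the domain, so
  reduced permutations remain total functions on the same type.\<close>

definition rm :: "'a \<Rightarrow> ('a \<Rightarrow> 'a) \<Rightarrow> 'a \<Rightarrow> 'a" where
  "rm e p = transpose e (p e) \<circ> p"

definition lk :: "('a \<Rightarrow> 'a) \<Rightarrow> 'a set \<Rightarrow> 'a rel" where
  "lk p A = {(x, p x) | x. p x \<in> A}"

lemma mem_lk [simp]: "(x, y) \<in> lk p A \<longleftrightarrow> y = p x \<and> y \<in> A"
  by (auto simp: lk_def)

lemma lk_empty [simp]: "lk p {} = {}"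
  by auto

lemma lk_mono: "A \<subseteq> B \<Longrightarrow> lk p A \<subseteq> lk p B"
  by auto

lemma lk_insert: "inj p \<Longrightarrow> p x = e \<Longrightarrow> lk p (insert e A) = insert (x, e) (lk p A)"
  by (auto simp: inj_def)

lemma rm_self [simp]: "rm e p e = e"
  by (simp add: rm_def)

lemma rm_apply: "bij p \<Longrightarrow> z \<noteq> e \<Longrightarrow> rm e p z = (if p z = e then p e else p z)"
  by (auto simp: rm_def transpose_def bij_def inj_def)

lemma rm_permutes: "p permutes E \<Longrightarrow> rm e p permutes E - {e}"
  unfolding rm_def
  by (rule permutes_insert_lemma) (rule permutes_subset, auto)

lemma rm_fixed: "p e = e \<Longrightarrow> rm e p = p"
  by (simp add: rm_def)

lemma bij_rm: "bij p \<Longrightarrow> bij (rm e p)"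
  by (simp add: rm_def bij_comp)

lemma eqcl_rm_insert:
  assumes "bij p"
  shows "eqcl (insert (e, p e) (gr (rm e p) \<union> P)) = eqcl (gr p \<union> P)"
proof (intro eqcl_eqI)
  fix a b assume "(a, b) \<in> insert (e, p e) (gr (rm e p) \<union> P)"
  then consider "a = e" "b = p e" | "b = rm e p a" | "(a, b) \<in> P"
    by auto
  then show "(a, b) \<in> eqcl (gr p \<union> P)"
  proof cases
    case 2
    show ?thesis
    proof (cases "a = e")
      case False
      then show ?thesis
        using 2 rm_apply[OF assms False] eqcl_gr_comp[of p "gr p \<union> P" p a]
        by (auto intro: eqcl_base)
    qed (simp add: 2)
  qed (auto intro: eqcl_base)
next
  fix a b assume "(a, b) \<in> gr p \<union> P"
  then consider "b = p a" | "(a, b) \<in> P"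
    by auto
  then show "(a, b) \<in> eqcl (insert (e, p e) (gr (rm e p) \<union> P))" (is "_ \<in> eqcl ?Q")
  proof cases
    case 1
    have e: "(p e, e) \<in> eqcl ?Q"
      by (auto intro: eqcl_base eqcl_sym)
    have "(a, rm e p a) \<in> eqcl ?Q"
      by (auto intro: eqcl_base)
    then show ?thesis
      using 1 e rm_apply[OF assms, of a e]
      by (cases "a = e"; cases "p a = e") (auto intro: eqcl_base eqcl_trans)
  qed (auto intro: eqcl_base)
qed

lemma eqcl_rm_subset: "bij p \<Longrightarrow> eqcl (gr (rm e p) \<union> P) \<subseteq> eqcl (gr p \<union> P)"
  by (metis eqcl_mono eqcl_rm_insert subset_insertI)

text \<open>Erasing replaces the connection of \<open>e\<close> with \<open>p e\<close> by a class
  of its own for \<open>e\<close>, and dropping \<open>e\<close> from the counted set compensates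
  for that class.\<close>

lemma ncl_rm:
  assumes "finite E" "e \<in> E" "p e \<in> E" "bij p" "p e \<noteq> e"
    and "\<And>a b. (a, b) \<in> P \<Longrightarrow> a = e \<longleftrightarrow> b = e"
  shows "ncl (E - {e}) (gr (rm e p) \<union> P) = ncl E (gr p \<union> P)"
proof -
  have iso: "a = e \<longleftrightarrow> b = e" if "(a, b) \<in> gr (rm e p) \<union> P" for a b
    using that assms(6)[of a b] bij_rm[OF assms(4), of e] rm_self[of e p]
    by (auto simp: bij_def inj_def)
  have "(e, p e) \<notin> eqcl (gr (rm e p) \<union> P)"
    using eqcl_isolated[of "gr (rm e p) \<union> P" e "p e"] iso assms(5) by auto
  then have "ncl E (gr (rm e p) \<union> P) = Suc (ncl E (insert (e, p e) (gr (rm e p) \<union> P)))"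
    using assms by (intro ncl_insert)
  then show ?thesis
    using ncl_isolated[OF assms(1,2), of "gr (rm e p) \<union> P"] iso
      ncl_cong_eqcl[OF eqcl_rm_insert[OF assms(4)], of E e P] by simp
qed

lemma ncl_rm_fixed:
  assumes "finite E" "e \<in> E" "bij p" "p e = e"
    and "\<And>a b. (a, b) \<in> P \<Longrightarrow> a = e \<longleftrightarrow> b = e"
  shows "Suc (ncl (E - {e}) (gr (rm e p) \<union> P)) = ncl E (gr p \<union> P)"
proof -
  have "a = e \<longleftrightarrow> b = e" if "(a, b) \<in> gr p \<union> P" for a b
    using that assms(5)[of a b] assms(3,4) by (auto simp: bij_def inj_def)
  then show ?thesis
    unfolding rm_fixed[of p e, OF assms(4)] by (intro ncl_isolated[symmetric] assms(1,2))
qed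

lemma eqcl_rm_iff:
  assumes "bij p" "x \<noteq> e" "y \<noteq> e" and iso: "\<And>a b. (a, b) \<in> P \<Longrightarrow> a = e \<longleftrightarrow> b = e"
  shows "(x, y) \<in> eqcl (gr (rm e p) \<union> P) \<longleftrightarrow> (x, y) \<in> eqcl (gr p \<union> P)"
proof
  assume "(x, y) \<in> eqcl (gr (rm e p) \<union> P)"
  then show "(x, y) \<in> eqcl (gr p \<union> P)"
    using eqcl_rm_subset[OF assms(1)] by auto
next
  assume "(x, y) \<in> eqcl (gr p \<union> P)"
  then have "(x, y) \<in> eqcl (insert (e, p e) (gr (rm e p) \<union> P))"
    by (simp add: eqcl_rm_insert assms(1))
  moreover have "a = e \<longleftrightarrow> b = e" if "(a, b) \<in> gr (rm e p) \<union> P" for a b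
    using that iso[of a b] bij_rm[OF assms(1), of e]
    by (auto simp: bij_def inj_def)
  then have "z = e" if "(e, z) \<in> eqcl (gr (rm e p) \<union> P) \<or> (z, e) \<in> eqcl (gr (rm e p) \<union> P)" for z
    using that by (intro eqcl_isolated[of "gr (rm e p) \<union> P"]) auto
  ultimately show "(x, y) \<in> eqcl (gr (rm e p) \<union> P)"
    using eqcl_insert_cases[of x y e "p e" "gr (rm e p) \<union> P"] assms(2,3) by blast
qed

text \<open>A cycle without its link into \<open>f\<close> is a path that starts at \<open>f\<close>
  and still passes through all its points.\<close>

lemma eqcl_cycle_without_link:
  assumes "permutation p" "(f, y) \<in> eqcl (gr p)"
  shows "(f, y) \<in> eqcl (lk p (eqcl (gr p) `` {f} - {f}))"
proof -
  have "(f, (p ^^ n) f) \<in> eqcl (lk p (eqcl (gr p) `` {f} - {f}))" for n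
  proof (induction n)
    case (Suc n)
    show ?case
    proof (cases "(p ^^ Suc n) f = f")
      case False
      have "(f, (p ^^ Suc n) f) \<in> eqcl (gr p)"
        by (simp only: eqcl_gr_iff_orbit[OF assms(1)] orbit_altdef) blast
      then have "((p ^^ n) f, (p ^^ Suc n) f) \<in> lk p (eqcl (gr p) `` {f} - {f})"
        using False by auto
      then show ?thesis
        using Suc.IH by (meson eqcl_base eqcl_trans)
    qed (metis eqcl_refl)
  qed simp
  moreover have "\<exists>n. (p ^^ n) f = y"
    using assms by (auto simp: eqcl_gr_iff_orbit orbit_altdef)
  ultimately show ?thesis
    by auto
qed

section \<open>Alternating dimaps as pairs of permutations\<close>

text \<open>
  The edges of an alternating dimap are permuted by the right successor map \<open>r\<close>, whose cycles are
  the c-faces, and by the inverse \<open>s\<close> of the left successor map, whose cycles are the a-faces.  The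
  cycles of \<open>s \<circ> r\<close> are the sets of edges with a common head, so they stand for the vertices.  As
  the tail of \<open>r z\<close> is the head of \<open>z\<close>, the pairs in \<open>lk r A\<close> join the two end vertices
  of each edge in \<open>A\<close>.
\<close>

definition con :: "('a \<Rightarrow> 'a) \<Rightarrow> ('a \<Rightarrow> 'a) \<Rightarrow> 'a set \<Rightarrow> 'a rel" where
  "con r s A = eqcl (gr (s \<circ> r) \<union> lk r A)"

definition rk :: "'a set \<Rightarrow> ('a \<Rightarrow> 'a) \<Rightarrow> ('a \<Rightarrow> 'a) \<Rightarrow> 'a set \<Rightarrow> nat" where
  "rk E r s A = ncl E (gr (s \<circ> r) \<union> lk r A)"

text \<open>The edge set of the c-face of \<open>e\<close>, written as a class of the closure so
  that the lemmas on \<open>eqcl\<close> apply directly.\<close>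

definition corb :: "('a \<Rightarrow> 'a) \<Rightarrow> 'a \<Rightarrow> 'a set" where
  "corb r e = eqcl (gr r) `` {e}"

lemma mem_corb: "x \<in> corb r e \<longleftrightarrow> (e, x) \<in> eqcl (gr r)"
  by (simp add: corb_def)

lemma corb_self [simp]: "e \<in> corb r e"
  by (simp add: mem_corb)

lemma corb_step: "x \<in> corb r e \<Longrightarrow> r x \<in> corb r e"
  by (auto simp: mem_corb intro: eqcl_step)

lemma corb_step_iff: "r x \<in> corb r e \<longleftrightarrow> x \<in> corb r e"
proof -
  have "(x, r x) \<in> eqcl (gr r)"
    by (auto intro: eqcl_base)
  then show ?thesis
    unfolding mem_corb by (meson eqcl_sym eqcl_trans)
qed

lemma corb_eq: "x \<in> corb r e \<Longrightarrow> corb r x = corb r e"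
  by (simp add: corb_def eqcl_class_eq_iff eqcl_sym)

lemma corb_subset:
  assumes "r permutes E" "e \<in> E"
  shows "corb r e \<subseteq> E"
  using eqcl_closed_superset[of "gr r" E e] assms permutes_in_image[OF assms(1)]
  by (auto simp: mem_corb)

text \<open>Euler's formula: the three terms on the left count c-faces, a-faces and vertices, and
  \<open>rk E r s UNIV\<close> counts components.\<close>

definition planar :: "'a set \<Rightarrow> ('a \<Rightarrow> 'a) \<Rightarrow> ('a \<Rightarrow> 'a) \<Rightarrow> bool" where
  "planar E r s \<longleftrightarrow>
     ncl E (gr r) + ncl E (gr s) + ncl E (gr (s \<circ> r)) = card E + 2 * rk E r s UNIV"

text \<open>
  The three kinds of c-faces that occur while a c-alternating dimap is reduced: those of size at most
  two, coming from an edge of an undirected graph; those consisting of loops; and those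
  that meet every component of the rest at most once.
\<close>

definition kind :: "('a \<Rightarrow> 'a) \<Rightarrow> ('a \<Rightarrow> 'a) \<Rightarrow> 'a set \<Rightarrow> bool" where
  "kind r s H \<longleftrightarrow> (\<forall>x\<in>H. r (r x) = x) \<or> (\<forall>x\<in>H. (x, r x) \<in> eqcl (gr (s \<circ> r))) \<or>
     (\<forall>x\<in>H. \<forall>y\<in>H. (x, y) \<in> con r s (- H) \<longrightarrow> x = y)"

definition good :: "'a set \<Rightarrow> ('a \<Rightarrow> 'a) \<Rightarrow> ('a \<Rightarrow> 'a) \<Rightarrow> bool" where
  "good E r s \<longleftrightarrow> finite E \<and> r permutes E \<and> s permutes E \<and> planar E r s \<and>
     (\<forall>e\<in>E. kind r s (corb r e))"

definition omits_one :: "('a \<Rightarrow> 'a) \<Rightarrow> 'a set \<Rightarrow> 'a set \<Rightarrow> bool" where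
  "omits_one r E R \<longleftrightarrow> R \<subseteq> E \<and> (\<forall>e\<in>E. \<exists>!f. f \<in> corb r e \<and> f \<notin> R)"

text \<open>Replacing each c-face by a path through its vertices, one gets an undirected graph.  Its Tutte
  polynomial does not depend on which edge of each c-face is left out.\<close>

definition val :: "'a set \<Rightarrow> ('a \<Rightarrow> 'a) \<Rightarrow> ('a \<Rightarrow> 'a) \<Rightarrow> int poly poly" where
  "val E r s = rank_poly (SOME R. omits_one r E R) (rk E r s)"

lemma eqcl_Un_mono:
  assumes "eqcl P \<subseteq> eqcl P'"
  shows "eqcl (Q \<union> P) \<subseteq> eqcl (Q \<union> P')"
proof (rule eqcl_least)
  fix a b assume "(a, b) \<in> Q \<union> P"
  then have "(a, b) \<in> Q \<or> (a, b) \<in> eqcl P'"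
    using assms eqcl_base by fast
  then show "(a, b) \<in> eqcl (Q \<union> P')"
    using eqcl_mono[of P' "Q \<union> P'"] by (auto intro: eqcl_base)
qed

lemma eqcl_Un_cong: "eqcl P = eqcl P' \<Longrightarrow> eqcl (Q \<union> P) = eqcl (Q \<union> P')"
  by (simp add: eqcl_Un_mono equalityI)

lemma con_mono: "A \<subseteq> B \<Longrightarrow> con r s A \<subseteq> con r s B"
  unfolding con_def by (intro eqcl_mono Un_mono lk_mono order_refl)

lemma eqcl_subset_con: "eqcl (gr (s \<circ> r)) \<subseteq> con r s A"
  unfolding con_def by (intro eqcl_mono) auto

lemma omits_one_exists:
  assumes "finite E" "r permutes E" "g \<in> E"
  shows "\<exists>R. omits_one r E R \<and> g \<notin> R"
proof -
  define rep where "rep f = (if g \<in> corb r f then g else SOME z. z \<in> corb r f)" for f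
  have rep: "rep f \<in> corb r f" for f
    using someI[of "\<lambda>z. z \<in> corb r f" f] by (auto simp: rep_def)
  have rep_eq: "rep f = rep f'" if "f \<in> corb r f'" for f f'
    using corb_eq[OF that] by (simp add: rep_def)
  have "omits_one r E (E - rep ` E)"
    unfolding omits_one_def
  proof (intro conjI ballI)
    fix e assume e: "e \<in> E"
    show "\<exists>!f. f \<in> corb r e \<and> f \<notin> E - rep ` E"
    proof (rule ex1I[of _ "rep e"])
      fix f assume f: "f \<in> corb r e \<and> f \<notin> E - rep ` E"
      then have "f \<in> E"
        using corb_subset[OF assms(2) e] by auto
      then obtain h where "h \<in> E" "f = rep h"
        using f by auto
      then have "f \<in> corb r h"
        using rep by simp
      then have "rep f = rep h" "rep f = rep e"
        using rep_eq f by blast+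
      then show "f = rep e"
        using \<open>f = rep h\<close> by simp
    qed (use rep e in auto)
  qed auto
  moreover have "g \<notin> E - rep ` E"
  proof -
    have "rep g = g"
      by (simp add: rep_def)
    then show ?thesis
      using assms(3) by force
  qed
  ultimately show ?thesis
    by blast
qed

section \<open>Component counts of edge sets for a pair of permutations\<close>

locale hypermap =
  fixes E :: "'a set" and r s :: "'a \<Rightarrow> 'a"
  assumes fin: "finite E" and r: "r permutes E" and s: "s permutes E"
begin

lemma perms: "permutation r" "permutation s" "permutation (s \<circ> r)"
  using r s fin by (auto intro: permutes_imp_permutation permutation_compose)

lemma bijs: "bij r" "bij s" "bij (s \<circ> r)"
  using perms by (auto intro: permutation_bijective)

lemma sr: "s \<circ> r permutes E"
  using r s by (simp add: permutes_compose)

lemma r_in [simp]: "r z \<in> E \<longleftrightarrow> z \<in> E"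
  by (rule permutes_in_image[OF r])

lemma s_in [simp]: "s z \<in> E \<longleftrightarrow> z \<in> E"
  by (rule permutes_in_image[OF s])

lemma r_eq [simp]: "r a = r b \<longleftrightarrow> a = b"
  using bijs(1) by (auto simp: bij_def inj_def)

lemma pred_ex: "\<exists>x. r x = z"
  using bijs(1) by (metis bij_pointE)

lemma r_out: "z \<notin> E \<Longrightarrow> r z = z"
  using r by (simp add: permutes_def)

lemma corb_two:
  assumes "r (r e) = e"
  shows "corb r e = {e, r e}"
proof -
  have re: "r a = e \<longleftrightarrow> a = r e" for a
    using assms r_eq by metis
  have "a \<in> {e, r e} \<longleftrightarrow> b \<in> {e, r e}" if "(a, b) \<in> gr r" for a b
    using that re by auto
  then have "e \<in> {e, r e} \<longleftrightarrow> y \<in> {e, r e}" if "(e, y) \<in> eqcl (gr r)" for y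
    using that by (rule eqcl_closed_superset)
  then have "corb r e \<subseteq> {e, r e}"
    by (simp add: corb_def subset_iff)
  then show ?thesis
    using corb_step[OF corb_self, of r e] by auto
qed

text \<open>The classes generated by \<open>s\<close> and \<open>r\<close> together are the
  components of the map: a step of \<open>s\<close> from \<open>a\<close> is the link into
  \<open>a\<close> taken backwards, followed by a step of \<open>s \<circ> r\<close>.\<close>

lemma euler: "ncl E (gr r) + ncl E (gr s) + ncl E (gr (s \<circ> r)) \<le> card E + 2 * rk E r s UNIV"
proof -
  have "eqcl (gr s \<union> gr r) = eqcl (gr (s \<circ> r) \<union> lk r UNIV)"
  proof (rule eqcl_eqI)
    fix a b assume "(a, b) \<in> gr s \<union> gr r"
    then consider "b = s a" | "b = r a"
      by auto
    then show "(a, b) \<in> eqcl (gr (s \<circ> r) \<union> lk r UNIV)"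
    proof cases
      case 1
      obtain c where c: "r c = a"
        using pred_ex by blast
      have "(c, a) \<in> eqcl (gr (s \<circ> r) \<union> lk r UNIV)" "(c, b) \<in> eqcl (gr (s \<circ> r) \<union> lk r UNIV)"
        using c 1 by (auto intro!: eqcl_base)
      then show ?thesis
        by (meson eqcl_sym eqcl_trans)
    qed (auto intro: eqcl_base)
  qed (auto intro: eqcl_base eqcl_gr_comp)
  then have "ncl E (gr s \<union> gr r) = rk E r s UNIV"
    unfolding rk_def by (rule ncl_cong_eqcl)
  then show ?thesis
    using euler_inequality[OF fin r s order_refl] by simp
qed

text \<open>Each c-face lacks only one link, and the rest of its cycle still connects the two ends
  of that link.\<close>

lemma eqcl_lk_omits:
  assumes "omits_one r E R"
  shows "eqcl (lk r R) = eqcl (lk r UNIV)"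
proof (rule eqcl_eqI)
    fix a b assume ab: "(a, b) \<in> lk r UNIV"
    then have b: "b = r a"
      by simp
    show "(a, b) \<in> eqcl (lk r R)"
    proof (cases "b \<in> R \<or> b \<notin> E")
      case True
      then show ?thesis
        using b r_out[of a] by (auto intro: eqcl_base)
    next
      case False
      then have "corb r b - {b} \<subseteq> R"
        using assms by (fastforce simp: omits_one_def)
      moreover have "(b, a) \<in> eqcl (gr r)"
        using b by (intro eqcl_sym[OF eqcl_base]) simp
      then have "(b, a) \<in> eqcl (lk r (corb r b - {b}))"
        unfolding corb_def by (rule eqcl_cycle_without_link[OF perms(1)])
      ultimately show ?thesis
        using eqcl_mono[OF lk_mono] by (blast intro: eqcl_sym)
    qed
qed (auto intro: eqcl_base)

lemma con_omits: "omits_one r E R \<Longrightarrow> con r s R = con r s UNIV"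
  unfolding con_def by (intro eqcl_Un_cong eqcl_lk_omits)

lemma rk_omits: "omits_one r E R \<Longrightarrow> rk E r s R = rk E r s UNIV"
  unfolding rk_def using con_omits by (intro ncl_cong_eqcl) (simp add: con_def)

lemma rk_antimono: "A \<subseteq> B \<Longrightarrow> rk E r s B \<le> rk E r s A"
  unfolding rk_def using con_mono[of A B r s] by (intro ncl_antimono fin) (simp add: con_def)

lemma rk_insert:
  assumes "r x = e"
  shows "rk E r s (insert e A) = ncl E (insert (x, e) (gr (s \<circ> r) \<union> lk r A))"
  unfolding rk_def using lk_insert[OF bij_is_inj[OF bijs(1)] assms, of A] by simp

lemma rk_insert_con: "r x = e \<Longrightarrow> (x, e) \<in> con r s A \<Longrightarrow> rk E r s (insert e A) = rk E r s A"
  by (simp add: rk_insert ncl_insert_redundant con_def) (simp add: rk_def)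

lemma rk_insert_not_con:
  assumes "r x = e" "e \<in> E" "(x, e) \<notin> con r s A"
  shows "rk E r s A = Suc (rk E r s (insert e A))"
proof -
  have "x \<in> E"
    using assms by auto
  then show ?thesis
    using assms fin by (simp add: rk_insert con_def ncl_insert) (simp add: rk_def ncl_insert)
qed

lemma rk_lower:
  assumes "A \<subseteq> E"
  shows "rk E r s {} \<le> card A + rk E r s A"
proof -
  have "finite A"
    using assms fin by (rule finite_subset)
  then show ?thesis
    using assms
  proof (induction A)
    case (insert e A)
    obtain x where "r x = e"
      using pred_ex by blast
    then have "rk E r s A \<le> Suc (rk E r s (insert e A))"
      using rk_insert_con[of x e A] rk_insert_not_con[of x e A] insert.prems by force
    then show ?case
      using insert by simp
  qed simp
qed

text \<open>Without its links into \<open>f\<close> and \<open>g\<close>, the cycle of the c-face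
  falls into two arcs. No component outside the c-face touches it twice, so nothing rejoins the
  arcs. The transposition in \<open>?r\<close> closes each arc up to a cycle of its own.\<close>

lemma c_face_cut:
  assumes H: "\<forall>x\<in>corb r f. \<forall>y\<in>corb r f. (x, y) \<in> con r s (- corb r f) \<longrightarrow> x = y"
    and g: "g \<in> corb r f" "g \<noteq> f" and x: "r x = f"
  shows "(x, f) \<notin> con r s (- {f, g})"
proof
  assume xf: "(x, f) \<in> con r s (- {f, g})"
  obtain y where y: "r y = g"
    using pred_ex by blast
  let ?H = "corb r f" and ?r = "r \<circ> transpose x y"
  have xy: "x \<noteq> y" "x \<in> ?H" "y \<in> ?H"
    using g x y corb_step_iff[of r x f] corb_step_iff[of r y f] by auto
  then have "(x, y) \<in> eqcl (gr r)"
    unfolding mem_corb by (meson eqcl_sym eqcl_trans)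
  then have nxy: "(x, y) \<notin> eqcl (gr ?r)"
    using transpose_cycles[OF perms(1) xy(1)] by auto
  have "eqcl (gr ?r) \<subseteq> eqcl (insert (x, y) (gr r \<union> {}))"
    using eqcl_transpose[of x y r "{}"] eqcl_mono[of "gr ?r" "insert (x, y) (gr ?r \<union> {})"] by auto
  then have sub: "eqcl (gr ?r) \<subseteq> eqcl (gr r)"
    using eqcl_insert_redundant[OF \<open>(x, y) \<in> eqcl (gr r)\<close>] by simp
  \<comment> \<open>the part of the map hanging on the arc from \<open>f\<close> to the edge before \<open>g\<close>, which is a cycle of \<open>?r\<close>\<close>
  define X where "X = {z. \<exists>a. (f, a) \<in> eqcl (gr ?r) \<and> (z, a) \<in> con r s (- ?H)}"
  have XH: "z \<in> X \<longleftrightarrow> (f, z) \<in> eqcl (gr ?r)" if "z \<in> ?H" for z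
  proof
    assume "z \<in> X"
    then obtain a where a: "(f, a) \<in> eqcl (gr ?r)" "(z, a) \<in> con r s (- ?H)"
      by (auto simp: X_def)
    then have "a \<in> ?H"
      using sub by (auto simp: mem_corb)
    then show "(f, z) \<in> eqcl (gr ?r)"
      using H that a by blast
  qed (auto simp: X_def con_def)
  have "(x \<in> X) = (f \<in> X)"
    using xf unfolding con_def
  proof (rule eqcl_invariant)
    fix c d assume cd: "(c, d) \<in> gr (s \<circ> r) \<union> lk r (- {f, g})"
    show "(c \<in> X) = (d \<in> X)"
    proof (cases "d = r c \<and> d \<in> ?H \<and> d \<notin> {f, g}")
      case True
      then have "c \<in> ?H" "c \<noteq> x" "c \<noteq> y"
        using corb_step_iff[of r c f] x y by auto
      then have "(c, d) \<in> gr ?r"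
        using True by simp
      then have "(f, c) \<in> eqcl (gr ?r) \<longleftrightarrow> (f, d) \<in> eqcl (gr ?r)"
        by (meson eqcl_base eqcl_sym eqcl_trans)
      then show ?thesis
        using XH \<open>c \<in> ?H\<close> True by blast
    next
      case False
      then have "(c, d) \<in> con r s (- ?H)"
        using cd unfolding con_def by (intro eqcl_base) auto
      then have "(c, a) \<in> con r s (- ?H) \<longleftrightarrow> (d, a) \<in> con r s (- ?H)" for a
        unfolding con_def by (meson eqcl_sym eqcl_trans)
      then show ?thesis
        by (simp add: X_def)
    qed
  qed
  moreover have "f \<in> X"
    using XH[of f] by simp
  ultimately have "(f, x) \<in> eqcl (gr ?r)"
    using XH xy by simp
  moreover have "(y, f) \<in> gr ?r"
    using x by simp
  ultimately show False
    using nxy by (meson eqcl_base eqcl_sym eqcl_trans)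
qed

text \<open>The three kinds are made for this exchange. On a c-face of two edges both links join the
  same two vertices; the links of loops never change the count; on the third kind each of the two
  links is a bridge as long as the other one is absent.\<close>

lemma rk_swap:
  assumes kind: "kind r s (corb r f)" and g: "g \<in> corb r f" "f \<noteq> g" and f: "f \<in> E"
    and A: "f \<notin> A" "g \<notin> A"
  shows "rk E r s (insert g A) = rk E r s (insert f A)"
proof -
  obtain x y where x: "r x = f" and y: "r y = g"
    using pred_ex by blast
  have mem: "x \<in> corb r f" "y \<in> corb r f"
    using x y g corb_step_iff[of r x f] corb_step_iff[of r y f] by auto
  have gE: "g \<in> E"
    using g corb_subset[OF r f] by auto
  consider (C) "\<forall>x\<in>corb r f. r (r x) = x" | (B) "\<forall>x\<in>corb r f. (x, r x) \<in> eqcl (gr (s \<circ> r))" |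
    (A) "\<forall>x\<in>corb r f. \<forall>y\<in>corb r f. (x, y) \<in> con r s (- corb r f) \<longrightarrow> x = y"
    using kind unfolding kind_def by blast
  then show ?thesis
  proof cases
    case C
    have "g \<in> {f, r f}"
      using g(1) corb_two[of f] C by simp
    then have "g = r f" "r g = f"
      using g C by auto
    then show ?thesis
      unfolding rk_insert[of g f A, OF \<open>r g = f\<close>] rk_insert[of f g A, OF \<open>g = r f\<close>[symmetric]]
      by (intro ncl_cong_eqcl eqcl_eqI) (auto intro: eqcl_base eqcl_sym)
  next
    case B
    then have "(x, f) \<in> con r s A" "(y, g) \<in> con r s A"
      using x y mem eqcl_subset_con by blast+
    then show ?thesis
      using x y by (simp add: rk_insert_con)
  next
    case A
    have "(x, f) \<notin> con r s A"
      using c_face_cut[OF A g(1) g(2)[symmetric] x] con_mono[of A "- {f, g}" r s] assms(5,6) by auto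
    moreover have "(y, g) \<notin> con r s A"
    proof -
      have [simp]: "corb r g = corb r f"
        using g(1) by (rule corb_eq)
      show ?thesis
        using c_face_cut[of g f y] A g y con_mono[of A "- {g, f}" r s] assms(5,6) by auto
    qed
    ultimately show ?thesis
      using rk_insert_not_con x y f gE by (metis Suc_inject)
  qed
qed

end

section \<open>Independence of the omitted edges\<close>

locale good_hypermap =
  fixes E :: "'a set" and r s :: "'a \<Rightarrow> 'a"
  assumes good: "good E r s"

sublocale good_hypermap \<subseteq> hypermap
  using good by unfold_locales (auto simp: good_def)

context good_hypermap
begin

text \<open>Exchange one omitted edge at a time: an \<open>f\<close> in \<open>R - R'\<close> is
  replaced by the edge \<open>g\<close> that \<open>R\<close> omits on the c-face of
  \<open>f\<close>. As \<open>R'\<close> omits \<open>f\<close> there, it contains \<open>g\<close>,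
  so the difference shrinks.\<close>

lemma rank_poly_omits_unique:
  assumes "omits_one r E R" "omits_one r E R'"
  shows "rank_poly R (rk E r s) = rank_poly R' (rk E r s)"
  using assms(1)
proof (induction "card (R - R')" arbitrary: R rule: less_induct)
  case less
  have finR: "finite R" "R \<subseteq> E" "R' \<subseteq> E"
    using less.prems assms(2) fin by (auto simp: omits_one_def intro: finite_subset)
  show ?case
  proof (cases "R \<subseteq> R'")
    case True
    have "R' \<subseteq> R"
    proof
      fix g assume g: "g \<in> R'"
      then obtain f where f: "f \<in> corb r g" "f \<notin> R'"
        using assms(2) finR unfolding omits_one_def by (metis subsetD)
      have "\<exists>!f. f \<in> corb r g \<and> f \<notin> R"
        using less.prems finR g by (auto simp: omits_one_def)
      then show "g \<in> R"
        using f g True by (metis corb_self subsetD)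
    qed
    then show ?thesis
      using True by auto
  next
    case False
    then obtain f where f: "f \<in> R" "f \<notin> R'"
      by blast
    then have fE: "f \<in> E"
      using finR by auto
    obtain g where g: "g \<in> corb r f" "g \<notin> R" and gu: "\<And>h. h \<in> corb r f \<Longrightarrow> h \<notin> R \<Longrightarrow> h = g"
      using less.prems fE unfolding omits_one_def by metis
    have gE: "g \<in> E"
      using g corb_subset[OF r fE] by auto
    have fg: "f \<noteq> g"
      using f g by auto
    have "g \<in> R'"
      using assms(2) fE f g fg unfolding omits_one_def by (metis corb_self)
    let ?R = "insert g (R - {f})"
    have "?R - R' = R - R' - {f}"
      using \<open>g \<in> R'\<close> by auto
    then have "card (?R - R') < card (R - R')"
      using f finR card_Diff1_less[of "R - R'" f] by simp
    moreover have "omits_one r E ?R"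
      unfolding omits_one_def
    proof (intro conjI ballI)
      show "?R \<subseteq> E"
        using finR gE by auto
      fix e assume e: "e \<in> E"
      show "\<exists>!h. h \<in> corb r e \<and> h \<notin> ?R"
      proof (cases "e \<in> corb r f")
        case True
        then have "corb r e = corb r f"
          by (rule corb_eq)
        then show ?thesis
          using gu f fg by (intro ex1I[of _ f]) auto
      next
        case False
        then have "f \<notin> corb r e" "g \<notin> corb r e"
          using corb_eq[of f r e] corb_eq[of g r e] corb_eq[OF g(1)] by auto
        moreover have "\<exists>!h. h \<in> corb r e \<and> h \<notin> R"
          using less.prems e by (simp add: omits_one_def)
        ultimately show ?thesis
          by (metis Diff_iff insert_iff singletonD)
      qed
    qed
    ultimately have "rank_poly ?R (rk E r s) = rank_poly R' (rk E r s)"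
      by (rule less.hyps)
    moreover have "rank_poly ?R (rk E r s) = rank_poly R (rk E r s)"
    proof (rule rank_poly_swap[OF finR(1) f(1) g(2)])
      fix A assume "A \<subseteq> R - {f}"
      then show "rk E r s (insert g A) = rk E r s (insert f A)"
        using g fg fE good by (intro rk_swap) (auto simp: good_def)
    qed
    ultimately show ?thesis
      by simp
  qed
qed

lemma val_eq:
  assumes "omits_one r E R"
  shows "val E r s = rank_poly R (rk E r s)"
  unfolding val_def using someI[of "omits_one r E", OF assms] assms
  by (rule rank_poly_omits_unique)

end

section \<open>Reductions\<close>

text \<open>\<open>e\<close> is the edge to be reduced. As \<open>r x = e\<close>, the cycle of
  \<open>x\<close> under \<open>s \<circ> r\<close> stands for the tail of \<open>e\<close>, and
  that of \<open>e\<close> for its head.\<close>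

locale marked = good_hypermap +
  fixes e x
  assumes e: "e \<in> E" and x: "r x = e"
begin

lemma xE: "x \<in> E" and reE: "r e \<in> E"
  using e x by auto

lemma x_eq_iff: "x = e \<longleftrightarrow> r e = e"
  using x by (metis r_eq)

abbreviation q where "q \<equiv> s \<circ> r"
text \<open>The vertex permutation of \<open>reduce1\<close> before \<open>e\<close> is erased: the
  transposition joins tail and head, or splits the vertex of a loop.\<close>

abbreviation p where "p \<equiv> s \<circ> r \<circ> transpose x e"
text \<open>The a-face permutation of the bypass before \<open>e\<close> is erased. The new edge
  keeps the name \<open>r e\<close> and takes over the tail end of \<open>e\<close>, so the values
  of \<open>s\<close> at \<open>e\<close> and \<open>r e\<close> change places.\<close>

abbreviation t where "t \<equiv> s \<circ> transpose e (r e)"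
abbreviation r' where "r' \<equiv> rm e r"
abbreviation s1 where "s1 \<equiv> rm e s"
abbreviation s2 where "s2 \<equiv> rm e t"

lemma rm_s: "s1 \<circ> r' = rm e p"
proof -
  have "inv r e = x" "inv r (r e) = e"
    using x bijs(1) by (auto simp: bij_is_inj inv_f_eq)
  then have "r' = r \<circ> transpose x e"
    using transpose_comp_eq_comp_transpose[OF bijs(1), of e "r e"] by (simp add: rm_def)
  then show ?thesis
    using x by (simp add: rm_def comp_assoc)
qed

text \<open>The transposition in \<open>t\<close> cancels against the one in \<open>r'\<close>, so
  the vertices merely lose \<open>e\<close>. This is why \<open>reduce_omega2\<close> acts as
  deletion in the undirected graph.\<close>

lemma rm_t: "s2 \<circ> r' = rm e q"
  by (simp add: rm_def comp_assoc) (simp add: comp_assoc[symmetric])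

lemma p_permutes: "p permutes E" and t_permutes: "t permutes E"
  using e xE reE sr s by (auto intro!: permutes_compose permutes_swap_id)

lemma perms_pt: "permutation p" "permutation t"
  using p_permutes t_permutes fin by (auto intro: permutes_imp_permutation)

lemma bijs_pt: "bij p" "bij t"
  using perms_pt by (auto intro: permutation_bijective)

lemma fin': "finite (E - {e})"
  using fin by simp

lemma r'_apply: "z \<noteq> e \<Longrightarrow> r' z = (if r z = e then r e else r z)"
  by (rule rm_apply[OF bijs(1)])

lemma r'_ne: "z \<noteq> e \<Longrightarrow> r' z \<noteq> e"
  using bij_rm[OF bijs(1), of e] rm_self[of e r] by (metis bij_def inj_def)

lemma hypermap1: "hypermap (E - {e}) r' s1"
  using fin r s by unfold_locales (auto intro: rm_permutes)

lemma hypermap2: "hypermap (E - {e}) r' s2"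
  using fin r t_permutes by unfold_locales (auto intro: rm_permutes)

text \<open>\<open>r'\<close> differs from \<open>r\<close> only at \<open>x\<close>, whose image
  becomes \<open>r e\<close>, and at \<open>e\<close>. Edge sets without \<open>e\<close> and
  \<open>r e\<close> do not see the difference, which explains the choice of \<open>r e\<close> as
  the omitted edge.\<close>

lemma lk_rm: "e \<notin> A \<Longrightarrow> r e \<notin> A \<Longrightarrow> lk r' A = lk r A"
proof (rule set_eqI, clarify)
  fix a b assume A: "e \<notin> A" "r e \<notin> A"
  show "(a, b) \<in> lk r' A \<longleftrightarrow> (a, b) \<in> lk r A"
  proof (cases "a = e")
    case False
    then show ?thesis
      using r'_apply[OF False] A by auto
  qed (use A in auto)
qed

lemma lk_iso: "e \<notin> A \<Longrightarrow> r e \<notin> A \<Longrightarrow> (a, b) \<in> lk r A \<Longrightarrow> a = e \<longleftrightarrow> b = e"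
  by auto

lemma gr_q_iso: "q e = e \<Longrightarrow> (a, b) \<in> gr q \<Longrightarrow> a = e \<longleftrightarrow> b = e"
  using bijs(3) by (auto simp: bij_def inj_def)

lemma corb_rm:
  assumes "z \<noteq> e"
  shows "corb r' z = corb r z - {e}"
proof -
  have "(z, e) \<notin> eqcl (gr r')"
  proof
    assume "(z, e) \<in> eqcl (gr r')"
    moreover have "a = e \<longleftrightarrow> b = e" if "(a, b) \<in> gr r'" for a b
      using that r'_ne[of a] by (cases "a = e") auto
    ultimately show False
      using eqcl_isolated[of "gr r'" e z] assms by blast
  qed
  moreover have "(z, y) \<in> eqcl (gr r') \<longleftrightarrow> (z, y) \<in> eqcl (gr r)" if "y \<noteq> e" for y
    using eqcl_rm_iff[OF bijs(1) assms that, of "{}"] by simp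
  ultimately have "(z, y) \<in> eqcl (gr r') \<longleftrightarrow> (z, y) \<in> eqcl (gr r) \<and> y \<noteq> e" for y
    by metis
  then show ?thesis
    by (auto simp: corb_def)
qed

lemma corb_fixed: "r e = e \<Longrightarrow> corb r e = {e}"
proof (rule equalityI, rule subsetI)
  fix z assume fixed: "r e = e" and z: "z \<in> corb r e"
  have "a = e \<longleftrightarrow> b = e" if "(a, b) \<in> gr r" for a b
    using that r_eq[of a e] fixed by auto
  then show "z \<in> {e}"
    using eqcl_isolated[of "gr r" e z] z by (simp add: mem_corb)
qed simp

lemma omits_rm:
  assumes "omits_one r E R" "e \<in> R \<or> r e = e"
  shows "omits_one r' (E - {e}) (R - {e})"
  unfolding omits_one_def
proof (intro conjI ballI)
  show "R - {e} \<subseteq> E - {e}"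
    using assms(1) by (auto simp: omits_one_def)
  fix f assume f: "f \<in> E - {e}"
  have "e \<in> R \<or> e \<notin> corb r f"
    using assms(2) corb_fixed corb_eq[of e r f] f by (metis DiffE corb_self)
  then have "z \<in> corb r' f \<and> z \<notin> R - {e} \<longleftrightarrow> z \<in> corb r f \<and> z \<notin> R" for z
    using f by (auto simp: corb_rm)
  then show "\<exists>!z. z \<in> corb r' f \<and> z \<notin> R - {e}"
    using assms(1) f by (auto simp: omits_one_def)
qed

text \<open>For \<open>r'\<close> the set \<open>R - {e}\<close> omits one edge on each c-face, so
  its links generate all links of \<open>r'\<close>, and \<open>- {e, r e}\<close> lies between it
  and \<open>UNIV\<close>.\<close>

lemma con_omits_rm:
  assumes "omits_one r E R" "r e \<notin> R" "r e \<noteq> e"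
  shows "eqcl (lk r (R - {e})) = eqcl (lk r (- {e, r e}))"
proof -
  have "e \<in> R"
    using assms e unfolding omits_one_def by (metis corb_self corb_step)
  then have "eqcl (lk r' (R - {e})) = eqcl (lk r' UNIV)"
    using hypermap.eqcl_lk_omits[OF hypermap1 omits_rm[OF assms(1)]] by auto
  moreover have "eqcl (lk r' (R - {e})) \<subseteq> eqcl (lk r' (- {e, r e}))"
    using assms(2) by (intro eqcl_mono lk_mono) auto
  moreover have "eqcl (lk r' (- {e, r e})) \<subseteq> eqcl (lk r' UNIV)"
    by (intro eqcl_mono lk_mono) auto
  ultimately have "eqcl (lk r' (R - {e})) = eqcl (lk r' (- {e, r e}))"
    by auto
  then show ?thesis
    using assms by (simp add: lk_rm)
qed

lemma arc:
  assumes "r e \<noteq> e"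
  shows "(r e, x) \<in> eqcl (lk r (- {e, r e}))"
proof -
  have "x \<in> corb r (r e)"
  proof -
    have "x \<in> corb r e" "r e \<in> corb r e"
      using corb_step_iff[of r x e] x by (auto intro: corb_step)
    then show ?thesis
      using corb_eq by metis
  qed
  then have "x \<in> corb r' (r e)"
    using assms x_eq_iff by (simp add: corb_rm)
  then have "(r e, x) \<in> eqcl (lk r' (corb r' (r e) - {r e}))"
    using eqcl_cycle_without_link[of r' "r e" x] rm_permutes[OF r, of e] fin'
    by (auto simp: corb_def intro: permutes_imp_permutation)
  moreover have "lk r' (corb r' (r e) - {r e}) \<subseteq> lk r (- {e, r e})"
    using assms by (subst lk_rm) (auto simp: corb_rm)
  ultimately show ?thesis
    using eqcl_mono by blast
qed

text \<open>The correction accounts for a vertex whose only incoming edge is \<open>e\<close>, which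
  disappears with \<open>e\<close>.\<close>

lemma rk2:
  assumes "e \<notin> A" "r e \<notin> A"
  shows "rk (E - {e}) r' s2 A + (if q e = e then 1 else 0) = rk E r s A"
proof -
  have "rk (E - {e}) r' s2 A = ncl (E - {e}) (gr (rm e q) \<union> lk r A)"
    unfolding rk_def rm_t lk_rm[OF assms] ..
  moreover have "q e \<in> E"
    using e by simp
  then have "q e \<noteq> e \<Longrightarrow> ncl (E - {e}) (gr (rm e q) \<union> lk r A) = ncl E (gr q \<union> lk r A)"
    using lk_iso[OF assms] by (intro ncl_rm fin e bijs(3))
  moreover have "q e = e \<Longrightarrow> Suc (ncl (E - {e}) (gr (rm e q) \<union> lk r A)) = ncl E (gr q \<union> lk r A)"
    using lk_iso[OF assms] by (intro ncl_rm_fixed fin e bijs(3))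
  ultimately show ?thesis
    unfolding rk_def by (simp split: if_splits)
qed

lemma eqcl_p: "eqcl (insert (x, e) (gr p \<union> P)) = eqcl (insert (x, e) (gr q \<union> P))"
  by (rule eqcl_transpose)

lemma p_e: "p e = s e"
  using x by simp

lemma ncl_p:
  "ncl E (insert (x, e) (gr p \<union> lk r A)) = rk E r s (insert e A)"
  unfolding rk_insert[OF x] by (rule ncl_cong_eqcl[OF eqcl_p])

text \<open>The correction concerns an \<omega>-loop, where \<open>p\<close> fixes \<open>e\<close>:
  one of the two vertices obtained by splitting has no edge-end left and disappears.\<close>

lemma rk1_eq: "e \<notin> A \<Longrightarrow> r e \<notin> A \<Longrightarrow>
  rk (E - {e}) r' s1 A + (if s e = e then 1 else 0) = ncl E (gr p \<union> lk r A)"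
proof -
  assume A: "e \<notin> A" "r e \<notin> A"
  have "rk (E - {e}) r' s1 A = ncl (E - {e}) (gr (rm e p) \<union> lk r A)"
    unfolding rk_def rm_s lk_rm[OF A] ..
  moreover have "p e \<in> E"
    using e by (simp add: x)
  then have "p e \<noteq> e \<Longrightarrow> ncl (E - {e}) (gr (rm e p) \<union> lk r A) = ncl E (gr p \<union> lk r A)"
    using lk_iso[OF A] by (intro ncl_rm fin e bijs_pt(1))
  moreover have "p e = e \<Longrightarrow> Suc (ncl (E - {e}) (gr (rm e p) \<union> lk r A)) = ncl E (gr p \<union> lk r A)"
    using lk_iso[OF A] by (intro ncl_rm_fixed fin e bijs_pt(1))
  ultimately show ?thesis
    unfolding p_e by (simp split: if_splits)
qed

lemma s_e_fixed_loop: "s e = e \<Longrightarrow> (x, e) \<in> eqcl (gr q)"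
  using x by (auto intro!: eqcl_base)

lemma rk1_contract:
  assumes "e \<notin> A" "r e \<notin> A" "(x, e) \<notin> eqcl (gr q)"
  shows "rk (E - {e}) r' s1 A = rk E r s (insert e A)"
proof -
  have "x \<noteq> e"
    using assms(3) by auto
  then have "(x, e) \<in> eqcl (gr p)"
    using transpose_cycles[OF perms(3)] assms(3) by auto
  then have "(x, e) \<in> eqcl (gr p \<union> lk r A)"
    using eqcl_mono[of "gr p"] by auto
  then show ?thesis
    using rk1_eq[OF assms(1,2)] s_e_fixed_loop assms(3) ncl_p[of A]
    by (simp add: ncl_insert_redundant split: if_splits)
qed

lemma rk1_split:
  assumes "e \<notin> A" "r e \<notin> A" "(x, e) \<notin> eqcl (gr p \<union> lk r A)"
  shows "rk (E - {e}) r' s1 A + (if s e = e then 1 else 0) = Suc (rk E r s (insert e A))"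
  using rk1_eq[OF assms(1,2)] ncl_insert[OF fin xE e assms(3)] ncl_p[of A] by simp

section \<open>Euler counts and planarity of the reduced maps\<close>

lemma z_r: "r e \<noteq> e \<Longrightarrow> ncl (E - {e}) (gr r') = ncl E (gr r)"
  using ncl_rm[OF fin e reE bijs(1), of "{}"] by simp

lemma z_s1: "ncl (E - {e}) (gr s1) + (if s e = e then 1 else 0) = ncl E (gr s)"
  using ncl_rm[OF fin e _ bijs(2), of "{}"] ncl_rm_fixed[OF fin e bijs(2), of "{}"] e by auto

lemma z_q1: "ncl (E - {e}) (gr (s1 \<circ> r')) + (if s e = e then 1 else 0) = ncl E (gr p)"
  using rk1_eq[of "{}"] by (simp add: rk_def)

lemma planarity: "ncl E (gr r) + ncl E (gr s) + ncl E (gr q) = card E + 2 * rk E r s UNIV"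
  using good by (simp add: good_def planar_def)

lemma card_E: "card E = Suc (card (E - {e}))"
  using fin e by (rule card.remove)

text \<open>This is the Jordan curve property of the plane: if splitting the vertex of a loop did not
  disconnect the map, the genus would become negative.\<close>

lemma loop_separates:
  assumes re: "r e \<noteq> e" and loop: "(x, e) \<in> eqcl (gr q)"
  shows "(x, e) \<notin> eqcl (gr p \<union> lk r (- {e, r e}))"
proof
  assume conn: "(x, e) \<in> eqcl (gr p \<union> lk r (- {e, r e}))"
  have xe: "x \<noteq> e"
    using re x_eq_iff by simp
  show False
  proof (cases "s e = e")
    case True
    have "a = e \<longleftrightarrow> b = e" if "(a, b) \<in> gr p \<union> lk r (- {e, r e})" for a b
      using that lk_iso[of "- {e, r e}" a b] p_e True bijs_pt(1)
      by (auto simp: bij_def inj_def simp del: comp_apply)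
    then show False
      using eqcl_isolated[of "gr p \<union> lk r (- {e, r e})" e x] conn xe by auto
  next
    case False
    obtain R where R: "omits_one r E R" "r e \<notin> R"
      using omits_one_exists[OF fin r reE] by auto
    then have "e \<in> R"
      using re e unfolding omits_one_def by (metis corb_self corb_step)
    have "(x, e) \<in> eqcl (gr p \<union> lk r (R - {e}))"
      using conn eqcl_Un_cong[OF con_omits_rm[OF R re]] by auto
    then have "rk (E - {e}) r' s1 (R - {e}) = rk E r s (insert e (R - {e}))"
      using rk1_eq[of "R - {e}"] ncl_p[of "R - {e}"] R(2) False by (simp add: ncl_insert_redundant)
    then have k: "rk (E - {e}) r' s1 UNIV = rk E r s UNIV"
      using hypermap.rk_omits[OF hypermap1 omits_rm[OF R(1)]] rk_omits[OF R(1)] \<open>e \<in> R\<close>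
      by (simp add: insert_absorb)
    have "ncl (E - {e}) (gr (s1 \<circ> r')) = Suc (ncl E (gr q))"
      using z_q1 False ncl_transpose_split[OF perms(3) fin xE e xe loop] by simp
    \<comment> \<open>One vertex more and one edge fewer, with faces and components unchanged,
      exceeds the Euler inequality by two.\<close>
    then show False
      using hypermap.euler[OF hypermap1] planarity card_E z_r[OF re] z_s1 False k by simp
  qed
qed

text \<open>Contracting a non-loop costs an edge and a vertex. Splitting at a loop costs an edge and
  gains a vertex and a component. For an \<omega>-loop the split-off vertex vanishes again, together
  with an a-face of one edge.\<close>

lemma planar1:
  assumes re: "r e \<noteq> e"
  shows "planar (E - {e}) r' s1"
proof -
  obtain R where R: "omits_one r E R" "r e \<notin> R"
    using omits_one_exists[OF fin r reE] by auto
  then have eR: "e \<in> R"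
    using re e unfolding omits_one_def by (metis corb_self corb_step)
  have RR: "insert e (R - {e}) = R" "R - {e} \<subseteq> - {e, r e}"
    using eR R(2) by auto
  have k: "rk (E - {e}) r' s1 UNIV = rk (E - {e}) r' s1 (R - {e})" "rk E r s UNIV = rk E r s R"
    using hypermap.rk_omits[OF hypermap1 omits_rm[OF R(1)]] rk_omits[OF R(1)] eR by auto
  have xe: "x \<noteq> e"
    using re x_eq_iff by simp
  show ?thesis
  proof (cases "(x, e) \<in> eqcl (gr q)")
    case False
    then have "s e \<noteq> e"
      using s_e_fixed_loop by auto
    moreover have "Suc (ncl E (gr p)) = ncl E (gr q)"
      using ncl_transpose_join[OF perms(3) fin xE e False] by simp
    moreover have "rk (E - {e}) r' s1 (R - {e}) = rk E r s R"
      using rk1_contract[of "R - {e}"] False R(2) RR by simp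
    ultimately show ?thesis
      unfolding planar_def using planarity card_E z_r[OF re] z_s1 z_q1 k by simp
  next
    case True
    have "eqcl (gr p \<union> lk r (R - {e})) \<subseteq> eqcl (gr p \<union> lk r (- {e, r e}))"
      using RR by (intro eqcl_mono Un_mono lk_mono) auto
    then have "(x, e) \<notin> eqcl (gr p \<union> lk r (R - {e}))"
      using loop_separates[OF re True] by blast
    then have "rk (E - {e}) r' s1 (R - {e}) + (if s e = e then 1 else 0) = Suc (rk E r s R)"
      using rk1_split[of "R - {e}"] R(2) unfolding RR(1) by simp
    moreover have "ncl E (gr p) = Suc (ncl E (gr q))"
      using ncl_transpose_split[OF perms(3) fin xE e xe True] by simp
    ultimately show ?thesis
      unfolding planar_def using planarity card_E z_r[OF re] z_s1 z_q1 k
      by (simp split: if_splits)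
  qed
qed

lemma z_s2: "ncl (E - {e}) (gr s2) + (if q e = e then 1 else 0) = ncl E (gr t)"
proof -
  have t: "t e = q e" "t e \<in> E"
    using e by auto
  then show ?thesis
    using ncl_rm[OF fin e t(2) bijs_pt(2), of "{}"] ncl_rm_fixed[OF fin e bijs_pt(2), of "{}"]
    by (auto simp del: comp_apply)
qed

lemma z_q2: "ncl (E - {e}) (gr (s2 \<circ> r')) + (if q e = e then 1 else 0) = ncl E (gr q)"
  using rk2[of "{}"] by (simp add: rk_def)

text \<open>
  If the incidence of \<open>e\<close> with its head is a bridge, the face walk that leaves the part beyond
  the bridge does so along \<open>e\<close>.  So the same a-face lies on both sides of the bridge.
\<close>

lemma bridge_same_a_face:
  assumes re: "r e \<noteq> e" and bridge: "(x, e) \<notin> con r s (- {e, r e})"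
  shows "(e, r e) \<in> eqcl (gr s)"
proof (rule ccontr)
  assume "(e, r e) \<notin> eqcl (gr s)"
  then have not_e: "e \<notin> orbit s (r e)"
    by (metis eqcl_gr_iff_orbit eqcl_sym perms(2))
  define X where "X = {z. (e, z) \<in> con r s (- {e, r e})}"
  have X: "w \<in> X \<longleftrightarrow> z \<in> X" if "(w, z) \<in> con r s (- {e, r e})" for w z
    using that unfolding X_def con_def by (auto intro: eqcl_trans eqcl_sym)
  have "(r e, x) \<in> con r s (- {e, r e})"
    using arc[OF re] eqcl_mono[of _ "gr q \<union> lk r (- {e, r e})"] unfolding con_def by blast
  then have re_X: "r e \<notin> X"
    using X[of "r e" x] bridge by (auto simp: X_def con_def intro: eqcl_sym)
  have "z \<in> X" if "z \<in> orbit s (r e)" for z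
    using that
  proof induction
    case base
    show ?case
      by (auto simp: X_def con_def intro: eqcl_base)
  next
    case (step y)
    obtain w where w: "r w = y"
      using pred_ex by blast
    have "y \<noteq> e" "y \<noteq> r e"
      using step re_X not_e by auto
    then have "(w, y) \<in> con r s (- {e, r e})" "(w, s y) \<in> con r s (- {e, r e})"
      using w by (auto simp: con_def intro!: eqcl_base)
    then show ?case
      using X step by blast
  qed
  then show False
    using re_X permutation_self_in_orbit[OF perms(2), of "r e"] by auto
qed

text \<open>The head of \<open>e\<close> has no incoming edge besides \<open>e\<close> and no
  outgoing edge besides \<open>r e\<close>, so without these two links it is isolated.\<close>

lemma one_loop_bridge:
  assumes qe: "q e = e" and re: "r e \<noteq> e"
  shows "(x, e) \<notin> con r s (- {e, r e})"
proof
  assume "(x, e) \<in> con r s (- {e, r e})"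
  moreover have "a = e \<longleftrightarrow> b = e" if "(a, b) \<in> gr q \<union> lk r (- {e, r e})" for a b
    using that gr_q_iso[OF qe, of a b] lk_iso[of "- {e, r e}" a b] by auto
  ultimately have "x = e"
    using eqcl_isolated[of "gr q \<union> lk r (- {e, r e})" e x] unfolding con_def by blast
  then show False
    using re x_eq_iff by simp
qed

text \<open>At a bridge the bypass adds a component and splits an a-face. At a non-bridge it either
  merges two a-faces, which balances the lost edge, or splits one, which the Euler inequality
  forbids.\<close>

lemma planar2: "planar (E - {e}) r' s2"
proof (cases "r e = e")
  case True
  obtain R where R: "omits_one r E R"
    using omits_one_exists[OF fin r e] by auto
  then have eR: "e \<notin> R"
    using e corb_fixed[OF True] by (auto simp: omits_one_def)
  have "rk (E - {e}) r' s2 UNIV = rk (E - {e}) r' s2 R" "rk E r s UNIV = rk E r s R"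
    using hypermap.rk_omits[OF hypermap2 omits_rm[OF R]] rk_omits[OF R] eR True by auto
  moreover have "Suc (ncl (E - {e}) (gr r')) = ncl E (gr r)"
    using ncl_rm_fixed[OF fin e bijs(1) True, of "{}"] by simp
  moreover have "t = s"
    using True by simp
  ultimately show ?thesis
    unfolding planar_def using planarity card_E z_s2 z_q2 rk2[OF eR] eR True
    by (simp split: if_splits)
next
  case re: False
  obtain R where R: "omits_one r E R" "r e \<notin> R"
    using omits_one_exists[OF fin r reE] by auto
  then have eR: "e \<in> R"
    using re e unfolding omits_one_def by (metis corb_self corb_step)
  have RR: "insert e (R - {e}) = R"
    using eR by auto
  have k: "rk (E - {e}) r' s2 UNIV = rk (E - {e}) r' s2 (R - {e})" "rk E r s UNIV = rk E r s R"
    using hypermap.rk_omits[OF hypermap2 omits_rm[OF R(1)]] rk_omits[OF R(1)] eR by auto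
  have con: "con r s (R - {e}) = con r s (- {e, r e})"
    unfolding con_def by (rule eqcl_Un_cong[OF con_omits_rm[OF R re]])
  have k2: "rk (E - {e}) r' s2 (R - {e}) + (if q e = e then 1 else 0) = rk E r s (R - {e})"
    using rk2[of "R - {e}"] R(2) by auto
  have euler2: "ncl (E - {e}) (gr r') + ncl (E - {e}) (gr s2) + ncl (E - {e}) (gr (s2 \<circ> r')) \<le>
      card (E - {e}) + 2 * rk (E - {e}) r' s2 UNIV"
    by (rule hypermap.euler[OF hypermap2])
  show ?thesis
  proof (cases "(x, e) \<in> con r s (- {e, r e})")
    case False
    have "rk E r s (R - {e}) = Suc (rk E r s R)"
      using rk_insert_not_con[OF x e, of "R - {e}"] con RR False by simp
    moreover have "ncl E (gr t) = Suc (ncl E (gr s))"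
      using bridge_same_a_face[OF re False] re
      by (intro ncl_transpose_split[OF perms(2) fin e reE]) auto
    ultimately show ?thesis
      unfolding planar_def using planarity card_E z_s2 z_q2 z_r[OF re] k k2
      by (simp split: if_splits)
  next
    case True
    have "rk E r s (R - {e}) = rk E r s R"
      using rk_insert_con[OF x, of "R - {e}"] con RR True by simp
    moreover have "q e \<noteq> e"
      using one_loop_bridge[OF _ re] True by blast
    moreover have "ncl E (gr s) = Suc (ncl E (gr t)) \<or> ncl E (gr t) = Suc (ncl E (gr s))"
      using ncl_transpose_join[OF perms(2) fin e reE]
        ncl_transpose_split[OF perms(2) fin e reE] re by metis
    ultimately show ?thesis
      unfolding planar_def using planarity card_E z_s2 z_q2 z_r[OF re] k k2 euler2 by simp
  qed
qed

section \<open>The kinds of c-faces under a reduction\<close>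

lemma eqcl_gr_q'_subset:
  assumes "s' \<circ> r' = rm e q \<or> s' \<circ> r' = rm e p"
  shows "eqcl (gr (s' \<circ> r')) \<subseteq> eqcl (insert (x, e) (gr q))"
proof -
  have "eqcl (gr (rm e q)) \<subseteq> eqcl (insert (x, e) (gr q))"
    using eqcl_rm_subset[OF bijs(3), of e "{}"] eqcl_mono[of "gr q" "insert (x, e) (gr q)"] by auto
  moreover have "eqcl (gr (rm e p)) \<subseteq> eqcl (insert (x, e) (gr q))"
    using eqcl_rm_subset[OF bijs_pt(1), of e "{}"] eqcl_mono[of "gr p" "insert (x, e) (gr p)"]
      eqcl_p[of "{}"] by auto
  ultimately show ?thesis
    using assms by metis
qed

text \<open>A reduction at most identifies the two ends of \<open>e\<close> or replaces the links
  into \<open>e\<close> and \<open>r e\<close> by one. As \<open>e\<close> is not on the c-face of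
  \<open>f\<close>, these links are available outside it anyway, and no new connection
  arises.\<close>

lemma con_rm_subset:
  assumes H: "e \<notin> corb r f" and q': "s' \<circ> r' = rm e q \<or> s' \<circ> r' = rm e p"
  shows "con r' s' (- corb r f) \<subseteq> con r s (- corb r f)"
  unfolding con_def
proof (rule eqcl_least)
  let ?Q = "gr q \<union> lk r (- corb r f)"
  fix a b assume "(a, b) \<in> gr (s' \<circ> r') \<union> lk r' (- corb r f)"
  then consider "(a, b) \<in> eqcl (gr (s' \<circ> r'))" | "b = r' a" "b \<notin> corb r f"
    using eqcl_base[of a b "gr (s' \<circ> r')"] by auto
  then show "(a, b) \<in> eqcl ?Q"
  proof cases
    case 1
    have "insert (x, e) (gr q) \<subseteq> ?Q"
      using x H by auto
    then show ?thesis
      using 1 eqcl_gr_q'_subset[OF q'] eqcl_mono by blast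
  next
    case 2
    show ?thesis
    proof (cases "a = e")
      case False
      show ?thesis
      proof (cases "r a = e")
        case True
        then have "(a, e) \<in> ?Q" "(e, r e) \<in> ?Q" "b = r e"
          using 2 H False by (auto simp: r'_apply corb_step_iff)
        then show ?thesis
          by (meson eqcl_base eqcl_trans)
      next
        case ra: False
        then show ?thesis
          using 2 False by (auto simp: r'_apply intro!: eqcl_base)
      qed
    qed (simp add: 2)
  qed
qed

lemma con_rm_t_subset:
  assumes H: "e \<in> corb r f"
  shows "con r' s2 (- (corb r f - {e})) \<subseteq> con r s (- corb r f)"
  unfolding con_def
proof (rule eqcl_least)
  let ?Q = "gr q \<union> lk r (- corb r f)"
  fix a b assume "(a, b) \<in> gr (s2 \<circ> r') \<union> lk r' (- (corb r f - {e}))"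
  then consider "(a, b) \<in> eqcl (gr (rm e q))" | "b = r' a" "b \<notin> corb r f - {e}"
    unfolding rm_t using eqcl_base[of a b "gr (rm e q)"] by auto
  then show "(a, b) \<in> eqcl ?Q"
  proof cases
    case 1
    then show ?thesis
      using eqcl_rm_subset[OF bijs(3), of e "{}"] eqcl_mono[of "gr q" ?Q] by auto
  next
    case 2
    show ?thesis
    proof (cases "a = e")
      case False
      then have "b \<noteq> e" "b \<notin> corb r f"
        using 2 r'_ne by auto
      moreover have "r a \<noteq> e"
        using 2 False H corb_step[OF H] \<open>b \<notin> corb r f\<close> by (auto simp: r'_apply)
      ultimately show ?thesis
        using 2 False by (auto simp: r'_apply intro!: eqcl_base)
    qed (simp add: 2)
  qed
qed

lemma loop_kind_q:
  assumes loops: "\<forall>z\<in>corb r f. (z, r z) \<in> eqcl (gr q)" and z: "z \<in> corb r f" "z \<noteq> e"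
  shows "(z, r' z) \<in> eqcl (gr q)"
proof (cases "r z = e")
  case True
  then have "(z, e) \<in> eqcl (gr q)" "(e, r e) \<in> eqcl (gr q)"
    using loops z corb_step[OF z(1)] by auto
  then show ?thesis
    using True z(2) by (auto simp: r'_apply intro: eqcl_trans)
qed (use loops z in \<open>auto simp: r'_apply\<close>)

text \<open>A loop on the c-face remains a loop when the vertex of \<open>e\<close> is split.
  Otherwise it would connect the two parts of the split vertex without using \<open>e\<close> or
  \<open>r e\<close>, against \<open>loop_separates\<close>.\<close>

lemma loop_kind_p:
  assumes loops: "\<forall>z\<in>corb r f. (z, r z) \<in> eqcl (gr q)" and z: "z \<in> corb r f" "z \<noteq> e"
  shows "(z, r' z) \<in> eqcl (gr p)"
proof (rule ccontr)
  assume neg: "(z, r' z) \<notin> eqcl (gr p)"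
  have zq: "(z, r' z) \<in> eqcl (gr q)"
    using loops z by (rule loop_kind_q)
  then have xe: "x \<noteq> e"
    using neg by auto
  then have re: "r e \<noteq> e"
    using x_eq_iff by simp
  have "(z, r' z) \<in> eqcl (insert (x, e) (gr p))"
    using zq eqcl_p[of "{}"] eqcl_mono[of "gr q" "insert (x, e) (gr q)"] by auto
  then have split: "(z, x) \<in> eqcl (gr p) \<and> (e, r' z) \<in> eqcl (gr p) \<or>
      (z, e) \<in> eqcl (gr p) \<and> (x, r' z) \<in> eqcl (gr p)"
    using neg eqcl_insert_cases[of z "r' z" x e "gr p"] by blast
  then have "(x, e) \<notin> eqcl (gr p)"
    using neg by (meson eqcl_sym eqcl_trans)
  then have loop: "(x, e) \<in> eqcl (gr q)"
    using transpose_cycles[OF perms(3) xe] by simp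
  let ?P = "gr p \<union> lk r (- {e, r e})"
  \<comment> \<open>The new link of \<open>z\<close> is an old one different from those into
    \<open>e\<close> and \<open>r e\<close>, except for \<open>z = x\<close>, where the arc from
    \<open>r e\<close> to \<open>x\<close> replaces it.\<close>
  have "(z, r' z) \<in> eqcl ?P"
  proof (cases "r z = e")
    case True
    then have "z = x" "r' z = r e"
      using x z(2) by (auto simp: r'_apply)
    then show ?thesis
      using arc[OF re] eqcl_mono[of "lk r (- {e, r e})" ?P] by (auto intro: eqcl_sym)
  qed (use z(2) in \<open>auto simp: r'_apply intro!: eqcl_base\<close>)
  moreover have "eqcl (gr p) \<subseteq> eqcl ?P"
    by (rule eqcl_mono) simp
  ultimately have "(x, e) \<in> eqcl ?P"
    using split by (meson eqcl_sym eqcl_trans subsetD)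
  then show False
    using loop_separates[OF re loop] by simp
qed

lemma edge_kind_rm:
  assumes "\<forall>z\<in>corb r f. r (r z) = z" "z \<in> corb r f - {e}"
  shows "r' (r' z) = z"
proof (cases "r z = e")
  case True
  then have "r e = z"
    using assms by auto
  then show ?thesis
    using True assms by (auto simp: r'_apply)
next
  case False
  then show ?thesis
    using assms by (auto simp: r'_apply)
qed

lemma good_f: "f \<in> E \<Longrightarrow> kind r s (corb r f)"
  using good by (simp add: good_def)

lemma good2: "good (E - {e}) r' s2"
  unfolding good_def
proof (intro conjI ballI)
  show "finite (E - {e})" "r' permutes E - {e}" "s2 permutes E - {e}"
    using fin' r t_permutes by (auto intro: rm_permutes)
  show "planar (E - {e}) r' s2"
    by (rule planar2)
  fix f assume f: "f \<in> E - {e}"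
  have H: "corb r' f = corb r f - {e}"
    using f by (simp add: corb_rm)
  consider (C) "\<forall>z\<in>corb r f. r (r z) = z" | (B) "\<forall>z\<in>corb r f. (z, r z) \<in> eqcl (gr q)" |
    (A) "\<forall>z\<in>corb r f. \<forall>y\<in>corb r f. (z, y) \<in> con r s (- corb r f) \<longrightarrow> z = y"
    using good_f[of f] f unfolding kind_def by blast
  then show "kind r' s2 (corb r' f)"
  proof cases
    case C
    then show ?thesis
      using edge_kind_rm by (simp add: kind_def H)
  next
    case B
    have "(z, r' z) \<in> eqcl (gr (s2 \<circ> r'))" if "z \<in> corb r f" "z \<noteq> e" for z
      unfolding rm_t
      using eqcl_rm_iff[OF bijs(3) that(2) r'_ne[OF that(2)], of "{}"] loop_kind_q[OF B that]
      by simp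
    then show ?thesis
      by (auto simp: kind_def H)
  next
    case A
    have "con r' s2 (- (corb r f - {e})) \<subseteq> con r s (- corb r f)"
    proof (cases "e \<in> corb r f")
      case True
      then show ?thesis
        by (rule con_rm_t_subset)
    next
      case False
      then show ?thesis
        using con_rm_subset[OF False, of s2] rm_t by (simp add: Diff_triv)
    qed
    then show ?thesis
      using A unfolding kind_def H by blast
  qed
qed

text \<open>The hypothesis covers all cases in which the recursion uses \<open>reduce1\<close>:
  loops, and edges of c-faces with at most two edges.\<close>

lemma good1:
  assumes "(x, e) \<in> eqcl (gr q) \<or> r (r e) = e"
  shows "good (E - {e}) r' s1"
proof (cases "r e = e")
  case True
  then show ?thesis
    using good2 by simp
next
  case re: False
  show ?thesis
    unfolding good_def
  proof (intro conjI ballI)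
    show "finite (E - {e})" "r' permutes E - {e}" "s1 permutes E - {e}"
      using fin' r s by (auto intro: rm_permutes)
    show "planar (E - {e}) r' s1"
      using re by (rule planar1)
    fix f assume f: "f \<in> E - {e}"
    have H: "corb r' f = corb r f - {e}"
      using f by (simp add: corb_rm)
    consider (C) "\<forall>z\<in>corb r f. r (r z) = z" | (B) "\<forall>z\<in>corb r f. (z, r z) \<in> eqcl (gr q)" |
      (A) "\<forall>z\<in>corb r f. \<forall>y\<in>corb r f. (z, y) \<in> con r s (- corb r f) \<longrightarrow> z = y"
      using good_f[of f] f unfolding kind_def by blast
    then show "kind r' s1 (corb r' f)"
    proof cases
      case C
      then show ?thesis
        using edge_kind_rm by (simp add: kind_def H)
    next
      case B
      have "(z, r' z) \<in> eqcl (gr (s1 \<circ> r'))" if "z \<in> corb r f" "z \<noteq> e" for z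
        unfolding rm_s
        using eqcl_rm_iff[OF bijs_pt(1) that(2) r'_ne[OF that(2)], of "{}"] loop_kind_p[OF B that]
        by simp
      then show ?thesis
        by (auto simp: kind_def H)
    next
      case A
      show ?thesis
      proof (cases "e \<in> corb r f")
        case True
        \<comment> \<open>On a c-face of the third kind different edges have different heads, so
          \<open>e\<close> is no loop. The hypothesis leaves a c-face of two edges, of which one
          edge remains.\<close>
        have "x \<in> corb r f"
          using True x corb_step_iff[of r x f] by simp
        then have "(x, e) \<notin> eqcl (gr q)"
          using A True re x_eq_iff eqcl_subset_con by blast
        then have "r (r e) = e"
          using assms by simp
        then have "x = r e"
          using x by (metis r_eq)
        have "corb r f = {e, r e}"
          using corb_two[OF \<open>r (r e) = e\<close>] corb_eq[OF True] by simp
        then show ?thesis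
          using re \<open>r (r e) = e\<close> by (simp add: kind_def H r'_apply)
      next
        case False
        then show ?thesis
          using con_rm_subset[OF False, of s1] rm_s A unfolding kind_def H
          by (simp add: Diff_triv) blast
      qed
    qed
  qed
qed

section \<open>Recursion equations for the rank polynomial\<close>

lemma omits_re:
  assumes "r e \<noteq> e"
  obtains R where "omits_one r E R" "r e \<notin> R" "e \<in> R" "finite R" "R \<subseteq> E"
    "omits_one r' (E - {e}) (R - {e})"
proof -
  obtain R where R: "omits_one r E R" "r e \<notin> R"
    using omits_one_exists[OF fin r reE] by auto
  then have "e \<in> R"
    using assms e unfolding omits_one_def by (metis corb_self corb_step)
  moreover have "R \<subseteq> E"
    using R by (simp add: omits_one_def)
  ultimately show ?thesis
    using that[OF R] omits_rm[OF R(1)] fin finite_subset by auto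
qed

text \<open>The edge of a one-edge c-face is the omitted one, so the undirected graph at most loses
  an isolated vertex.\<close>

lemma val_rm_fixed:
  assumes "r e = e"
  shows "val (E - {e}) r' s1 = val E r s"
proof -
  interpret two: good_hypermap "E - {e}" r' s2
    using good2 by unfold_locales
  obtain R where R: "omits_one r E R"
    using omits_one_exists[OF fin r e] by auto
  then have eR: "e \<notin> R"
    using e corb_fixed[OF assms] by (auto simp: omits_one_def)
  have "rank_poly R (rk (E - {e}) r' s2) = rank_poly R (rk E r s)"
  proof (rule rank_poly_shift)
    fix A assume "A \<subseteq> R"
    then have "e \<notin> A" "r e \<notin> A"
      using eR assms by auto
    then show "rk (E - {e}) r' s2 A + (if q e = e then 1 else 0) = rk E r s A + 0"
      using rk2 by simp
  qed
  then show ?thesis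
    using two.val_eq[OF omits_rm[OF R]] val_eq[OF R] eR assms by simp
qed

lemma rank_poly2:
  assumes "R \<subseteq> - {e, r e}"
  shows "rank_poly R (rk (E - {e}) r' s2) = rank_poly R (rk E r s)"
proof (rule rank_poly_shift)
  fix A assume "A \<subseteq> R"
  then have "e \<notin> A" "r e \<notin> A"
    using assms by auto
  then show "rk (E - {e}) r' s2 A + (if q e = e then 1 else 0) = rk E r s A + 0"
    using rk2[of A] by simp
qed

text \<open>The hypothesis speaks of the largest edge set without \<open>e\<close> and
  \<open>r e\<close>, so \<open>e\<close> is a bridge relative to every edge set in the rank
  polynomial.\<close>

lemma val_bridge:
  assumes re: "r e \<noteq> e" and bridge: "(x, e) \<notin> con r s (- {e, r e})"
  shows "val E r s = var_x * val (E - {e}) r' s2"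
proof -
  interpret two: good_hypermap "E - {e}" r' s2
    using good2 by unfold_locales
  from omits_re[OF re] obtain R where R: "omits_one r E R" "r e \<notin> R" "e \<in> R" "finite R" "R \<subseteq> E"
    "omits_one r' (E - {e}) (R - {e})" .
  have R': "R - {e} \<subseteq> - {e, r e}"
    using R(2) by auto
  have "rank_poly R (rk E r s) = var_x * rank_poly (R - {e}) (rk E r s)"
  proof (rule rank_poly_bridge[OF R(4,3)])
    fix A assume "A \<subseteq> R - {e}"
    then have "con r s A \<subseteq> con r s (- {e, r e})"
      using R(2) by (intro con_mono) auto
    then show "rk E r s A = Suc (rk E r s (insert e A))"
      using bridge by (intro rk_insert_not_con[OF x e]) auto
  qed (rule rk_antimono)
  then show ?thesis
    using val_eq[OF R(1)] two.val_eq[OF R(6)] rank_poly2[OF R'] by simp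
qed

text \<open>Splitting the vertex of the loop gives one more component for every edge set alike, less
  a vertex that may disappear. The rank polynomial ignores this constant.\<close>

lemma val_loop:
  assumes re: "r e \<noteq> e" and loop: "(x, e) \<in> eqcl (gr q)"
  shows "val E r s = var_y * val (E - {e}) r' s1"
proof -
  interpret one: good_hypermap "E - {e}" r' s1
    using good1 loop by unfold_locales simp
  from omits_re[OF re] obtain R where R: "omits_one r E R" "r e \<notin> R" "e \<in> R" "finite R" "R \<subseteq> E"
    "omits_one r' (E - {e}) (R - {e})" .
  have ins: "rk E r s (insert e A) = rk E r s A" for A
    using loop eqcl_subset_con by (intro rk_insert_con[OF x]) auto
  have "rank_poly R (rk E r s) = var_y * rank_poly (R - {e}) (rk E r s)"
    using ins R by (intro rank_poly_loop) (auto intro!: rk_lower)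
  moreover have "rank_poly (R - {e}) (rk (E - {e}) r' s1) = rank_poly (R - {e}) (rk E r s)"
  proof (rule rank_poly_shift)
    fix A assume A: "A \<subseteq> R - {e}"
    then have "eqcl (gr p \<union> lk r A) \<subseteq> eqcl (gr p \<union> lk r (- {e, r e}))"
      using R(2) by (intro eqcl_mono Un_mono lk_mono) auto
    then have "(x, e) \<notin> eqcl (gr p \<union> lk r A)"
      using loop_separates[OF re loop] by blast
    moreover have rk_A: "e \<notin> A" "r e \<notin> A"
      using A R(2) by auto
    ultimately show "rk (E - {e}) r' s1 A + (if s e = e then 1 else 0) = rk E r s A + 1"
      using rk1_split[of A] rk_A ins by simp
  qed
  ultimately show ?thesis
    using val_eq[OF R(1)] one.val_eq[OF R(6)] by simp
qed

lemma val_sum: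
  assumes re: "r e \<noteq> e" and edge: "r (r e) = e" and nonloop: "(x, e) \<notin> eqcl (gr q)"
    and nonbridge: "(x, e) \<in> con r s (- {e, r e})"
  shows "val E r s = val (E - {e}) r' s1 + val (E - {e}) r' s2"
proof -
  interpret one: good_hypermap "E - {e}" r' s1
    using good1 edge by unfold_locales simp
  interpret two: good_hypermap "E - {e}" r' s2
    using good2 by unfold_locales
  from omits_re[OF re] obtain R where R: "omits_one r E R" "r e \<notin> R" "e \<in> R" "finite R" "R \<subseteq> E"
    "omits_one r' (E - {e}) (R - {e})" .
  have RR: "insert e (R - {e}) = R" and R': "R - {e} \<subseteq> - {e, r e}"
    using R by auto
  have "con r s (R - {e}) = con r s (- {e, r e})"
    unfolding con_def by (rule eqcl_Un_cong[OF con_omits_rm[OF R(1,2) re]])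
  then have "rk E r s (R - {e}) = rk E r s R"
    using rk_insert_con[OF x, of "R - {e}"] nonbridge RR by simp
  moreover have "rk E r s {} = Suc (rk E r s {e})"
    using rk_insert_not_con[OF x e, of "{}"] nonloop by (simp add: con_def)
  ultimately have "rank_poly R (rk E r s) =
      rank_poly (R - {e}) (\<lambda>A. rk E r s (insert e A)) + rank_poly (R - {e}) (rk E r s)"
    by (rule rank_poly_deletion_contraction[OF R(4,3)])
  moreover have "rank_poly (R - {e}) (rk (E - {e}) r' s1) =
      rank_poly (R - {e}) (\<lambda>A. rk E r s (insert e A))"
  proof (rule rank_poly_shift)
    fix A assume "A \<subseteq> R - {e}"
    then show "rk (E - {e}) r' s1 A + 0 = rk E r s (insert e A) + 0"
      using rk1_contract[of A] nonloop R(2) by auto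
  qed
  ultimately show ?thesis
    using val_eq[OF R(1)] one.val_eq[OF R(6)] two.val_eq[OF R(6)] rank_poly2[OF R'] by simp
qed

end

section \<open>Disjoint unions and identification of vertices\<close>

lemma eqcl_agree:
  assumes "\<And>a b. a \<in> F \<Longrightarrow> (a, b) \<in> P \<longleftrightarrow> (a, b) \<in> P'"
    and "\<And>a b. (a, b) \<in> P \<Longrightarrow> a \<in> F \<longleftrightarrow> b \<in> F" "\<And>a b. (a, b) \<in> P' \<Longrightarrow> a \<in> F \<longleftrightarrow> b \<in> F"
    and "x \<in> F"
  shows "(x, y) \<in> eqcl P \<longleftrightarrow> (x, y) \<in> eqcl P'"
  using eqcl_restrict[of F P P' x y] eqcl_restrict[of F P' P x y] assms eqcl_base by metis

lemma ncl_agree: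
  assumes "\<And>a b. a \<in> F \<Longrightarrow> (a, b) \<in> P \<longleftrightarrow> (a, b) \<in> P'"
    and "\<And>a b. (a, b) \<in> P \<Longrightarrow> a \<in> F \<longleftrightarrow> b \<in> F" "\<And>a b. (a, b) \<in> P' \<Longrightarrow> a \<in> F \<longleftrightarrow> b \<in> F"
  shows "ncl F P = ncl F P'"
  unfolding ncl_def using eqcl_agree[OF assms]
  by (intro card_image_cong_kernel) (simp add: eqcl_class_eq_iff)

locale part = hypermap E r s for E :: "'a set" and r s +
  fixes F r1 s1
  assumes F: "F \<subseteq> E" and hyp: "hypermap F r1 s1"
    and r_agree: "\<And>z. z \<in> F \<Longrightarrow> r z = r1 z" and s_agree: "\<And>z. z \<in> F \<Longrightarrow> s z = s1 z"
begin

sublocale F: hypermap F r1 s1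
  by (rule hyp)

lemma closed_r [simp]: "r z \<in> F \<longleftrightarrow> z \<in> F"
proof
  assume "r z \<in> F"
  moreover obtain c where "r1 c = r z"
    using F.pred_ex by blast
  ultimately have "c \<in> F" "r c = r z"
    using F.r_in[of c] r_agree by auto
  then show "z \<in> F"
    by simp
qed (simp add: r_agree)

lemma closed_s [simp]: "s z \<in> F \<longleftrightarrow> z \<in> F"
proof
  assume "s z \<in> F"
  moreover obtain c where "s1 c = s z"
    using F.bijs(2) by (metis bij_pointE)
  ultimately have "c \<in> F" "s c = s z"
    using F.s_in[of c] s_agree by auto
  then show "z \<in> F"
    using bijs(2) by (metis bij_def inj_def)
qed (simp add: s_agree)

lemma gr_agree:
  "z \<in> F \<Longrightarrow> (z, y) \<in> eqcl (gr r) \<longleftrightarrow> (z, y) \<in> eqcl (gr r1)"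
  "z \<in> F \<Longrightarrow> (z, y) \<in> eqcl (gr (s \<circ> r)) \<longleftrightarrow> (z, y) \<in> eqcl (gr (s1 \<circ> r1))"
  "z \<in> F \<Longrightarrow> (z, y) \<in> con r s A \<longleftrightarrow> (z, y) \<in> con r1 s1 A"
  subgoal by (rule eqcl_agree[where F = F]) (auto simp: r_agree)
  subgoal by (rule eqcl_agree[where F = F]) (auto simp: r_agree s_agree)
  subgoal unfolding con_def by (rule eqcl_agree[where F = F]) (auto simp: r_agree s_agree)
  done

lemma ncl_gr_agree:
  "ncl F (gr r) = ncl F (gr r1)"
  "ncl F (gr s) = ncl F (gr s1)"
  "ncl F (gr (s \<circ> r)) = ncl F (gr (s1 \<circ> r1))"
  by (rule ncl_agree; auto simp: r_agree s_agree)+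

lemma rk_agree:
  assumes "A \<inter> F = B \<inter> F"
  shows "rk F r s A = rk F r1 s1 B"
  unfolding rk_def
proof (rule ncl_agree)
  fix a b assume "a \<in> F"
  moreover have "r1 a \<in> A \<longleftrightarrow> r1 a \<in> B" if "a \<in> F"
    using assms F.r_in[of a] that by blast
  ultimately show "(a, b) \<in> gr (s \<circ> r) \<union> lk r A \<longleftrightarrow> (a, b) \<in> gr (s1 \<circ> r1) \<union> lk r1 B"
    by (simp add: r_agree s_agree) blast
qed auto

lemma corb_agree: "f \<in> F \<Longrightarrow> corb r f = corb r1 f"
  using gr_agree(1) by (auto simp: corb_def)

lemma corb_F: "f \<in> F \<Longrightarrow> corb r f \<subseteq> F"
  using corb_subset[OF F.r] by (simp add: corb_agree)

lemma kind_agree: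
  assumes "f \<in> F"
  shows "kind r s (corb r f) \<longleftrightarrow> kind r1 s1 (corb r1 f)"
proof -
  have "z \<in> F \<Longrightarrow> r z = r1 z" "z \<in> F \<Longrightarrow> r (r z) = r1 (r1 z)" for z
    using closed_r[of z] by (auto simp: r_agree)
  then show ?thesis
    using corb_F[OF assms] gr_agree(2,3)
    unfolding kind_def corb_agree[OF assms, symmetric] by (smt (verit) subsetD)
qed

end

section \<open>Two parts: disjoint union and identification of a vertex\<close>

locale two_parts = A: part E r s F1 r1 s1 + B: part E r s F2 r2 s2
  for E :: "'a set" and r s F1 r1 s1 F2 r2 s2 +
  assumes E: "E = F1 \<union> F2" and disj: "F1 \<inter> F2 = {}"
begin

lemma fins: "finite F1" "finite F2"
  using A.fin A.F B.F finite_subset by auto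

lemma rk_add:
  assumes "A' \<inter> F1 = A1 \<inter> F1" "A' \<inter> F2 = A2 \<inter> F2"
  shows "rk E r s A' = rk F1 r1 s1 A1 + rk F2 r2 s2 A2"
proof -
  have "rk E r s A' = rk F1 r s A' + rk F2 r s A'"
    unfolding rk_def E
    by (rule ncl_Un[OF fins disj]) auto
  then show ?thesis
    using A.rk_agree[OF assms(1)] B.rk_agree[OF assms(2)] by simp
qed

lemma ncl_add:
  "ncl E (gr r) = ncl F1 (gr r1) + ncl F2 (gr r2)"
  "ncl E (gr s) = ncl F1 (gr s1) + ncl F2 (gr s2)"
  "ncl E (gr (s \<circ> r)) = ncl F1 (gr (s1 \<circ> r1)) + ncl F2 (gr (s2 \<circ> r2))"
  unfolding E A.ncl_gr_agree[symmetric] B.ncl_gr_agree[symmetric]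
  by (rule ncl_Un[OF fins disj]; auto)+

text \<open>Both parts satisfy the Euler inequality, so their sum is an equality exactly if each of
  them is.\<close>

lemma planar_iff: "planar E r s \<longleftrightarrow> planar F1 r1 s1 \<and> planar F2 r2 s2"
proof -
  have "card E = card F1 + card F2"
    using fins disj by (simp add: E card_Un_disjoint)
  then show ?thesis
    unfolding planar_def ncl_add rk_add[of UNIV UNIV UNIV, OF refl refl]
    using A.F.euler B.F.euler by auto
qed

lemma good_iff: "good E r s \<longleftrightarrow> good F1 r1 s1 \<and> good F2 r2 s2"
  unfolding good_def planar_iff using A.kind_agree B.kind_agree A.fin fins A.r A.s
    A.F.r A.F.s B.F.r B.F.s by (auto simp: E)

lemma omits_Un:
  assumes "omits_one r1 F1 R1" "omits_one r2 F2 R2"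
  shows "omits_one r E (R1 \<union> R2)"
  unfolding omits_one_def
proof (intro conjI ballI)
  show "R1 \<union> R2 \<subseteq> E"
    using assms by (auto simp: omits_one_def E)
  fix e assume "e \<in> E"
  then consider "e \<in> F1" | "e \<in> F2"
    by (auto simp: E)
  then show "\<exists>!f. f \<in> corb r e \<and> f \<notin> R1 \<union> R2"
  proof cases
    case 1
    then have "f \<in> corb r e \<and> f \<notin> R1 \<union> R2 \<longleftrightarrow> f \<in> corb r1 e \<and> f \<notin> R1" for f
      using A.corb_agree[OF 1] A.corb_F[OF 1] assms(2) disj by (auto simp: omits_one_def)
    then show ?thesis
      using assms(1) 1 by (simp add: omits_one_def)
  next
    case 2
    then have "f \<in> corb r e \<and> f \<notin> R1 \<union> R2 \<longleftrightarrow> f \<in> corb r2 e \<and> f \<notin> R2" for f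
      using B.corb_agree[OF 2] B.corb_F[OF 2] assms(1) disj by (auto simp: omits_one_def)
    then show ?thesis
      using assms(2) 2 by (simp add: omits_one_def)
  qed
qed

lemma omits_exists: "\<exists>R. omits_one r1 F1 R" "\<exists>R. omits_one r2 F2 R"
proof -
  have "\<exists>R. omits_one \<rho> F R" if "finite F" "\<rho> permutes F" for F :: "'a set" and \<rho>
  proof (cases "F = {}")
    case True
    then show ?thesis
      by (auto simp: omits_one_def)
  qed (use omits_one_exists[OF that] in auto)
  then show "\<exists>R. omits_one r1 F1 R" "\<exists>R. omits_one r2 F2 R"
    using fins A.F.r B.F.r by auto
qed

lemma val_mult:
  assumes "good E r s"
  shows "val E r s = val F1 r1 s1 * val F2 r2 s2"
proof -
  interpret good_hypermap E r s
    using assms by unfold_locales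
  interpret g1: good_hypermap F1 r1 s1
    using assms good_iff by unfold_locales simp
  interpret g2: good_hypermap F2 r2 s2
    using assms good_iff by unfold_locales simp
  obtain R1 R2 where R: "omits_one r1 F1 R1" "omits_one r2 F2 R2"
    using omits_exists by auto
  then have sub: "R1 \<subseteq> F1" "R2 \<subseteq> F2"
    by (auto simp: omits_one_def)
  have "rank_poly (R1 \<union> R2) (rk E r s) =
      rank_poly R1 (rk F1 r1 s1) * rank_poly R2 (rk F2 r2 s2)"
  proof (rule rank_poly_Un)
    show "finite R1" "finite R2" "R1 \<inter> R2 = {}"
      using sub fins disj finite_subset by blast+
    show "rk E r s (A \<union> B) = rk F1 r1 s1 A + rk F2 r2 s2 B" if "A \<subseteq> R1" "B \<subseteq> R2" for A B
      using that sub disj by (intro rk_add) auto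
  qed (use sub in \<open>auto intro!: A.F.rk_lower B.F.rk_lower A.F.rk_antimono B.F.rk_antimono\<close>)
  then show ?thesis
    using val_eq[OF omits_Un[OF R]] g1.val_eq[OF R(1)] g2.val_eq[OF R(2)] by simp
qed

text \<open>The transposition merges a vertex and an a-face of one part with those of the other, and
  thereby two components: both sides of Euler's formula lose two. The c-faces stay, and the
  component count of every edge set drops by the same one.\<close>

lemma join:
  assumes good: "good F1 r1 s1" "good F2 r2 s2" and ab: "a \<in> F1" "b \<in> F2"
  defines "s' \<equiv> s \<circ> transpose a b"
  shows "good E r s'" and "val E r s' = val F1 r1 s1 * val F2 r2 s2"
proof -
  have goodE: "good E r s"
    using good good_iff by simp
  interpret g: good_hypermap E r s
    using goodE by unfold_locales
  obtain x y where x: "r x = a" and y: "r y = b"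
    using A.pred_ex by meson
  have xy: "x \<in> F1" "y \<in> F2" "x \<in> E" "y \<in> E" "a \<in> E" "b \<in> E"
    using ab x y A.closed_r[of x] B.closed_r[of y] E by auto
  have "inv r a = x" "inv r b = y"
    using x y A.bijs(1) by (auto simp: bij_is_inj inv_f_eq)
  then have "s' \<circ> r = s \<circ> (r \<circ> transpose x y)"
    using transpose_comp_eq_comp_transpose[OF A.bijs(1), of a b]
    by (simp add: s'_def comp_assoc)
  then have q': "s' \<circ> r = (s \<circ> r) \<circ> transpose x y"
    by (simp add: comp_assoc)
  have s': "s' permutes E"
    unfolding s'_def using A.s xy by (intro permutes_compose permutes_swap_id)
  interpret h: hypermap E r s'
    using A.fin A.r s' by unfold_locales
  have closed: "z \<in> F1 \<longleftrightarrow> w \<in> F1" "z \<in> F2 \<longleftrightarrow> w \<in> F2" if "(z, w) \<in> con r s A" for z w A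
    using that eqcl_closed_superset[of "gr (s \<circ> r) \<union> lk r A" F1 z w]
      eqcl_closed_superset[of "gr (s \<circ> r) \<union> lk r A" F2 z w]
    unfolding con_def by fastforce+
  have nxy: "(x, y) \<notin> con r s A" for A
    using closed(1)[of x y A] xy disj by auto
  then have nq: "(x, y) \<notin> eqcl (gr (s \<circ> r))"
    using eqcl_subset_con by blast
  then have "(x, y) \<in> eqcl (gr (s' \<circ> r))"
    using transpose_cycles[OF A.perms(3), of x y] xy disj q' by auto
  then have "(x, y) \<in> eqcl (gr (s' \<circ> r) \<union> P)" for P
    using eqcl_mono[of "gr (s' \<circ> r)"] by auto
  then have eq: "eqcl (gr (s' \<circ> r) \<union> P) = eqcl (insert (x, y) (gr (s \<circ> r) \<union> P))" for P
    using eqcl_transpose[of x y "s \<circ> r" P] by (simp add: q'[symmetric] eqcl_insert_redundant)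
  have rk: "rk E r s A = Suc (rk E r s' A)" for A
    using ncl_insert[OF A.fin xy(3,4), of "gr (s \<circ> r) \<union> lk r A"] nxy[of A]
      ncl_cong_eqcl[OF eq, of E "lk r A"] by (simp add: rk_def con_def)
  have "(a, b) \<notin> eqcl (gr s)"
    using eqcl_closed_superset[of "gr s" F1 a b] ab disj by auto
  then have "ncl E (gr s) = Suc (ncl E (gr s'))"
    unfolding s'_def using xy by (intro ncl_transpose_join A.perms A.fin)
  moreover have "ncl E (gr (s \<circ> r)) = Suc (ncl E (gr (s' \<circ> r)))"
    unfolding q' using xy nq by (intro ncl_transpose_join A.perms A.fin)
  ultimately have planar: "planar E r s'"
    using goodE rk[of UNIV] by (simp add: good_def planar_def)
  have sub: "eqcl (gr (s \<circ> r)) \<subseteq> eqcl (gr (s' \<circ> r))"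
    using eq[of "{}"] eqcl_mono[of "gr (s \<circ> r)" "insert (x, y) (gr (s \<circ> r))"] by auto
  have "kind r s' (corb r f)" if f: "f \<in> E" for f
  proof -
    have H: "corb r f \<subseteq> F1 \<or> corb r f \<subseteq> F2"
      using f E A.corb_F B.corb_F by blast
    have "(z, w) \<in> con r s (- corb r f)"
      if zw: "z \<in> corb r f" "w \<in> corb r f" "(z, w) \<in> con r s' (- corb r f)" for z w
    proof -
      have F: "z \<in> F1 \<and> w \<in> F1 \<or> z \<in> F2 \<and> w \<in> F2"
        using H zw by auto
      let ?C = "con r s (- corb r f)"
      \<comment> \<open>The merged vertex is the only connection between the parts. A path that
        changes sides there would end in the other part, while \<open>z\<close> and \<open>w\<close>
        are in the same one.\<close>
      have "(z, w) \<in> eqcl (insert (x, y) (gr (s \<circ> r) \<union> lk r (- corb r f)))"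
        using zw(3) eq by (simp add: con_def)
      then have "(z, w) \<in> ?C \<or> (z, x) \<in> ?C \<and> (y, w) \<in> ?C \<or> (z, y) \<in> ?C \<and> (x, w) \<in> ?C"
        unfolding con_def by (rule eqcl_insert_cases)
      then show ?thesis
        using F closed[of _ _ "- corb r f"] xy disj by blast
    qed
    then show ?thesis
      using goodE f sub unfolding kind_def good_def by blast
  qed
  then show goodE': "good E r s'"
    using planar A.fin A.r s' by (simp add: good_def)
  interpret g': good_hypermap E r s'
    using goodE' by unfold_locales
  obtain R where R: "omits_one r E R"
    using omits_one_exists[OF A.fin A.r xy(3)] by auto
  have "rank_poly R (rk E r s') = rank_poly R (rk E r s)"
    using rk by (intro rank_poly_shift[of _ _ 1 _ 0]) simp
  then show "val E r s' = val F1 r1 s1 * val F2 r2 s2"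
    using val_mult[OF goodE] g.val_eq[OF R] g'.val_eq[OF R] by simp
qed

end

section \<open>The permutations of an alternating dimap\<close>

definition asucc :: "'e emap \<Rightarrow> 'e \<Rightarrow> 'e" where
  "asucc M e = fst (rot M (e, Tail))"

text \<open>In an alternating map the rotation consists of one map from head ends to tail ends and
  one from tail ends to head ends, so a pair of permutations carries all its information.\<close>

definition mk :: "'e set \<Rightarrow> ('e \<Rightarrow> 'e) \<Rightarrow> ('e \<Rightarrow> 'e) \<Rightarrow> 'e emap" where
  "mk E r s = \<lparr>edges = E,
     rot = (\<lambda>(e, d). if e \<in> E then (case d of Head \<Rightarrow> (r e, Tail) | Tail \<Rightarrow> (s e, Head))
                     else (e, d))\<rparr>"

lemma side_cases: "d = Tail \<or> d = Head"
  by (cases d) auto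

lemma finite_side: "finite (UNIV :: side set)"
proof -
  have "(UNIV :: side set) = {Tail, Head}"
    using side_cases by auto
  then show ?thesis
    by (metis finite.simps)
qed

lemma rsucc_eq: "rsucc M e = fst (rot M (e, Head))"
  by (simp add: rsucc_def face_step_def)

lemma mem_ends [simp]: "(e, d) \<in> ends M \<longleftrightarrow> e \<in> edges M"
  by (auto simp: ends_def)

lemma edges_mk [simp]: "edges (mk E r s) = E"
  by (simp add: mk_def)

lemma rot_mk:
  "e \<in> E \<Longrightarrow> rot (mk E r s) (e, Head) = (r e, Tail)"
  "e \<in> E \<Longrightarrow> rot (mk E r s) (e, Tail) = (s e, Head)"
  "e \<notin> E \<Longrightarrow> rot (mk E r s) (e, d) = (e, d)"
  by (auto simp: mk_def)

lemma emap_eq_mkI: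
  assumes "edges M = E"
    and "\<And>e. e \<in> E \<Longrightarrow> rot M (e, Head) = (r e, Tail)"
    and "\<And>e. e \<in> E \<Longrightarrow> rot M (e, Tail) = (s e, Head)"
    and "\<And>e d. e \<notin> E \<Longrightarrow> rot M (e, d) = (e, d)"
  shows "M = mk E r s"
proof (rule emap.equality)
  show "rot M = rot (mk E r s)"
  proof
    fix z :: "'a \<times> side"
    obtain e d where "z = (e, d)"
      by (cases z)
    then show "rot M z = rot (mk E r s) z"
      using assms side_cases[of d] by (cases "e \<in> E") (auto simp: rot_mk)
  qed
qed (simp_all add: assms(1))

lemma first_return_eq:
  assumes "x \<in> A" "0 < n" "(p ^^ n) x \<in> A" "\<And>m. 0 < m \<Longrightarrow> m < n \<Longrightarrow> (p ^^ m) x \<notin> A"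
  shows "first_return A p x = (p ^^ n) x"
proof -
  have "(LEAST n. 0 < n \<and> (p ^^ n) x \<in> A) = n"
  proof (rule Least_equality)
    fix m assume "0 < m \<and> (p ^^ m) x \<in> A"
    then show "n \<le> m"
      using assms(4)[of m] by (meson not_le)
  qed (use assms in simp)
  then show ?thesis
    using assms(1) by (simp add: first_return_def)
qed

lemma first_return_outside: "x \<notin> A \<Longrightarrow> first_return A p x = x"
  by (simp add: first_return_def)

lemma first_return_1: "x \<in> A \<Longrightarrow> p x \<in> A \<Longrightarrow> first_return A p x = p x"
  using first_return_eq[of x A 1 p] by simp

lemma first_return_2:
  assumes "x \<in> A" "p x \<notin> A" "p (p x) \<in> A"
  shows "first_return A p x = p (p x)"
proof -
  have "first_return A p x = (p ^^ 2) x"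
  proof (rule first_return_eq)
    show "(p ^^ m) x \<notin> A" if "0 < m" "m < 2" for m
    proof -
      have "m = 1"
        using that by simp
      then show ?thesis
        using assms by simp
    qed
  qed (use assms in \<open>auto simp: numeral_2_eq_2\<close>)
  then show ?thesis
    by (simp add: numeral_2_eq_2)
qed

lemma first_return_3:
  assumes "x \<in> A" "p x \<notin> A" "p (p x) \<notin> A" "p (p (p x)) \<in> A"
  shows "first_return A p x = p (p (p x))"
proof -
  have "first_return A p x = (p ^^ 3) x"
  proof (rule first_return_eq)
    show "(p ^^ m) x \<notin> A" if "0 < m" "m < 3" for m
    proof -
      have "m = 1 \<or> m = 2"
        using that by auto
      then show ?thesis
        using assms by (auto simp: numeral_2_eq_2)
    qed
  qed (use assms in \<open>auto simp: numeral_3_eq_3\<close>)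
  then show ?thesis
    by (simp add: numeral_3_eq_3)
qed

lemma opp_opp [simp]: "opp (opp d) = d"
  by (cases d rule: opp.cases) auto

lemma fst_opp [simp]: "fst (opp d) = fst d"
  by (cases d rule: opp.cases) auto

lemma rtrancl_class_eq_iff:
  assumes "sym S"
  shows "S\<^sup>* `` {a} = S\<^sup>* `` {b} \<longleftrightarrow> (a, b) \<in> S\<^sup>*"
proof
  have sym: "sym (S\<^sup>*)"
    using assms by (rule sym_rtrancl)
  assume ab: "(a, b) \<in> S\<^sup>*"
  then have "(b, a) \<in> S\<^sup>*"
    using sym by (rule symD[rotated])
  then show "S\<^sup>* `` {a} = S\<^sup>* `` {b}"
    using ab by (auto intro: rtrancl_trans)
qed auto

locale alt_map =
  fixes M :: "'e emap"
  assumes alt: "alternating_dimap M"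
begin

abbreviation E where "E \<equiv> edges M"
abbreviation r where "r \<equiv> rsucc M"
abbreviation s where "s \<equiv> asucc M"

lemma finE: "finite E" and rot_permutes: "rot M permutes ends M"
  using alt by (auto simp: alternating_dimap_def embedded_digraph_def)

lemma rot_permutation: "permutation (rot M)"
  using rot_permutes finE finite_side by (intro permutes_imp_permutation[of "ends M"])
    (simp_all add: ends_def)

lemma rot_inj: "rot M a = rot M b \<longleftrightarrow> a = b"
  using rot_permutes by (meson permutes_inj inj_eq)

lemma rot_Head: "e \<in> E \<Longrightarrow> rot M (e, Head) = (r e, Tail)"
  and rot_Tail: "e \<in> E \<Longrightarrow> rot M (e, Tail) = (s e, Head)"
  and rot_out: "e \<notin> E \<Longrightarrow> rot M (e, d) = (e, d)"
proof -
  have "snd (rot M (e, d)) \<noteq> d" if "e \<in> E" for d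
    using alt that unfolding alternating_dimap_def by (metis mem_ends snd_conv)
  then show "e \<in> E \<Longrightarrow> rot M (e, Head) = (r e, Tail)" "e \<in> E \<Longrightarrow> rot M (e, Tail) = (s e, Head)"
    using side_cases by (metis prod.collapse rsucc_eq, metis prod.collapse asucc_def)
  show "e \<notin> E \<Longrightarrow> rot M (e, d) = (e, d)"
    using rot_permutes by (simp add: permutes_def)
qed

lemma rot_ends: "rot M d \<in> ends M \<longleftrightarrow> d \<in> ends M"
  using rot_permutes by (rule permutes_in_image)

end

sublocale alt_map \<subseteq> hypermap "edges M" "rsucc M" "asucc M"
proof
  show "finite E"
    by (rule finE)
  have r: "r ` E \<subseteq> E" "inj_on r E"
    using rot_ends rot_Head rot_inj by (auto simp: inj_on_def) (metis mem_ends)+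
  have s: "s ` E \<subseteq> E" "inj_on s E"
    using rot_ends rot_Tail rot_inj by (auto simp: inj_on_def) (metis mem_ends)+
  show "r permutes E"
    using r endo_inj_surj[OF finE r] rot_out
    by (intro bij_imp_permutes) (auto simp: bij_betw_def rsucc_eq)
  show "s permutes E"
    using s endo_inj_surj[OF finE s] rot_out
    by (intro bij_imp_permutes) (auto simp: bij_betw_def asucc_def)
qed

context hypermap
begin

lemma alternating_mk: "alternating_dimap (mk E r s)"
proof -
  have in_ends: "rot (mk E r s) z \<in> ends (mk E r s)" if "z \<in> ends (mk E r s)" for z
    using that side_cases[of "snd z"] by (cases z) (auto simp: rot_mk)
  have "inj_on (rot (mk E r s)) (ends (mk E r s))"
  proof (rule inj_onI)
    fix y z assume "y \<in> ends (mk E r s)" "z \<in> ends (mk E r s)" "rot (mk E r s) y = rot (mk E r s) z"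
    moreover have "s a = s b \<longleftrightarrow> a = b" for a b
      using bijs(2) by (meson bij_def inj_eq)
    ultimately show "y = z"
      using side_cases[of "snd y"] side_cases[of "snd z"]
      by (cases y; cases z) (auto simp: rot_mk)
  qed
  moreover have "finite (ends (mk E r s))"
    using fin finite_side by (simp add: ends_def)
  ultimately have "rot (mk E r s) ` ends (mk E r s) = ends (mk E r s)"
    using in_ends by (intro endo_inj_surj) auto
  then have "rot (mk E r s) permutes ends (mk E r s)"
    using \<open>inj_on _ _\<close> by (intro bij_imp_permutes) (auto simp: bij_betw_def rot_mk)
  moreover have "snd (rot (mk E r s) z) \<noteq> snd z" if "z \<in> ends (mk E r s)" for z
    using that side_cases[of "snd z"] by (cases z) (auto simp: rot_mk)
  ultimately show ?thesis
    using fin by (auto simp: alternating_dimap_def embedded_digraph_def)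
qed

lemma rsucc_mk: "rsucc (mk E r s) = r" and asucc_mk: "asucc (mk E r s) = s"
proof -
  show "rsucc (mk E r s) = r"
  proof
    fix e show "rsucc (mk E r s) e = r e"
      by (cases "e \<in> E") (simp_all add: rsucc_eq rot_mk r_out)
  qed
  have "s e = e" if "e \<notin> E" for e
    using s that by (simp add: permutes_def)
  then show "asucc (mk E r s) = s"
    by (intro ext) (metis asucc_def fst_conv rot_mk(2,3))
qed

end

section \<open>Vertices, faces and components read off from the permutations\<close>

context alt_map
begin

lemma head_eq_iff:
  assumes "a \<in> E" "b \<in> E"
  shows "head M a = head M b \<longleftrightarrow> (a, b) \<in> eqcl (gr (s \<circ> r))"
proof -
  have pre: "inv r (r z) = z" for z
    using bijs(1) by (simp add: bij_is_inj)
  \<comment> \<open>An edge-end is sent to the class of edges that enter its vertex; the tail end of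
    an edge lies at the head of its predecessor under \<open>r\<close>. Ends outside the map share a
    default value.\<close>
  define \<psi> where "\<psi> d = (if d \<in> ends M then
      eqcl (gr (s \<circ> r)) `` {case snd d of Head \<Rightarrow> fst d | Tail \<Rightarrow> inv r (fst d)} else {})" for d
  have "\<psi> d = \<psi> (rot M d)" for d
  proof (cases "d \<in> ends M")
    case True
    obtain e x where e: "d = (e, x)" "e \<in> E"
      using True by (cases d) auto
    show ?thesis
    proof (cases x)
      case Tail
      obtain z where z: "r z = e"
        using pred_ex by blast
      have "(z, s e) \<in> eqcl (gr (s \<circ> r))"
        using z by (auto intro!: eqcl_base)
      then show ?thesis
        using e Tail pre[of z] z
        by (auto simp: \<psi>_def rot_Tail eqcl_class_eq_iff simp del: Image_singleton_iff)
    next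
      case Head
      then show ?thesis
        using e by (auto simp: \<psi>_def rot_Head pre)
    qed
  qed (use rot_ends in \<open>auto simp: \<psi>_def\<close>)
  then have "(a, b) \<in> eqcl (gr (s \<circ> r))" if "((a, Head), (b, Head)) \<in> eqcl (gr (rot M))"
    using eqcl_invariant[OF that, of \<psi>] assms
    by (auto simp: \<psi>_def eqcl_class_eq_iff simp del: Image_singleton_iff)
  moreover have "((a, Head), (b, Head)) \<in> eqcl (gr (rot M))" if "(a, b) \<in> eqcl (gr (s \<circ> r))"
  proof -
    have "((z, Head), (s (r z), Head)) \<in> eqcl (gr (rot M))" for z
    proof (cases "z \<in> E")
      case True
      then show ?thesis
        using eqcl_gr_comp[of "rot M" "gr (rot M)" "rot M" "(z, Head)"]
        by (simp add: rot_Head rot_Tail)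
    next
      case False
      then have "s (r z) = z"
        using sr by (simp add: permutes_def)
      then show ?thesis
        by simp
    qed
    then have "eqcl (gr (rot M)) `` {(a, Head)} = eqcl (gr (rot M)) `` {(b, Head)}"
      using that by (intro eqcl_invariant[OF that, of "\<lambda>z. eqcl (gr (rot M)) `` {(z, Head)}"])
        (auto simp: eqcl_class_eq_iff simp del: Image_singleton_iff)
    then show ?thesis
      by (simp only: eqcl_class_eq_iff)
  qed
  ultimately show ?thesis
    unfolding head_def orbit_eqI_eqcl[OF rot_permutation] by blast
qed

lemma tail_rsucc: "e \<in> E \<Longrightarrow> tail M (r e) = head M e"
  unfolding tail_def head_def orbit_eqI_eqcl[OF rot_permutation]
  by (intro eqcl_sym[OF eqcl_base]) (simp add: rot_Head)

lemma is_loop_iff: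
  assumes "e \<in> E" "r x = e"
  shows "is_loop M e \<longleftrightarrow> (x, e) \<in> eqcl (gr (s \<circ> r))"
proof -
  have "x \<in> E"
    using assms by auto
  then show ?thesis
    using assms tail_rsucc[of x] head_eq_iff[of x e] by (auto simp: is_loop_def)
qed

lemma verts_eq: "verts M = head M ` E"
proof -
  have "orbit (rot M) d \<in> head M ` E" if "d \<in> ends M" for d
  proof -
    obtain e x where e: "d = (e, x)" "e \<in> E"
      using \<open>d \<in> ends M\<close> by (cases d) auto
    show ?thesis
    proof (cases x)
      case Tail
      obtain z where z: "r z = e"
        using pred_ex by blast
      then have "tail M e = head M z" "z \<in> E"
        using e tail_rsucc[of z] by auto
      then show ?thesis
        using e Tail by (auto simp: tail_def)
    qed (use e in \<open>auto simp: head_def\<close>)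
  qed
  then show ?thesis
    by (auto simp: verts_def head_def)
qed

lemma card_verts: "card (verts M) = ncl E (gr (s \<circ> r))"
  unfolding verts_eq by (rule ncl_eq_card_image[symmetric]) (simp add: head_eq_iff)

lemma orbit_image_eq:
  assumes "\<And>z. z \<in> E \<Longrightarrow> f (z, d) = (g z, d)" "g permutes E" "e \<in> E"
  shows "orbit f (e, d) = (\<lambda>z. (z, d)) ` orbit g e"
proof (intro equalityI subsetI)
  have E: "g z \<in> E \<longleftrightarrow> z \<in> E" for z
    using assms(2) by (rule permutes_in_image)
  fix y assume "y \<in> orbit f (e, d)"
  then have "y \<in> (\<lambda>z. (z, d)) ` orbit g e \<and> fst y \<in> E"
  proof induction
    case base
    then show ?case
      using assms E orbit.base[of g e] by simp
  next
    case (step y)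
    then obtain z where "z \<in> orbit g e" "y = (z, d)" "z \<in> E"
      by auto
    then show ?case
      using assms(1) E orbit.step[of z g e] by simp
  qed
  then show "y \<in> (\<lambda>z. (z, d)) ` orbit g e"
    by simp
next
  have E: "g z \<in> E \<longleftrightarrow> z \<in> E" for z
    using assms(2) by (rule permutes_in_image)
  fix y assume "y \<in> (\<lambda>z. (z, d)) ` orbit g e"
  then obtain z where "z \<in> orbit g e" "y = (z, d)"
    by auto
  have "(z, d) \<in> orbit f (e, d) \<and> z \<in> E"
    using \<open>z \<in> orbit g e\<close>
  proof induction
    case base
    then show ?case
      using assms E orbit.base[of f "(e, d)"] by simp
  next
    case (step z)
    then show ?case
      using assms(1) E orbit.step[of "(z, d)" f "(e, d)"] by simp
  qed
  then show "y \<in> orbit f (e, d)"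
    using \<open>y = (z, d)\<close> by simp
qed

lemma face_Tail: "e \<in> E \<Longrightarrow> face_of M (e, Tail) = (\<lambda>z. (z, Tail)) ` orbit r e"
  unfolding face_of_def using r by (intro orbit_image_eq) (auto simp: face_step_def rot_Head)

lemma face_Head: "e \<in> E \<Longrightarrow> face_of M (e, Head) = (\<lambda>z. (z, Head)) ` orbit s e"
  unfolding face_of_def using s by (intro orbit_image_eq) (auto simp: face_step_def rot_Tail)

lemma card_faces: "card (faces M) = ncl E (gr r) + ncl E (gr s)"
proof -
  have inj: "inj (\<lambda>z. (z, d))" for d :: side
    by (simp add: inj_def)
  have "faces M = (\<lambda>e. face_of M (e, Tail)) ` E \<union> (\<lambda>e. face_of M (e, Head)) ` E"
  proof -
    have "ends M = (\<lambda>e. (e, Tail)) ` E \<union> (\<lambda>e. (e, Head)) ` E"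
      using side_cases by (auto simp: ends_def)
    then show ?thesis
      by (simp add: faces_def image_Un image_image)
  qed
  moreover have "(\<lambda>e. face_of M (e, Tail)) ` E \<inter> (\<lambda>e. face_of M (e, Head)) ` E = {}"
  proof -
    have "face_of M (a, Tail) \<noteq> face_of M (b, Head)" if "a \<in> E" "b \<in> E" for a b
      using permutation_self_in_orbit[OF perms(1), of a] by (auto simp: face_Tail face_Head that)
    then show ?thesis
      by blast
  qed
  moreover have "card ((\<lambda>e. face_of M (e, Tail)) ` E) = ncl E (gr r)"
    by (rule ncl_eq_card_image[symmetric])
      (simp only: face_Tail inj_image_eq_iff[OF inj] orbit_eqI_eqcl[OF perms(1)])
  moreover have "card ((\<lambda>e. face_of M (e, Head)) ` E) = ncl E (gr s)"
    by (rule ncl_eq_card_image[symmetric])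
      (simp only: face_Head inj_image_eq_iff[OF inj] orbit_eqI_eqcl[OF perms(2)])
  ultimately show ?thesis
    using fin by (simp add: card_Un_disjoint)
qed

lemma adjacency_sym: "sym {(u, v) \<in> V \<times> V. \<exists>e\<in>F. {u, v} = {head M e, tail M e}}"
  by (auto simp: sym_def insert_commute)

text \<open>A vertex is represented by any edge entering it. Steps of \<open>s \<circ> r\<close>
  move among these edges, and the link from \<open>y\<close> to \<open>r y\<close> crosses the edge
  \<open>r y\<close>, whose tail is the head of \<open>y\<close>.\<close>

lemma connected_iff:
  assumes "F \<subseteq> E" "a \<in> E" "b \<in> E"
  shows "(head M a, head M b) \<in>
      {(u, v) \<in> verts M \<times> verts M. \<exists>e\<in>F. {u, v} = {head M e, tail M e}}\<^sup>* \<longleftrightarrow>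
    (a, b) \<in> con r s F" (is "_ \<in> ?R\<^sup>* \<longleftrightarrow> _")
proof
  have R: "sym (?R\<^sup>*)"
    by (rule sym_rtrancl[OF adjacency_sym])
  assume "(a, b) \<in> con r s F"
  then have "(\<lambda>z. if z \<in> E then ?R\<^sup>* `` {head M z} else {}) a =
      (\<lambda>z. if z \<in> E then ?R\<^sup>* `` {head M z} else {}) b"
    unfolding con_def
  proof (rule eqcl_invariant)
    fix c d assume cd: "(c, d) \<in> gr (s \<circ> r) \<union> lk r F"
    then have dE: "d \<in> E \<longleftrightarrow> c \<in> E"
      by auto
    have "?R\<^sup>* `` {head M c} = ?R\<^sup>* `` {head M d}" if c: "c \<in> E"
    proof (cases "d = s (r c)")
      case True
      then have "(c, d) \<in> eqcl (gr (s \<circ> r))"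
        by (auto intro: eqcl_base)
      then have "head M c = head M d"
        using head_eq_iff[of c d] c dE by blast
      then show ?thesis
        by (simp only:)
    next
      case False
      then have d: "d = r c" "d \<in> F"
        using cd by auto
      then have "(head M c, head M d) \<in> ?R"
        using tail_rsucc[OF c] c dE by (auto simp: verts_eq insert_commute intro!: bexI[of _ d])
      then show ?thesis
        unfolding rtrancl_class_eq_iff[OF adjacency_sym] by (rule r_into_rtrancl)
    qed
    then show "(if c \<in> E then ?R\<^sup>* `` {head M c} else {}) =
        (if d \<in> E then ?R\<^sup>* `` {head M d} else {})"
      using dE by simp
  qed
  then show "(head M a, head M b) \<in> ?R\<^sup>*"
    using assms R by (auto dest: symD)
next
  assume "(head M a, head M b) \<in> ?R\<^sup>*"
  moreover have "(a, z) \<in> con r s F" if "(head M a, v) \<in> ?R\<^sup>*" "z \<in> E" "v = head M z" for v z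
    using that
  proof (induction arbitrary: z rule: rtrancl_induct)
    case base
    then show ?case
      using head_eq_iff[OF assms(2)] eqcl_subset_con by blast
  next
    case (step u v)
    then obtain e where e: "e \<in> F" "{u, v} = {head M e, tail M e}"
      by auto
    obtain y where y: "r y = e"
      using pred_ex by blast
    then have E: "e \<in> E" "y \<in> E"
      using e assms(1) by auto
    have ye: "(y, e) \<in> con r s F"
      using y e by (auto simp: con_def intro: eqcl_base)
    have "{u, v} = {head M e, head M y}"
      using e tail_rsucc[OF E(2)] y by simp
    then have uv: "u = head M e \<and> v = head M y \<or> u = head M y \<and> v = head M e"
      by (auto simp: doubleton_eq_iff)
    have cz: "(c, z) \<in> con r s F" if "v = head M c" "c \<in> E" for c
    proof -
      have "(c, z) \<in> eqcl (gr (s \<circ> r))"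
        using head_eq_iff[of c z] that step.prems by simp
      then show ?thesis
        by (rule subsetD[OF eqcl_subset_con])
    qed
    from uv show ?case
    proof
      assume "u = head M e \<and> v = head M y"
      then show ?thesis
        using step.IH[OF E(1)] cz[OF _ E(2)] ye unfolding con_def
        by (meson eqcl_sym eqcl_trans)
    next
      assume "u = head M y \<and> v = head M e"
      then show ?thesis
        using step.IH[OF E(2)] cz[OF _ E(1)] ye unfolding con_def
        by (meson eqcl_sym eqcl_trans)
    qed
  qed
  ultimately show "(a, b) \<in> con r s F"
    using assms by blast
qed

lemma card_components:
  assumes "F \<subseteq> E"
  shows "card (components M (verts M) F) = rk E r s F"
proof -
  let ?R = "{(u, v) \<in> verts M \<times> verts M. \<exists>e\<in>F. {u, v} = {head M e, tail M e}}\<^sup>*"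
  have "components M (verts M) F = (\<lambda>a. ?R `` {head M a}) ` E"
    by (auto simp: components_def quotient_def verts_eq)
  moreover have "?R `` {head M a} = ?R `` {head M b} \<longleftrightarrow> (a, b) \<in> con r s F"
    if "a \<in> E" "b \<in> E" for a b
  proof -
    have "?R `` {head M a} = ?R `` {head M b} \<longleftrightarrow> (head M a, head M b) \<in> ?R"
      by (rule rtrancl_class_eq_iff[OF adjacency_sym])
    then show ?thesis
      using connected_iff[OF assms that] by simp
  qed
  ultimately show ?thesis
    unfolding rk_def using ncl_eq_card_image[of E "gr (s \<circ> r) \<union> lk r F" "\<lambda>a. ?R `` {head M a}"]
    by (simp add: con_def)
qed

lemma n_components_eq: "n_components M = rk E r s UNIV"
proof -
  have "con r s E = con r s UNIV"
    unfolding con_def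
  proof (rule eqcl_eqI)
    fix a b assume "(a, b) \<in> gr (s \<circ> r) \<union> lk r UNIV"
    then show "(a, b) \<in> eqcl (gr (s \<circ> r) \<union> lk r E)"
      using r_out[of a] by (cases "a \<in> E") (auto intro: eqcl_base)
  qed (auto intro: eqcl_base)
  then show ?thesis
    unfolding n_components_def card_components[OF order_refl] rk_def
    by (intro ncl_cong_eqcl) (simp add: con_def)
qed

lemma plane_iff: "plane M \<longleftrightarrow> planar E r s"
  unfolding plane_def planar_def card_verts card_faces n_components_eq by auto

lemma genus_eq_0: "planar E r s \<Longrightarrow> genus M = 0"
  unfolding planar_def genus_def card_verts card_faces n_components_eq by simp

lemma cutset_iff: "cutset M A \<longleftrightarrow> rk E r s UNIV < rk E r s (E - A)"
  unfolding cutset_def n_components_eq by (simp add: card_components)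

end

section \<open>Edge types and reductions\<close>

context alt_map
begin

lemma r_perm: "permutation r" and s_perm: "permutation s" and s_eq: "s a = s b \<longleftrightarrow> a = b"
  using perms bijs(2) by (auto simp: bij_def inj_eq)

lemma one_loop_iff:
  assumes "e \<in> E"
  shows "one_loop M e \<longleftrightarrow> s (r e) = e"
proof
  have steps: "rot M (e, Head) = (r e, Tail)" "rot M (r e, Tail) = (s (r e), Head)"
    using assms by (simp_all add: rot_Head rot_Tail)
  have mem: "(e, Head) \<in> head M e" "(r e, Tail) \<in> head M e" "(s (r e), Head) \<in> head M e"
    using permutation_self_in_orbit[OF rot_permutation] steps
    unfolding head_def by (metis orbit.base orbit.step)+
  show "s (r e) = e" if "one_loop M e"
  proof -
    have "finite (head M e)" "card (head M e) = 2"
      using that by (auto simp: one_loop_def intro: card_ge_0_finite)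
    moreover have "{(e, Head), (r e, Tail)} \<subseteq> head M e" "card {(e, Head), (r e, Tail)} = 2"
      using mem by auto
    ultimately have "{(e, Head), (r e, Tail)} = head M e"
      by (metis card_subset_eq)
    then show ?thesis
      using mem(3) by auto
  qed
  show "one_loop M e" if "s (r e) = e"
  proof -
    have "y \<in> {(e, Head), (r e, Tail)}" if "y \<in> head M e" for y
      using that unfolding head_def by induction (use steps \<open>s (r e) = e\<close> in auto)
    then have "head M e = {(e, Head), (r e, Tail)}"
      using mem by auto
    then show ?thesis
      by (simp add: one_loop_def)
  qed
qed

lemma singleton_face_iff:
  assumes "e \<in> E"
  shows "{(e, d)} \<in> faces M \<longleftrightarrow> face_step M (e, d) = (e, d)"
proof
  assume "{(e, d)} \<in> faces M"
  then obtain z where "orbit (face_step M) z = {(e, d)}"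
    by (auto simp: faces_def face_of_def)
  then show "face_step M (e, d) = (e, d)"
    by (metis orbit.step singleton_iff)
next
  assume "face_step M (e, d) = (e, d)"
  then have "face_of M (e, d) = {(e, d)}"
    unfolding face_of_def by (simp add: orbit_eq_singleton_iff)
  then show "{(e, d)} \<in> faces M"
    using assms by (metis faces_def imageI mem_ends)
qed

lemma omega_loop_iff: "e \<in> E \<Longrightarrow> omega_loop M e \<longleftrightarrow> s e = e"
  by (simp add: omega_loop_def a_face_def singleton_face_iff face_step_def rot_Tail)

lemma omega2_loop_iff: "e \<in> E \<Longrightarrow> omega2_loop M e \<longleftrightarrow> r e = e"
  by (simp add: omega2_loop_def c_face_def singleton_face_iff face_step_def rot_Head)

lemma lsucc_eq:
  assumes "s l = e" "e \<in> E"
  shows "lsucc M e = l"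
proof -
  have "l \<in> E"
    using assms by auto
  then have "face_step M (l, Head) = (e, Head)"
    using assms by (simp add: face_step_def rot_Tail)
  moreover have "inj (face_step M)"
    unfolding face_step_def by (metis (no_types, lifting) injI opp_opp rot_inj)
  ultimately have "inv (face_step M) (e, Head) = (l, Head)"
    by (metis inv_f_f)
  then show ?thesis
    by (simp add: lsucc_def)
qed

lemma rm_r: "z \<noteq> e \<Longrightarrow> rm e r z = (if r z = e then r e else r z)"
  using bijs(1) by (rule rm_apply)

lemma rm_s: "z \<noteq> e \<Longrightarrow> rm e s z = (if s z = e then s e else s z)"
  using bijs(2) by (rule rm_apply)

lemma delete_eq:
  assumes e: "e \<in> E" and tri: "s e = e \<or> r e = e"
  shows "delete M {e} = mk (E - {e}) (rm e r) (rm e s)"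
proof (rule emap_eq_mkI)
  let ?A = "(E - {e}) \<times> (UNIV :: side set)"
  have rot: "rot (delete M {e}) = first_return ?A (rot M)"
    by (simp add: delete_def submap_def)
  show "edges (delete M {e}) = E - {e}"
    by (simp add: delete_def submap_def)
  show "rot (delete M {e}) (z, d) = (z, d)" if "z \<notin> E - {e}" for z d
    using that by (simp add: rot first_return_outside)
  fix z assume z: "z \<in> E - {e}"
  show "rot (delete M {e}) (z, Head) = (rm e r z, Tail)"
  proof (cases "r z = e")
    case True
    then have "r e \<noteq> e"
      using z by (metis DiffE insertI1 r_eq)
    \<comment> \<open>Here \<open>s e = e\<close>, so both ends of \<open>e\<close> are skipped in
      turn: the walk goes from \<open>(z, Head)\<close> over \<open>(e, Tail)\<close> and
      \<open>(e, Head)\<close> to \<open>(r e, Tail)\<close>.\<close>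
    then show ?thesis
      unfolding rot using True z e tri
      by (subst first_return_3) (auto simp: rot_Head rot_Tail rm_r)
  next
    case False
    then show ?thesis
      unfolding rot using z by (subst first_return_1) (auto simp: rot_Head rm_r)
  qed
  show "rot (delete M {e}) (z, Tail) = (rm e s z, Head)"
  proof (cases "s z = e")
    case True
    then have "s e \<noteq> e"
      using z s_eq by (metis DiffE insertI1)
    then show ?thesis
      unfolding rot using True z e tri
      by (subst first_return_3) (auto simp: rot_Head rot_Tail rm_s)
  next
    case False
    then show ?thesis
      unfolding rot using z by (subst first_return_1) (auto simp: rot_Tail rm_s)
  qed
qed

lemma reduce1_eq:
  assumes e: "e \<in> E"
  shows "reduce1 M e = mk (E - {e}) (rm e r) (rm e s)"
proof (cases "s e = e \<or> r e = e")
  case True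
  then show ?thesis
    using delete_eq[OF e] e by (auto simp: reduce1_def omega_loop_iff omega2_loop_iff)
next
  case False
  let ?A = "(E - {e}) \<times> (UNIV :: side set)"
  let ?p = "rot M \<circ> transpose (e, Tail) (e, Head)"
  have red: "reduce1 M e = \<lparr>edges = E - {e}, rot = first_return ?A ?p\<rparr>"
    using False e by (simp add: reduce1_def omega_loop_iff omega2_loop_iff)
  show ?thesis
  proof (rule emap_eq_mkI)
    show "edges (reduce1 M e) = E - {e}"
      by (simp add: red)
    show "rot (reduce1 M e) (z, d) = (z, d)" if "z \<notin> E - {e}" for z d
      using that by (simp add: red first_return_outside)
    fix z assume z: "z \<in> E - {e}"
    then have p: "?p (z, Head) = (r z, Tail)" "?p (z, Tail) = (s z, Head)"
      by (auto simp: rot_Head rot_Tail)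
    have pe: "?p (e, Tail) = (r e, Tail)" "?p (e, Head) = (s e, Head)"
      using e by (auto simp: rot_Head rot_Tail)
    have "rot (reduce1 M e) (z, Head) = first_return ?A ?p (z, Head)"
      by (simp add: red)
    also have "\<dots> = (rm e r z, Tail)"
    proof (cases "r z = e")
      case True
      then have "first_return ?A ?p (z, Head) = ?p (?p (z, Head))"
        using z e False p pe by (intro first_return_2) (simp_all del: comp_apply)
      then show ?thesis
        using True z p pe by (simp add: rm_r del: comp_apply)
    next
      case False
      then have "first_return ?A ?p (z, Head) = ?p (z, Head)"
        using z p by (intro first_return_1) (simp_all del: comp_apply)
      then show ?thesis
        using False z p by (simp add: rm_r del: comp_apply)
    qed
    finally show "rot (reduce1 M e) (z, Head) = (rm e r z, Tail)" .
    have "rot (reduce1 M e) (z, Tail) = first_return ?A ?p (z, Tail)"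
      by (simp add: red)
    also have "\<dots> = (rm e s z, Head)"
    proof (cases "s z = e")
      case True
      then have "first_return ?A ?p (z, Tail) = ?p (?p (z, Tail))"
        using z e False p pe by (intro first_return_2) (simp_all del: comp_apply)
      then show ?thesis
        using True z p pe by (simp add: rm_s del: comp_apply)
    next
      case False
      then have "first_return ?A ?p (z, Tail) = ?p (z, Tail)"
        using z p by (intro first_return_1) (simp_all del: comp_apply)
      then show ?thesis
        using False z p by (simp add: rm_s del: comp_apply)
    qed
    finally show "rot (reduce1 M e) (z, Tail) = (rm e s z, Head)" .
  qed
qed

lemma reduce_omega2_eq:
  assumes e: "e \<in> E"
  shows "reduce_omega2 M e = mk (E - {e}) (rm e r) (rm e (s \<circ> transpose e (r e)))"
proof -
  consider "r e = e" | "s e = e" "r e \<noteq> e" | "s e \<noteq> e" "r e \<noteq> e"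
    by blast
  then show ?thesis
  proof cases
    case 1
    then show ?thesis
      using delete_eq[OF e] e by (simp add: reduce_omega2_def omega2_loop_iff)
  next
    case 2
    have "s (r e) \<noteq> e"
      using 2 s_eq by metis
    \<comment> \<open>For an \<omega>-loop the transposition sends \<open>r e\<close> to
      \<open>e\<close> and \<open>e\<close> to \<open>s (r e)\<close>; erasing \<open>e\<close>
      restores the old value at \<open>r e\<close>.\<close>
    then have "rm e (s \<circ> transpose e (r e)) = rm e s"
      unfolding rm_def by (intro ext) (use 2 in \<open>auto simp: transpose_def s_eq\<close>)
    then show ?thesis
      using delete_eq[OF e] 2 e by (simp add: reduce_omega2_def omega_loop_iff)
  next
    case 3
    define f where "f = r e"
    have f: "f \<in> E" "f \<noteq> e"
      using e 3 by (auto simp: f_def)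
    let ?A = "(E - {e}) \<times> (UNIV :: side set)"
    let ?t = "transpose (e, Tail) (f, Tail)"
    define p where "p = ?t \<circ> rot M \<circ> ?t"
    have red: "reduce_omega2 M e = \<lparr>edges = E - {e}, rot = first_return ?A p\<rparr>"
      using 3 e by (simp add: reduce_omega2_def omega_loop_iff omega2_loop_iff bypass_def
          f_def[symmetric] Let_def p_def)
    have pH: "p (z, Head) = ((if z = e then e else rm e r z), Tail)" if "z \<in> E" for z
      using that 3 f by (auto simp: p_def rot_Head rm_r f_def)
    have pT: "p (z, Tail) = ((if z = e then s f else if z = f then s e else s z), Head)"
      if "z \<in> E" for z
      using that e f by (auto simp: p_def rot_Tail)
    have t: "bij (s \<circ> transpose e (r e))"
      using bijs(2) by (simp add: bij_comp)
    have sz: "rm e (s \<circ> transpose e (r e)) z =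
        (if z = f then s e else if s z = e then s f else s z)" if "z \<noteq> e" for z
      using 3 that f unfolding rm_apply[OF t that] by (auto simp: f_def s_eq)
    show ?thesis
    proof (rule emap_eq_mkI)
      show "edges (reduce_omega2 M e) = E - {e}"
        by (simp add: red)
      show "rot (reduce_omega2 M e) (z, d) = (z, d)" if "z \<notin> E - {e}" for z d
        using that by (simp add: red first_return_outside)
      fix z assume z: "z \<in> E - {e}"
      then have "rm e r z \<in> E - {e}"
        using 3 by (auto simp: rm_r)
      then show "rot (reduce_omega2 M e) (z, Head) = (rm e r z, Tail)"
        using z pH[of z] by (simp add: red first_return_1)
      have "first_return ?A p (z, Tail) = (rm e (s \<circ> transpose e (r e)) z, Head)"
      proof (cases "z \<noteq> f \<and> s z = e")
        case True
        \<comment> \<open>The walk passes both ends that are still named \<open>e\<close>, which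
          belong to the bypassed vertex, and continues to where the tail end of \<open>f\<close>
          used to lead.\<close>
        then have "s f \<noteq> e"
          by (metis s_eq)
        moreover have "p (z, Tail) = (e, Head)" "p (e, Head) = (e, Tail)" "p (e, Tail) = (s f, Head)"
          using z True e pT[of z] pH[of e] pT[of e] by auto
        ultimately have "first_return ?A p (z, Tail) = p (p (p (z, Tail)))"
          using z e f by (intro first_return_3) auto
        then show ?thesis
          using True z sz \<open>p (z, Tail) = _\<close> \<open>p (e, Head) = _\<close> \<open>p (e, Tail) = _\<close> by simp
      next
        case False
        then show ?thesis
          using z e 3 pT[of z] sz[of z] by (subst first_return_1) auto
      qed
      then show "rot (reduce_omega2 M e) (z, Tail) =
          (rm e (s \<circ> transpose e (r e)) z, Head)"
        by (simp add: red)
    qed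
  qed
qed

end

section \<open>Disjoint unions and maps with good permutations\<close>

lemma disjoint_union_eq:
  assumes "alt_map M" "alt_map N" and disj: "edges M \<inter> edges N = {}"
  shows "disjoint_union M N =
    mk (edges M \<union> edges N) (rsucc M \<circ> rsucc N) (asucc M \<circ> asucc N)"
proof -
  interpret M: alt_map M by fact
  interpret N: alt_map N by fact
  have out: "asucc M z = z" if "z \<notin> edges M" for z
    using M.s that by (simp add: permutes_def)
  have out': "asucc N z = z" if "z \<notin> edges N" for z
    using N.s that by (simp add: permutes_def)
  show ?thesis
  proof (rule emap_eq_mkI)
    fix e assume e: "e \<in> edges M \<union> edges N"
    have *: "e \<in> edges N \<Longrightarrow> asucc N e \<notin> edges M" "e \<in> edges N \<Longrightarrow> rsucc N e \<notin> edges M"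
      using disj N.r_in N.s_in by blast+
    have "e \<in> edges M \<and> e \<notin> edges N \<or> e \<in> edges N \<and> e \<notin> edges M"
      using e disj by auto
    then show "rot (disjoint_union M N) (e, Head) = ((rsucc M \<circ> rsucc N) e, Tail)"
      "rot (disjoint_union M N) (e, Tail) = ((asucc M \<circ> asucc N) e, Head)"
      using * out out' M.r_out N.r_out
      by (auto simp: disjoint_union_def M.rot_Head M.rot_Tail N.rot_Head N.rot_Tail)
  qed (auto simp: disjoint_union_def)
qed

lemma two_parts_disjoint_union:
  assumes "alt_map M" "alt_map N" and disj: "edges M \<inter> edges N = {}"
  shows "two_parts (edges M \<union> edges N) (rsucc M \<circ> rsucc N) (asucc M \<circ> asucc N)
    (edges M) (rsucc M) (asucc M) (edges N) (rsucc N) (asucc N)"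
proof -
  interpret M: alt_map M by fact
  interpret N: alt_map N by fact
  have out: "asucc M z = z" if "z \<notin> edges M" for z
    using M.s that by (simp add: permutes_def)
  have out': "asucc N z = z" if "z \<notin> edges N" for z
    using N.s that by (simp add: permutes_def)
  show ?thesis
  proof unfold_locales
    show "finite (edges M \<union> edges N)"
      using M.fin N.fin by simp
    show "rsucc M \<circ> rsucc N permutes edges M \<union> edges N"
      using M.r N.r by (intro permutes_compose) (auto intro: permutes_subset)
    show "asucc M \<circ> asucc N permutes edges M \<union> edges N"
      using M.s N.s by (intro permutes_compose) (auto intro: permutes_subset)
    show "(rsucc M \<circ> rsucc N) z = rsucc M z" "(asucc M \<circ> asucc N) z = asucc M z"
      if "z \<in> edges M" for z
    proof -
      have "z \<notin> edges N"
        using that disj by blast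
      then show "(rsucc M \<circ> rsucc N) z = rsucc M z" "(asucc M \<circ> asucc N) z = asucc M z"
        using N.r_out out' by auto
    qed
    show "(rsucc M \<circ> rsucc N) z = rsucc N z" "(asucc M \<circ> asucc N) z = asucc N z"
      if "z \<in> edges N" for z
    proof -
      have "rsucc N z \<notin> edges M" "asucc N z \<notin> edges M"
        using that disj N.r_in[of z] N.s_in[of z] by blast+
      then show "(rsucc M \<circ> rsucc N) z = rsucc N z" "(asucc M \<circ> asucc N) z = asucc N z"
        using M.r_out out by auto
    qed
  qed (use disj M.r M.s N.r N.s M.fin N.fin in auto)
qed

definition good_map :: "'e emap \<Rightarrow> bool" where
  "good_map M \<longleftrightarrow> alternating_dimap M \<and> good (edges M) (rsucc M) (asucc M)"

definition tval :: "'e emap \<Rightarrow> int poly poly" where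
  "tval M = val (edges M) (rsucc M) (asucc M)"

lemma good_map_mk:
  assumes "good E r s"
  shows "good_map (mk E r s)" and "tval (mk E r s) = val E r s"
proof -
  interpret good_hypermap E r s
    using assms by unfold_locales
  show "good_map (mk E r s)" "tval (mk E r s) = val E r s"
    using assms alternating_mk rsucc_mk asucc_mk by (auto simp: good_map_def tval_def)
qed

lemma (in hypermap) con_Int_E: "con r s (A \<inter> E) = con r s A"
  unfolding con_def
proof (rule eqcl_eqI)
  fix a b assume "(a, b) \<in> gr (s \<circ> r) \<union> lk r A"
  then show "(a, b) \<in> eqcl (gr (s \<circ> r) \<union> lk r (A \<inter> E))"
    using r_out[of a] by (cases "a \<in> E") (auto intro: eqcl_base)
qed (auto intro: eqcl_base)

lemma (in hypermap) rk_Diff: "rk E r s (E - A) = rk E r s (- A)"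
proof -
  have "- A \<inter> E = E - A"
    by auto
  then show ?thesis
    unfolding rk_def using con_Int_E[of "- A"] by (intro ncl_cong_eqcl) (simp add: con_def)
qed

section \<open>The equations of the c-Tutte invariant on good maps\<close>

locale good_map_edge = alt_map M for M :: "'e emap" +
  fixes e x
  assumes goodM: "good (edges M) (rsucc M) (asucc M)" and eE: "e \<in> edges M" and rx: "rsucc M x = e"
begin

sublocale edge: marked "edges M" "rsucc M" "asucc M" e x
  using goodM eE rx by unfold_locales

lemma ultraloop_iff: "ultraloop M e \<longleftrightarrow> r e = e \<and> s e = e"
  using eE by (auto simp: ultraloop_def one_loop_iff omega_loop_iff omega2_loop_iff)

lemma triloop_iff: "triloop M e \<longleftrightarrow> s (r e) = e \<or> s e = e \<or> r e = e"
  using eE by (auto simp: triloop_def one_loop_iff omega_loop_iff omega2_loop_iff)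

lemma not_ultraloop:
  assumes "\<not> ultraloop M e"
  shows "s (r e) = e \<Longrightarrow> r e \<noteq> e" "s e = e \<Longrightarrow> r e \<noteq> e"
  using assms by (auto simp: ultraloop_iff)

text \<open>Nested relations with equally many classes agree, so the component count is kept exactly
  if both lost links are recovered from the rest.\<close>

lemma cutset_pair_iff:
  assumes "r y = l" "l \<in> E"
  shows "cutset M {e, l} \<longleftrightarrow>
    \<not> ((x, e) \<in> con r s (- {e, l}) \<and> (y, l) \<in> con r s (- {e, l}))"
proof
  assume "cutset M {e, l}"
  then have less: "rk E r s UNIV < rk E r s (- {e, l})"
    by (simp add: cutset_iff rk_Diff)
  show "\<not> ((x, e) \<in> con r s (- {e, l}) \<and> (y, l) \<in> con r s (- {e, l}))"
  proof
    assume "(x, e) \<in> con r s (- {e, l}) \<and> (y, l) \<in> con r s (- {e, l})"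
    then have *: "(a, r a) \<in> con r s (- {e, l})" for a
      using rx assms(1) r_eq[of a x] r_eq[of a y]
      by (cases "r a = e"; cases "r a = l") (auto simp: con_def intro: eqcl_base)
    have "eqcl (gr (s \<circ> r) \<union> lk r UNIV) \<subseteq> con r s (- {e, l})"
      unfolding con_def by (intro eqcl_least) (use * in \<open>auto simp: con_def intro: eqcl_base\<close>)
    then have "rk E r s (- {e, l}) \<le> rk E r s UNIV"
      unfolding rk_def con_def by (intro ncl_antimono fin)
    then show False
      using less by simp
  qed
next
  assume neg: "\<not> ((x, e) \<in> con r s (- {e, l}) \<and> (y, l) \<in> con r s (- {e, l}))"
  show "cutset M {e, l}"
  proof (rule ccontr)
    assume "\<not> cutset M {e, l}"
    then have eq: "rk E r s (- {e, l}) = rk E r s UNIV"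
      using rk_antimono[of "- {e, l}" UNIV] by (simp add: cutset_iff rk_Diff)
    have "(a, b) \<in> con r s (- {e, l})" if "a \<in> E" "b \<in> E" "(a, b) \<in> con r s UNIV" for a b
      using that eq con_mono[of "- {e, l}" UNIV r s] ncl_eq_imp_eqcl[OF fin, of _ _ a b]
      unfolding rk_def con_def by blast
    moreover have "(x, e) \<in> con r s UNIV" "(y, l) \<in> con r s UNIV"
      using rx assms by (auto simp: con_def intro!: eqcl_base)
    moreover have "x \<in> E" "y \<in> E"
      using rx eE assms by auto
    ultimately show False
      using neg assms(2) eE by blast
  qed
qed

lemma genus_M: "genus M = 0"
  using goodM by (intro genus_eq_0) (simp add: good_def)

text \<open>If the link into \<open>e\<close> can be recovered, so can the one into
  \<open>r e\<close>, along the remaining arc from \<open>r e\<close> to \<open>x\<close>. The genus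
  is zero and cannot decrease, which leaves the cutset condition.\<close>

lemma omega_semiloop_iff:
  assumes "\<not> triloop M e"
  shows "omega_semiloop M e \<longleftrightarrow> (x, e) \<notin> con r s (- {e, r e})"
proof -
  have re: "r e \<noteq> e"
    using assms by (simp add: triloop_iff)
  have "(e, r e) \<in> con r s (- {e, r e})" if "(x, e) \<in> con r s (- {e, r e})"
    using that edge.arc[OF re] eqcl_mono[of "lk r (- {e, r e})" "gr (s \<circ> r) \<union> lk r (- {e, r e})"]
    unfolding con_def by (meson Un_upper2 eqcl_sym eqcl_trans subsetD)
  then show ?thesis
    using re cutset_pair_iff[of e "r e"] eE genus_M by (auto simp: omega_semiloop_def)
qed

text \<open>Let \<open>y\<close> precede the left successor \<open>l\<close> on its c-face; then
  \<open>y\<close> and \<open>e\<close> have the same head. If \<open>l\<close> is on another c-face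
  than \<open>e\<close>, each of the two c-faces loses one link and stays connected. On the same
  c-face, a size of at most two forces a triloop, loops do not need their links, and the third kind
  forces \<open>y = e\<close>, hence a 1-loop. So the equation with factor one only meets c-faces of
  one edge.\<close>

lemma not_omega2_semiloop:
  assumes tri: "\<not> triloop M e"
  shows "\<not> omega2_semiloop M e"
proof
  assume semi: "omega2_semiloop M e"
  have ne: "s (r e) \<noteq> e" "s e \<noteq> e" "r e \<noteq> e"
    using tri by (auto simp: triloop_iff)
  obtain l where l: "s l = e"
    using bijs(2) by (metis bij_pointE)
  obtain y where y: "r y = l"
    using pred_ex by blast
  have lE: "l \<in> E"
    using l eE by auto
  have "cutset M {e, l}"
    using semi ne lsucc_eq[OF l eE] genus_M eE by (auto simp: omega2_semiloop_def omega_loop_iff)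
  then have cut: "\<not> ((x, e) \<in> con r s (- {e, l}) \<and> (y, l) \<in> con r s (- {e, l}))"
    using cutset_pair_iff[OF y lE] by simp
  have ye: "(y, e) \<in> eqcl (gr (s \<circ> r))"
    using y l by (intro eqcl_base) simp
  have mem: "x \<in> corb r e" "y \<in> corb r l"
    using rx y corb_step_iff[of r x e] corb_step_iff[of r y l] by auto
  show False
  proof (cases "l \<in> corb r e")
    case False
    have *: "(z, f) \<in> con r s (- {e, l})"
      if "z \<in> corb r f" "corb r f - {f} \<subseteq> - {e, l}" for z f
    proof -
      have "(f, z) \<in> eqcl (lk r (corb r f - {f}))"
        using that(1) unfolding corb_def by (intro eqcl_cycle_without_link r_perm) simp
      moreover have "lk r (corb r f - {f}) \<subseteq> gr (s \<circ> r) \<union> lk r (- {e, l})"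
        using that(2) by auto
      ultimately have "(f, z) \<in> eqcl (gr (s \<circ> r) \<union> lk r (- {e, l}))"
        by (rule subsetD[OF eqcl_mono, rotated])
      then show ?thesis
        unfolding con_def by (rule eqcl_sym)
    qed
    have "e \<notin> corb r l"
      using False corb_eq[of e r l] by auto
    then show False
      using False cut *[OF mem(1)] *[OF mem(2)] by auto
  next
    case True
    then have y_mem: "y \<in> corb r e"
      using mem corb_eq by metis
    consider (C) "\<forall>z\<in>corb r e. r (r z) = z" | (B) "\<forall>z\<in>corb r e. (z, r z) \<in> eqcl (gr (s \<circ> r))" |
      (A) "\<forall>z\<in>corb r e. \<forall>w\<in>corb r e. (z, w) \<in> con r s (- corb r e) \<longrightarrow> z = w"
      using edge.good_f[OF eE] unfolding kind_def by blast
    then show False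
    proof cases
      case C
      have "y \<in> {e, r e}"
        using y_mem corb_two[of e] C by simp
      moreover have "r (r e) = e"
        using C by simp
      ultimately show False
        using y l ne by (metis empty_iff insert_iff)
    next
      case B
      then have "(x, e) \<in> eqcl (gr (s \<circ> r))" "(y, l) \<in> eqcl (gr (s \<circ> r))"
        using mem(1) y_mem rx y by blast+
      then show False
        using cut eqcl_subset_con by blast
    next
      case A
      then have "y = e"
        using ye y_mem eqcl_subset_con[of s r] by (meson corb_self subsetD)
      then show False
        using y l ne by simp
    qed
  qed
qed

lemma reduce1_mk: "reduce1 M e = mk (E - {e}) edge.r' edge.s1"
  using eE by (rule reduce1_eq)

lemma reduce_omega2_mk: "reduce_omega2 M e = mk (E - {e}) edge.r' edge.s2"
  using eE by (rule reduce_omega2_eq)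

lemma good_reduce_omega2: "good_map (reduce_omega2 M e)"
  unfolding reduce_omega2_mk by (rule good_map_mk[OF edge.good2])

lemma fixed_step:
  assumes "r e = e"
  shows "delete M {e} = reduce1 M e" "good_map (reduce1 M e)" "tval M = tval (reduce1 M e)"
proof -
  have g: "good (E - {e}) edge.r' edge.s1"
    using assms by (intro edge.good1) simp
  show "delete M {e} = reduce1 M e"
    using assms eE by (simp add: reduce1_def omega2_loop_iff)
  show "good_map (reduce1 M e)" "tval M = tval (reduce1 M e)"
    using good_map_mk[OF g] edge.val_rm_fixed[OF assms] by (simp_all add: reduce1_mk tval_def)
qed

lemma x_step:
  assumes "proper_loop one_loop M e \<or> proper_semiloop omega_semiloop M e"
  shows "tval M = var_x * tval (reduce_omega2 M e)"
proof -
  have "r e \<noteq> e \<and> (x, e) \<notin> con r s (- {e, r e})"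
    using assms
  proof
    assume "proper_loop one_loop M e"
    then have "s (r e) = e" "\<not> ultraloop M e"
      using eE by (auto simp: proper_loop_def one_loop_iff)
    then show ?thesis
      using not_ultraloop edge.one_loop_bridge by auto
  next
    assume "proper_semiloop omega_semiloop M e"
    then show ?thesis
      using omega_semiloop_iff by (auto simp: proper_semiloop_def triloop_iff)
  qed
  then show ?thesis
    using edge.val_bridge good_map_mk[OF edge.good2] by (simp add: tval_def reduce_omega2_mk)
qed

lemma y_step:
  assumes "proper_loop omega_loop M e \<or> proper_semiloop one_semiloop M e"
  shows "good_map (reduce1 M e)" "tval M = var_y * tval (reduce1 M e)"
proof -
  have loop: "r e \<noteq> e \<and> (x, e) \<in> eqcl (gr (s \<circ> r))"
    using assms
  proof
    assume "proper_loop omega_loop M e"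
    then show ?thesis
      using eE not_ultraloop edge.s_e_fixed_loop by (auto simp: proper_loop_def omega_loop_iff)
  next
    assume "proper_semiloop one_semiloop M e"
    then show ?thesis
      using is_loop_iff[OF eE rx] by (auto simp: proper_semiloop_def triloop_iff one_semiloop_def)
  qed
  then have g: "good (E - {e}) edge.r' edge.s1"
    by (intro edge.good1) simp
  show "good_map (reduce1 M e)" "tval M = var_y * tval (reduce1 M e)"
    using loop edge.val_loop good_map_mk[OF g] by (simp_all add: tval_def reduce1_mk)
qed

lemma unit_step:
  assumes "proper_loop omega2_loop M e \<or> proper_semiloop omega2_semiloop M e"
  shows "r e = e" "reduce_omega M e = reduce1 M e"
proof -
  show re: "r e = e"
    using assms not_omega2_semiloop eE
    by (auto simp: proper_loop_def proper_semiloop_def omega2_loop_iff)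
  then show "reduce_omega M e = reduce1 M e"
    using eE by (simp add: reduce_omega_def reduce1_def omega2_loop_iff)
qed

text \<open>A c-face of loops would make \<open>e\<close> a loop, and the third kind would make it a
  bridge. The equation with two terms therefore only meets c-faces of two edges, where contraction
  keeps the map good.\<close>

lemma sum_step:
  assumes "\<not> ultraloop M e"
    and "\<not> (proper_loop one_loop M e \<or> proper_semiloop omega_semiloop M e)"
    and "\<not> (proper_loop omega_loop M e \<or> proper_semiloop one_semiloop M e)"
    and "\<not> (proper_loop omega2_loop M e \<or> proper_semiloop omega2_semiloop M e)"
  shows "good_map (reduce1 M e)" "tval M = tval (reduce1 M e) + tval (reduce_omega2 M e)"
proof -
  have tri: "\<not> triloop M e"
    using assms by (auto simp: proper_loop_def triloop_def)
  then have re: "r e \<noteq> e"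
    by (simp add: triloop_iff)
  have nonloop: "(x, e) \<notin> eqcl (gr (s \<circ> r))"
    using assms tri is_loop_iff[OF eE rx] by (auto simp: proper_semiloop_def one_semiloop_def)
  have nonbridge: "(x, e) \<in> con r s (- {e, r e})"
    using assms tri omega_semiloop_iff[OF tri] by (auto simp: proper_semiloop_def)
  have x_mem: "x \<in> corb r e"
    using rx corb_step_iff[of r x e] by simp
  consider (C) "\<forall>z\<in>corb r e. r (r z) = z" | (B) "\<forall>z\<in>corb r e. (z, r z) \<in> eqcl (gr (s \<circ> r))" |
    (A) "\<forall>z\<in>corb r e. \<forall>w\<in>corb r e. (z, w) \<in> con r s (- corb r e) \<longrightarrow> z = w"
    using edge.good_f[OF eE] unfolding kind_def by blast
  then have edge: "r (r e) = e"
  proof cases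
    case B
    then have "(x, e) \<in> eqcl (gr (s \<circ> r))"
      using x_mem rx by blast
    then show ?thesis
      using nonloop by simp
  next
    case A
    then have "(x, e) \<notin> con r s (- {e, r e})"
      using c_face_cut[OF A _ re rx] corb_step[OF corb_self, of r e] by simp
    then show ?thesis
      using nonbridge by simp
  qed simp
  then have g: "good (E - {e}) edge.r' edge.s1"
    by (intro edge.good1) simp
  show "good_map (reduce1 M e)" "tval M = tval (reduce1 M e) + tval (reduce_omega2 M e)"
    using edge.val_sum[OF re edge nonloop nonbridge] good_map_mk[OF g] good_map_mk[OF edge.good2]
    by (simp_all add: tval_def reduce1_mk reduce_omega2_mk)
qed

end

lemma good_map_edge_exists:
  assumes "good_map M" "e \<in> edges M"
  obtains x where "good_map_edge M e x"
proof -
  interpret alt_map M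
    using assms by unfold_locales (simp add: good_map_def)
  obtain x where "r x = e"
    using pred_ex by blast
  then have "good_map_edge M e x"
    using assms by unfold_locales (auto simp: good_map_def)
  then show ?thesis
    by (rule that)
qed

lemma good_map_disjoint_union:
  assumes "alternating_dimap M" "alternating_dimap N" "edges M \<inter> edges N = {}"
  shows "good_map (disjoint_union M N) \<longleftrightarrow> good_map M \<and> good_map N"
    and "good_map M \<Longrightarrow> good_map N \<Longrightarrow> tval (disjoint_union M N) = tval M * tval N"
proof -
  have alt: "alt_map M" "alt_map N"
    using assms by (auto intro: alt_map.intro)
  interpret two_parts "edges M \<union> edges N" "rsucc M \<circ> rsucc N" "asucc M \<circ> asucc N"
    "edges M" "rsucc M" "asucc M" "edges N" "rsucc N" "asucc N"
    using two_parts_disjoint_union[OF alt assms(3)] .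
  have mk: "disjoint_union M N =
      mk (edges M \<union> edges N) (rsucc M \<circ> rsucc N) (asucc M \<circ> asucc N)"
    using disjoint_union_eq[OF alt assms(3)] .
  show "good_map (disjoint_union M N) \<longleftrightarrow> good_map M \<and> good_map N"
    using A.alternating_mk A.rsucc_mk A.asucc_mk good_iff assms by (simp add: good_map_def mk)
  show "tval (disjoint_union M N) = tval M * tval N" if "good_map M" "good_map N"
    using val_mult good_iff that A.rsucc_mk A.asucc_mk by (simp add: good_map_def tval_def mk)
qed

lemma tval_empty: "edges M = {} \<Longrightarrow> tval M = 1"
proof -
  assume E: "edges M = {}"
  have "omits_one (rsucc M) {} = (\<lambda>R. R = {})"
    by (auto simp: omits_one_def)
  then show ?thesis
    by (simp add: tval_def val_def E rank_poly_def)
qed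

text \<open>\<open>tval\<close> obeys each rule for every edge to which the rule applies, and the
  maps in the premises are good again, so no sequence of choices can give another result.\<close>

lemma Tc_value_unique: "Tc_value M p \<Longrightarrow> good_map M \<Longrightarrow> p = tval M"
proof (induction rule: Tc_value.induct)
  case (empty M)
  then show ?case
    by (simp add: tval_empty)
next
  case (disjoint_union M N p q)
  then show ?case
    using good_map_disjoint_union[of M N] by auto
next
  case (ultraloop e M p)
  then obtain x where "good_map_edge M e x"
    using good_map_edge_exists by metis
  then interpret good_map_edge M e x .
  show ?case
    using ultraloop fixed_step ultraloop_iff by metis
next
  case (x_step e M p)
  then obtain x where "good_map_edge M e x"
    using good_map_edge_exists by metis
  then interpret m: good_map_edge M e x .
  show ?case
    using x_step.IH[OF m.good_reduce_omega2] m.x_step[OF x_step.hyps(2)] by simp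
next
  case (y_step e M p)
  then obtain x where "good_map_edge M e x"
    using good_map_edge_exists by metis
  then interpret m: good_map_edge M e x .
  show ?case
    using y_step.IH m.y_step[OF y_step.hyps(2)] by simp
next
  case (unit_step e M p)
  then obtain x where "good_map_edge M e x"
    using good_map_edge_exists by metis
  then interpret m: good_map_edge M e x .
  show ?case
    using unit_step.IH m.unit_step[OF unit_step.hyps(2)] m.fixed_step by metis
next
  case (sum_step e M p q)
  then obtain x where "good_map_edge M e x"
    using good_map_edge_exists by metis
  then interpret m: good_map_edge M e x .
  show ?case
    using sum_step.IH(1) sum_step.IH(2)[OF m.good_reduce_omega2] m.sum_step[OF sum_step.hyps(2-5)]
    by simp
qed

lemma Tc_value_exists: "good_map M \<Longrightarrow> \<exists>p. Tc_value M p"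
proof (induction "card (edges M)" arbitrary: M rule: less_induct)
  case less
  show ?case
  proof (cases "edges M = {}")
    case True
    then show ?thesis
      using Tc_value.empty by blast
  next
    case False
    then obtain e where e: "e \<in> edges M"
      by auto
    then obtain x where "good_map_edge M e x"
      using good_map_edge_exists less.prems by metis
    then interpret m: good_map_edge M e x .
    have small: "card (edges M - {e}) < card (edges M)"
      using e m.fin by (metis card_Diff1_less)
    have r2: "\<exists>p. Tc_value (reduce_omega2 M e) p"
      using less.hyps[OF _ m.good_reduce_omega2] small by (simp add: m.reduce_omega2_mk)
    have r1: "\<exists>p. Tc_value (reduce1 M e) p" if "good_map (reduce1 M e)"
      using less.hyps[OF _ that] small by (simp add: m.reduce1_mk)
    \<comment> \<open>The edge types are exhaustive, so an equation applies to \<open>e\<close>, and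
      each reduction it calls for removes one edge.\<close>
    show ?thesis
      using r1 r2 m.y_step(1) m.unit_step m.sum_step(1) m.fixed_step(1,2) m.ultraloop_iff
        Tc_value.ultraloop[OF e] Tc_value.x_step[OF e] Tc_value.y_step[OF e]
        Tc_value.unit_step[OF e] Tc_value.sum_step[OF e]
      by metis
  qed
qed

lemma good_map_Tc:
  assumes "good_map M"
  shows "Tc_well_defined M" and "Tc M = tval M"
proof -
  obtain p where "Tc_value M p"
    using Tc_value_exists[OF assms] by blast
  then have *: "Tc_value M q \<longleftrightarrow> q = tval M" for q
    using Tc_value_unique[OF _ assms] by blast
  then show "Tc_well_defined M" "Tc M = tval M"
    by (simp_all add: Tc_well_defined_def Tc_def)
qed

section \<open>First returns and submaps\<close>

lemma first_return_ex:
  assumes "permutation p" "x \<in> A"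
  obtains n where "0 < n" "(p ^^ n) x \<in> A" "first_return A p x = (p ^^ n) x"
    "\<And>m. 0 < m \<Longrightarrow> m < n \<Longrightarrow> (p ^^ m) x \<notin> A"
proof -
  define n where "n = (LEAST n. 0 < n \<and> (p ^^ n) x \<in> A)"
  obtain k where "0 < k" "(p ^^ k) x = x"
    using permutation_self_in_orbit[OF assms(1), of x] unfolding orbit_altdef by auto
  then have "0 < k \<and> (p ^^ k) x \<in> A"
    using assms(2) by simp
  then have "0 < n \<and> (p ^^ n) x \<in> A"
    unfolding n_def by (rule LeastI)
  moreover have "(p ^^ m) x \<notin> A" if "0 < m" "m < n" for m
    using that not_less_Least[of m "\<lambda>n. 0 < n \<and> (p ^^ n) x \<in> A"] by (simp add: n_def)
  moreover have "first_return A p x = (p ^^ n) x"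
    using assms(2) by (simp add: first_return_def n_def)
  ultimately show ?thesis
    using that by blast
qed

lemma first_return_in: "permutation p \<Longrightarrow> x \<in> A \<Longrightarrow> first_return A p x \<in> A"
  by (rule first_return_ex) auto

lemma first_return_last:
  assumes "permutation p" "x \<in> A"
  obtains w where "p w = first_return A p x" "w = x \<or> w \<notin> A"
proof -
  obtain n where n: "0 < n" "first_return A p x = (p ^^ n) x"
    "\<And>m. 0 < m \<Longrightarrow> m < n \<Longrightarrow> (p ^^ m) x \<notin> A"
    using first_return_ex[OF assms] by metis
  then obtain m where m: "n = Suc m"
    by (cases n) auto
  have "(p ^^ m) x = x \<or> (p ^^ m) x \<notin> A"
    using n(3)[of m] m by (cases m) auto
  then show ?thesis
    using that[of "(p ^^ m) x"] n m by simp
qed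

lemma first_return_permutes:
  assumes "permutation p" "finite A"
  shows "first_return A p permutes A"
proof -
  let ?f = "first_return A p"
  have inj: "inj (p ^^ n)" for n
    using assms(1) by (simp add: bij_is_inj bij_betw_funpow permutation_bijective)
  \<comment> \<open>If two walks returned at the same point after \<open>m < n\<close> steps, then
    \<open>x\<close> would lie on the walk from \<open>y\<close> and in \<open>A\<close> before the
    first return of \<open>y\<close>.\<close>
  have less: False
    if xy: "x \<in> A" "y \<in> A" "?f x = (p ^^ m) x" "?f y = (p ^^ n) y" "?f x = ?f y" "m < n" "x \<noteq> y"
      and n: "\<And>k. 0 < k \<Longrightarrow> k < n \<Longrightarrow> (p ^^ k) y \<notin> A" and m: "0 < m" for x y m n
  proof -
    have "(p ^^ m) x = (p ^^ m) ((p ^^ (n - m)) y)"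
      using xy by (simp add: funpow_add[symmetric, THEN fun_cong, simplified])
    then have "x = (p ^^ (n - m)) y"
      using inj by (simp add: inj_eq)
    then show False
      using n[of "n - m"] xy m by simp
  qed
  have "inj_on ?f A"
  proof (rule inj_onI, rule ccontr)
    fix x y assume xy: "x \<in> A" "y \<in> A" "?f x = ?f y" "x \<noteq> y"
    obtain m where m: "0 < m" "?f x = (p ^^ m) x" "\<And>k. 0 < k \<Longrightarrow> k < m \<Longrightarrow> (p ^^ k) x \<notin> A"
      using first_return_ex[OF assms(1) xy(1)] by metis
    obtain n where n: "0 < n" "?f y = (p ^^ n) y" "\<And>k. 0 < k \<Longrightarrow> k < n \<Longrightarrow> (p ^^ k) y \<notin> A"
      using first_return_ex[OF assms(1) xy(2)] by metis
    consider "m < n" | "n < m" | "m = n"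
      by linarith
    then show False
    proof cases
      case 1
      then show ?thesis
        using less[of x y m n] xy m n by blast
    next
      case 2
      then show ?thesis
        using less[of y x n m] xy m n by (metis (no_types))
    next
      case 3
      then show ?thesis
        using xy m n inj by (simp add: inj_eq)
    qed
  qed
  moreover have "?f ` A \<subseteq> A"
    using first_return_in[OF assms(1)] by auto
  ultimately show ?thesis
    using endo_inj_surj[OF assms(2)] first_return_outside
    by (intro bij_imp_permutes) (auto simp: bij_betw_def)
qed

lemma orbit_first_return:
  assumes p: "permutation p" and A: "finite A" and x: "x \<in> A"
  shows "orbit (first_return A p) x = orbit p x \<inter> A"
proof (intro equalityI subsetI)
  let ?f = "first_return A p"
  have f_orbit: "?f z \<in> orbit p z" if z: "z \<in> A" for z
  proof -
    obtain n where "0 < n" "?f z = (p ^^ n) z"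
      using first_return_ex[OF p z] by metis
    then show ?thesis
      unfolding orbit_altdef by blast
  qed
  fix y assume "y \<in> orbit ?f x"
  then show "y \<in> orbit p x \<inter> A"
  proof induction
    case base
    then show ?case
      using f_orbit[OF x] first_return_in[OF p x] by simp
  next
    case (step y)
    then show ?case
      using f_orbit[of y] first_return_in[OF p, of y A] orbit_trans[of "?f y" p y x] by auto
  qed
next
  let ?f = "first_return A p"
  have f: "permutation ?f"
    using first_return_permutes[OF p A] A by (rule permutes_imp_permutation[rotated])
  fix y assume y: "y \<in> orbit p x \<inter> A"
  then obtain n where "y = (p ^^ n) x"
    by (auto simp: orbit_altdef)
  then have "y = (p ^^ n) x \<Longrightarrow> x \<in> A \<Longrightarrow> y \<in> orbit ?f x"
  proof (induction n arbitrary: x rule: less_induct)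
    case (less n)
    show ?case
    proof (cases "n = 0")
      case True
      then show ?thesis
        using less.prems permutation_self_in_orbit[OF f] by simp
    next
      case False
      obtain m where m: "0 < m" "?f x = (p ^^ m) x" "\<And>k. 0 < k \<Longrightarrow> k < m \<Longrightarrow> (p ^^ k) x \<notin> A"
        using first_return_ex[OF p less.prems(2)] by metis
      have "m \<le> n"
        using m(3)[of n] False y less.prems by (meson Int_iff gr0I not_le)
      then have "y = (p ^^ (n - m)) (?f x)"
        using less.prems m(2) by (simp add: funpow_add[symmetric, THEN fun_cong, simplified])
      then have "y \<in> orbit ?f (?f x)"
        using less.IH[of "n - m" "?f x"] m(1) False first_return_in[OF p less.prems(2)] by simp
      then show ?thesis
        using permutation_orbit_step[OF f] by metis
    qed
  qed
  then show "y \<in> orbit ?f x"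
    using \<open>y = (p ^^ n) x\<close> x by simp
qed

lemma edges_submap [simp]: "edges (submap M A) = A"
  and rot_submap: "rot (submap M A) = first_return (A \<times> UNIV) (rot M)"
  by (simp_all add: submap_def)

lemma ends_eq: "ends M = edges M \<times> UNIV"
  by (simp add: ends_def)

lemma (in alt_map) face_of_submap_subset:
  assumes "z \<in> A \<times> UNIV" "y \<in> face_of (submap M A) z"
  shows "y \<in> A \<times> UNIV"
proof -
  define f where "f = face_step (submap M A)"
  have f: "f w \<in> A \<times> UNIV" if "w \<in> A \<times> UNIV" for w
    unfolding f_def face_step_def rot_submap using that
    by (intro first_return_in rot_permutation) (auto simp: mem_Times_iff)
  have "y \<in> orbit f z"
    using assms(2) by (simp add: face_of_def f_def)
  then show ?thesis
    by induction (use f assms(1) in blast)+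
qed

section \<open>Unions at a vertex and multiloops\<close>

text \<open>The corner after a tail end lies in an a-face. Gluing two such corners exchanges two
  values of the a-face permutation and leaves \<open>rsucc\<close>, hence every c-face,
  alone.\<close>

lemma good_map_identify:
  assumes "good_map M" "good_map N" "edges M \<inter> edges N = {}" "a \<in> edges M" "b \<in> edges N"
  shows "good_map (identify M (a, Tail) N (b, Tail))"
    and "tval (identify M (a, Tail) N (b, Tail)) = tval M * tval N"
proof -
  have alt: "alt_map M" "alt_map N"
    using assms by (auto intro: alt_map.intro simp: good_map_def)
  interpret M: alt_map M by fact
  interpret N: alt_map N by fact
  interpret two_parts "edges M \<union> edges N" "rsucc M \<circ> rsucc N" "asucc M \<circ> asucc N"
    "edges M" "rsucc M" "asucc M" "edges N" "rsucc N" "asucc N"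
    using two_parts_disjoint_union[OF alt assms(3)] .
  define t where "t = asucc M \<circ> asucc N \<circ> transpose a b"
  have ab: "a \<noteq> b" "a \<notin> edges N" "b \<notin> edges M"
    using assms by auto
  have "identify M (a, Tail) N (b, Tail) = mk (edges M \<union> edges N) (rsucc M \<circ> rsucc N) t"
  proof (rule emap_eq_mkI)
    have du: "rot (disjoint_union M N) =
        rot (mk (edges M \<union> edges N) (rsucc M \<circ> rsucc N) (asucc M \<circ> asucc N))"
      using disjoint_union_eq[OF alt assms(3)] by simp
    show "edges (identify M (a, Tail) N (b, Tail)) = edges M \<union> edges N"
      by (simp add: identify_def)
    show "rot (identify M (a, Tail) N (b, Tail)) (e, Head) = ((rsucc M \<circ> rsucc N) e, Tail)"
      if "e \<in> edges M \<union> edges N" for e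
      using that by (simp add: identify_def du rot_mk)
    show "rot (identify M (a, Tail) N (b, Tail)) (e, d) = (e, d)"
      if "e \<notin> edges M \<union> edges N" for e d
      using that assms by (auto simp: identify_def du rot_mk)
    show "rot (identify M (a, Tail) N (b, Tail)) (e, Tail) = (t e, Head)"
      if e: "e \<in> edges M \<union> edges N" for e
    proof -
      consider "e = a" | "e = b" | "e \<noteq> a" "e \<noteq> b"
        by blast
      then show ?thesis
      proof cases
        case 1
        then show ?thesis
          using assms ab B.s_agree[of b] by (simp add: identify_def N.rot_Tail t_def)
      next
        case 2
        then show ?thesis
          using assms ab A.s_agree[of a] by (simp add: identify_def M.rot_Tail t_def)
      next
        case 3
        then show ?thesis
          using e by (simp add: identify_def du rot_mk t_def)
      qed
    qed
  qed
  moreover have "good (edges M \<union> edges N) (rsucc M \<circ> rsucc N) t"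
    "val (edges M \<union> edges N) (rsucc M \<circ> rsucc N) t = tval M * tval N"
    using join[of a b] assms by (simp_all add: good_map_def tval_def t_def)
  ultimately show "good_map (identify M (a, Tail) N (b, Tail))"
    "tval (identify M (a, Tail) N (b, Tail)) = tval M * tval N"
    using good_map_mk by metis+
qed

lemma good_map_multiloop:
  assumes "multiloop L"
  shows "good_map L"
proof -
  interpret alt_map L
    using assms by unfold_locales (simp add: multiloop_def)
  obtain es where es: "multiloop_ordering L es"
    using assms by (auto simp: multiloop_def)
  then have loop: "is_loop L e" if "e \<in> E" for e
    using that by (auto simp: multiloop_ordering_def is_loop_def)
  have "kind r s (corb r e)" if "e \<in> E" for e
    using corb_subset[OF r that] is_loop_iff[OF _ refl] loop
    unfolding kind_def by (metis r_in subsetD)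
  then show ?thesis
    using assms plane_iff alt fin r s by (simp add: good_map_def good_def multiloop_def)
qed

section \<open>Corners and the faces in which they lie\<close>

lemma rot_identify:
  assumes "alt_map M" "alt_map N" "edges M \<inter> edges N = {}" "d \<in> ends M" "d' \<in> ends N"
  shows "rot (identify M d N d') z =
    (if z = d then rot N d' else if z = d' then rot M d
     else if z \<in> ends M then rot M z else if z \<in> ends N then rot N z else z)"
proof -
  have "d \<noteq> d'"
    using assms(3-5) by (auto simp: ends_eq)
  then show ?thesis
    by (simp add: identify_def disjoint_union_def)
qed

lemma ends_identify: "ends (identify M d N d') = ends M \<union> ends N"
  by (auto simp: identify_def ends_def)

lemma edges_identify [simp]: "edges (identify M d N d') = edges M \<union> edges N"
  by (simp add: identify_def)

lemma identify_same_side: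
  assumes "alt_map M" "alt_map N" "edges M \<inter> edges N = {}" "d \<in> ends M" "d' \<in> ends N"
    and "alternating_dimap (identify M d N d')"
  shows "snd d = snd d'"
proof -
  interpret N: alt_map N by fact
  have "snd (rot N d') \<noteq> snd d"
    using assms(4,6) rot_identify[OF assms(1-5), of d]
    unfolding alternating_dimap_def ends_identify by (metis UnI1)
  moreover have "snd (rot N d') \<noteq> snd d'"
    using N.alt assms(5) by (auto simp: alternating_dimap_def)
  ultimately show ?thesis
    using side_cases by metis
qed

text \<open>
  In a map obtained from \<open>S\<close> by adding submaps at vertices, \<open>colour\<close> assigns to each edge-end
  the direction of the face of \<open>S\<close> in which it lies.
\<close>

definition colouring :: "'e emap \<Rightarrow> 'e emap \<Rightarrow> ('e edge_end \<Rightarrow> side) \<Rightarrow> bool" where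
  "colouring S D colour \<longleftrightarrow> ends S \<subseteq> ends D \<and> (\<forall>d\<in>ends S. colour d = snd d) \<and>
     (\<forall>d\<in>ends D. colour (face_step D d) = colour d) \<and>
     (\<forall>d\<in>ends D - ends S. colour (opp d) = colour d)"

lemma opp_ends [simp]: "opp d \<in> ends M \<longleftrightarrow> d \<in> ends M"
  by (simp add: ends_eq mem_Times_iff)

lemma colouring_self:
  assumes "alt_map S"
  shows "colouring S S snd"
proof -
  interpret alt_map S by fact
  have "snd (face_step S d) = snd d" if "d \<in> ends S" for d
    using that side_cases[of "snd d"] by (cases d) (auto simp: face_step_def rot_Head rot_Tail)
  then show ?thesis
    by (simp add: colouring_def)
qed

text \<open>The corner that follows \<open>d\<close> belongs to the face of \<open>opp d\<close>,
  because \<open>face_step\<close> leaves \<open>opp d\<close> along \<open>rot D d\<close>.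
  Everything attached there takes the colour \<open>snd (opp d)\<close>.\<close>

lemma colouring_identify:
  assumes "alt_map D" "alt_map L" and disj: "edges D \<inter> edges L = {}"
    and d: "d \<in> ends S" and d': "d' \<in> ends L" and col: "colouring S D colour"
  shows "colouring S (identify D d L d') (\<lambda>z. if z \<in> ends L then snd (opp d) else colour z)"
    (is "colouring S ?D ?c")
proof -
  interpret D: alt_map D by fact
  interpret L: alt_map L by fact
  have SD: "ends S \<subseteq> ends D"
    using col by (simp add: colouring_def)
  then have dD: "d \<in> ends D"
    using d by auto
  note rot = rot_identify[OF assms(1,2) disj dD d']
  have disj': "ends D \<inter> ends L = {}"
    using disj by (auto simp: ends_eq)
  have c_opp: "colour (opp d) = snd (opp d)"
    using col d by (simp add: colouring_def)
  have "?c (face_step ?D z) = ?c z" if z: "z \<in> ends D \<union> ends L" for z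
  proof -
    consider "opp z = d" | "opp z = d'" | "opp z \<noteq> d" "opp z \<noteq> d'" "z \<in> ends D" |
      "opp z \<noteq> d" "opp z \<noteq> d'" "z \<in> ends L"
      using z by blast
    then show ?thesis
    proof cases
      case 1
      then have "z = opp d"
        by auto
      then show ?thesis
        using 1 c_opp dD d' disj' L.rot_ends[of d'] by (auto simp: face_step_def rot)
    next
      case 2
      then have z: "z = opp d'"
        by auto
      have "face_step D (opp d) = rot D d"
        by (simp add: face_step_def)
      then have "colour (rot D d) = colour (opp d)"
        using col dD unfolding colouring_def by (metis opp_ends)
      moreover have "rot D d \<notin> ends L" "d \<noteq> d'"
        using D.rot_ends[of d] dD d' disj' by blast+
      ultimately show ?thesis
        using z d' c_opp by (simp add: face_step_def rot)
    next
      case 3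
      then have "rot D (opp z) \<in> ends D"
        using D.rot_ends by simp
      moreover have "colour (face_step D z) = colour z"
        using col 3 by (simp add: colouring_def)
      ultimately show ?thesis
        using 3 disj' by (auto simp: face_step_def rot)
    next
      case 4
      then have "rot L (opp z) \<in> ends L" "opp z \<notin> ends D"
        using L.rot_ends disj' by auto
      then show ?thesis
        using 4 by (simp add: face_step_def rot)
    qed
  qed
  then show ?thesis
    using col SD disj' unfolding colouring_def ends_identify by auto
qed

text \<open>The colour is constant on each face and across each edge outside \<open>S\<close>, so
  the direction of \<open>g\<close> spreads to all faces of \<open>D\<close> within
  \<open>g\<close>.\<close>

lemma colouring_within_face:
  assumes "alt_map D" and col: "colouring S D colour"
    and g: "g \<in> faces (submap D (edges S))" "\<forall>d\<in>g. snd d = x"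
    and within: "within_face D B (edges S) g" and B: "B \<subseteq> edges D"
  shows "\<exists>z\<in>B \<times> UNIV. colour z = x"
proof -
  interpret alt_map D by fact
  obtain g' where g': "subface D (edges S) g' g" "fst ` g' \<inter> B \<noteq> {}"
    using within by (auto simp: within_face_def)
  then obtain d where d: "d \<in> g"
    and path: "(face_of D d, g') \<in> (face_crossing D (edges D - edges S))\<^sup>*"
    by (auto simp: subface_def)
  have const: "colour y = colour w \<and> y \<in> ends D" if "y \<in> face_of D w" "w \<in> ends D" for y w
    using that unfolding face_of_def
  proof induction
    case base
    then show ?case
      using col rot_ends by (simp add: colouring_def face_step_def)
  next
    case (step y)
    then show ?case
      using col rot_ends by (simp add: colouring_def face_step_def)
  qed
  obtain w where "w \<in> edges S \<times> UNIV" "g = face_of (submap D (edges S)) w"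
    using g(1) by (auto simp: faces_def ends_eq)
  then have dS: "d \<in> ends S"
    using face_of_submap_subset d by (auto simp: ends_eq)
  then have "colour d = x" "d \<in> ends D"
    using col g(2) d by (auto simp: colouring_def)
  then have start: "\<forall>y\<in>face_of D d. colour y = x"
    using const by simp
  have "\<forall>y\<in>g'. colour y = x"
    using path
  proof (induction rule: rtrancl_induct)
    case (step f f')
    then obtain w where w: "f = face_of D w" "f' = face_of D (opp w)" "fst w \<in> edges D - edges S"
      by (auto simp: face_crossing_def)
    have wD: "w \<in> ends D - ends S"
      using w(3) by (auto simp: ends_eq mem_Times_iff)
    obtain y where "y \<in> f"
      unfolding w face_of_def using orbit.base by metis
    then have "colour w = x"
      using step.IH const[of y w] w wD by auto
    then have "colour (opp w) = x"
      using col wD by (simp add: colouring_def)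
    then show ?case
      using const[of _ "opp w"] w wD by auto
  qed (rule start)
  then show ?thesis
    using g'(2) by (fastforce simp: mem_Times_iff)
qed

lemma good_map_adds_c_multiloops:
  assumes "adds_c_multiloops S D" "good_map S"
  shows "good_map D \<and> (\<exists>colour. colouring S D colour)"
  using assms
proof (induction rule: adds_c_multiloops.induct)
  case base
  then show ?case
    using colouring_self[of S] unfolding good_map_def by (metis alt_map.intro)
next
  case (add D L d d')
  then have good: "good_map D" "good_map L"
    using good_map_multiloop by (auto simp: c_multiloop_def)
  obtain colour where col: "colouring S D colour"
    using add by auto
  have alt: "alt_map D" "alt_map L" "alt_map (identify D d L d')"
    using good add by (auto intro: alt_map.intro simp: good_map_def)
  have dD: "d \<in> ends D"
    using col add by (auto simp: colouring_def)
  have same: "snd d = snd d'"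
    using identify_same_side[OF alt(1,2)] add dD by blast
  let ?c = "\<lambda>z. if z \<in> ends L then snd (opp d) else colour z"
  have col': "colouring S (identify D d L d') ?c"
    using colouring_identify[OF alt(1,2) _ _ _ col] add by blast
  obtain g where g: "a_face (submap (identify D d L d') (edges S)) g"
    "within_face (identify D d L d') (edges L) (edges S) g"
    using add by (auto simp: within_a_face_def)
  \<comment> \<open>All of \<open>L\<close> has the colour of its corner, so lying in an a-face
    means that the corner follows a tail end.\<close>
  have "\<exists>z\<in>edges L \<times> UNIV. ?c z = Head"
    using g by (intro colouring_within_face[OF alt(3) col']) (auto simp: a_face_def)
  then have "snd (opp d) = Head"
    by (auto simp: ends_eq)
  then have "snd d = Tail"
    by (cases d rule: opp.cases) auto
  then have "d = (fst d, Tail)" "d' = (fst d', Tail)"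
    using same by (metis prod.collapse)+
  then have "good_map (identify D d L d')"
    using good_map_identify(1)[OF good, of "fst d" "fst d'"] add dD
    by (metis ends_eq mem_Times_iff)
  then show ?case
    using col' by blast
qed

text \<open>The corner after a head end lies in a c-face. Erasing \<open>S2\<close> restores
  \<open>S1\<close> with the c-face that runs from \<open>e\<close> to \<open>y\<close>, while in
  the union the c-face of \<open>y\<close> contains an edge of \<open>S2\<close>.\<close>

lemma identify_at_c_corner:
  assumes "alt_map S1" "alt_map S2" "alt_map (identify S1 d S2 d')"
    and disj: "edges S1 \<inter> edges S2 = {}" and d: "d \<in> ends S1" "d' \<in> ends S2" "snd d = Head"
  shows "within_c_face (identify S1 d S2 d') (edges S2) (edges S1)"
proof -
  interpret A: alt_map S1 by fact
  interpret B: alt_map S2 by fact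
  let ?D = "identify S1 d S2 d'"
  interpret D: alt_map ?D by fact
  define N where "N = submap ?D (edges S1)"
  note rot = rot_identify[OF assms(1,2) disj d(1,2)]
  have same: "snd d' = Head"
    using identify_same_side[OF assms(1,2) disj d(1,2) D.alt] d(3) by simp
  have disj': "ends S1 \<inter> ends S2 = {}"
    using disj by (auto simp: ends_eq)
  have dd: "d \<noteq> d'"
    using d disj' by auto
  have rN: "rot N z = rot S1 z" if z: "z \<in> ends S1" for z
  proof (cases "z = d")
    case False
    have "z \<noteq> d'"
      using z d(2) disj' by auto
    then have "rot ?D z = rot S1 z" "rot S1 z \<in> edges S1 \<times> UNIV"
      using False z A.rot_ends[of z] by (auto simp: rot ends_eq)
    then show ?thesis
      using z unfolding N_def rot_submap by (subst first_return_1) (auto simp: ends_eq)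
  next
    case True
    \<comment> \<open>At \<open>d\<close> the rotation of the union first passes through
      \<open>S2\<close>. The only way back into \<open>S1\<close> is from \<open>d'\<close>, and it
      leads to \<open>rot S1 d\<close>.\<close>
    obtain w where w: "rot ?D w = first_return (edges S1 \<times> UNIV) (rot ?D) d"
      "w = d \<or> w \<notin> edges S1 \<times> UNIV"
      using first_return_last[OF D.rot_permutation, of d "edges S1 \<times> UNIV"] d(1)
      by (auto simp: ends_eq)
    have in_S1: "rot ?D w \<in> ends S1"
      using w(1) first_return_in[OF D.rot_permutation, of d "edges S1 \<times> UNIV"] d(1)
      by (simp add: ends_eq)
    have "rot ?D d = rot S2 d'" "rot S2 d' \<in> ends S2"
      using d(2) B.rot_ends by (auto simp: rot)
    then have "w \<noteq> d"
      using in_S1 disj' by auto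
    then have w_out: "w \<notin> ends S1"
      using w(2) by (simp add: ends_eq)
    have "w = d'"
    proof (rule ccontr)
      assume "w \<noteq> d'"
      then have "rot ?D w = (if w \<in> ends S2 then rot S2 w else w)"
        using w_out \<open>w \<noteq> d\<close> by (simp add: rot)
      then show False
        using in_S1 w_out B.rot_ends[of w] disj' by (auto split: if_splits)
    qed
    then show ?thesis
      using w(1) True dd unfolding N_def rot_submap by (simp add: rot)
  qed
  obtain e b where e: "d = (e, Head)" "e \<in> edges S1" and b: "d' = (b, Head)" "b \<in> edges S2"
    using d same by (cases d; cases d') auto
  define y where "y = rsucc S1 e"
  have step: "face_step N (e, Tail) = (y, Tail)"
    using rN[of "(e, Head)"] e by (simp add: face_step_def A.rot_Head y_def)
  let ?g = "face_of N (e, Tail)"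
  have g_Tail: "snd z = Tail \<and> z \<in> ends S1" if "z \<in> ?g" for z
    using that unfolding face_of_def
  proof induction
    case base
    then show ?case
      using step e by (simp add: y_def)
  next
    case (step z)
    then obtain a where a: "z = (a, Tail)" "a \<in> edges S1"
      by (metis mem_ends prod.collapse)
    then show ?case
      using rN[of "(a, Head)"] by (simp add: face_step_def A.rot_Head)
  qed
  have "?g \<in> faces N"
    using e by (auto simp: faces_def N_def ends_eq)
  then have "c_face N ?g"
    using g_Tail by (auto simp: c_face_def)
  moreover have "within_face ?D (edges S2) (edges S1) ?g"
    unfolding within_face_def N_def[symmetric]
  proof (intro conjI exI)
    show "?g \<in> faces N"
      by fact
    have yg: "(y, Tail) \<in> ?g"
      unfolding face_of_def by (metis orbit.base step)
    \<comment> \<open>In the union the c-face through \<open>y\<close> reaches it from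
      \<open>b\<close>, an edge of \<open>S2\<close>.\<close>
    have "(y, Tail) = rot ?D d'"
      using dd e(1) rot[of d'] A.rot_Head[OF e(2)] unfolding y_def by simp
    then have y: "y = rsucc ?D b"
      using b D.rot_Head[of b] by simp
    have yE: "y \<in> edges ?D"
      using e by (simp add: y_def)
    then show "subface ?D (edges S1) (face_of ?D (y, Tail)) ?g"
      using yg by (auto simp: subface_def faces_def)
    have "b \<in> orbit (rsucc ?D) y"
      unfolding y using permutation_self_in_orbit[OF D.perms(1)]
        permutation_orbit_step[OF D.perms(1)] by metis
    then have "(b, Tail) \<in> face_of ?D (y, Tail)"
      using D.face_Tail[OF yE] by simp
    then show "fst ` face_of ?D (y, Tail) \<inter> edges S2 \<noteq> {}"
      using b by force
  qed
  ultimately show ?thesis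
    unfolding within_c_face_def N_def by blast
qed

lemma tval_c_union:
  assumes "good_map S1" "good_map S2" "c_union D S1 S2"
  shows "good_map D \<and> tval D = tval S1 * tval S2"
proof -
  have alt: "alternating_dimap S1" "alternating_dimap S2" "alternating_dimap D"
    and disj: "edges S1 \<inter> edges S2 = {}"
    using assms by (auto simp: good_map_def c_union_def)
  consider "D = disjoint_union S1 S2" |
    d d' where "d \<in> ends S1" "d' \<in> ends S2" "D = identify S1 d S2 d'"
    using assms(3) by (auto simp: c_union_def)
  then show ?thesis
  proof cases
    case 1
    then show ?thesis
      using good_map_disjoint_union[OF alt(1,2) disj] assms by simp
  next
    case 2
    \<comment> \<open>A head end would put \<open>S2\<close> within a c-face of \<open>S1\<close>,
      so the two glued corners lie in a-faces.\<close>
    have "snd d \<noteq> Head"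
      using identify_at_c_corner[of S1 S2 d d'] 2 assms(3) alt disj
      by (auto simp: c_union_def intro: alt_map.intro)
    then have "snd d = Tail" "snd d' = Tail"
      using identify_same_side[of S1 S2 d d'] 2 alt disj side_cases
      by (metis alt_map.intro)+
    then have "d = (fst d, Tail)" "d' = (fst d', Tail)" "fst d \<in> edges S1" "fst d' \<in> edges S2"
      using 2 by (auto simp: ends_eq)
    then show ?thesis
      using good_map_identify[OF assms(1,2) disj] 2 by metis
  qed
qed

section \<open>Blocks of c-simple dimaps\<close>

lemma card_quotient_le_1:
  assumes "sym R" "\<And>u v. u \<in> V \<Longrightarrow> v \<in> V \<Longrightarrow> (u, v) \<in> R\<^sup>*"
  shows "card (V // R\<^sup>*) \<le> 1"
proof (cases "V = {}")
  case False
  then obtain u where u: "u \<in> V"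
    by auto
  have "V // R\<^sup>* = {R\<^sup>* `` {u}}"
    using u assms(2) rtrancl_class_eq_iff[OF assms(1)] unfolding quotient_def by blast
  then show ?thesis
    by simp
qed (simp add: quotient_def)

lemma simple_path:
  assumes "(u, v) \<in> R\<^sup>*"
  obtains n f where "f 0 = u" "f n = v" "\<And>i. i < n \<Longrightarrow> (f i, f (Suc i)) \<in> R" "inj_on f {..n}"
proof -
  have "\<exists>n. (u, v) \<in> R ^^ n"
    using assms by (auto simp: rtrancl_power)
  define n where "n = (LEAST n. (u, v) \<in> R ^^ n)"
  have "(u, v) \<in> R ^^ n"
    unfolding n_def using \<open>\<exists>n. _\<close> by (rule LeastI_ex)
  then obtain f where f: "f 0 = u" "f n = v" "\<And>i. i < n \<Longrightarrow> (f i, f (Suc i)) \<in> R"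
    by (auto simp: relpow_fun_conv)
  have "f i \<noteq> f j" if ij: "i < j" "j \<le> n" for i j
  proof
    assume eq: "f i = f j"
    have "(f 0, f i) \<in> R ^^ i"
      using f(3) ij by (auto simp: relpow_fun_conv intro!: exI[of _ f])
    moreover have "(f j, f n) \<in> R ^^ (n - j)"
      using f(3) ij by (auto simp: relpow_fun_conv intro!: exI[of _ "\<lambda>k. f (j + k)"])
    ultimately have "(u, v) \<in> R ^^ (i + (n - j))"
      using eq f(1,2) by (auto simp: relpow_add)
    then have "n \<le> i + (n - j)"
      unfolding n_def by (rule Least_le)
    then show False
      using ij by simp
  qed
  then have "inj_on f {..n}"
    by (intro inj_onI) (metis atMost_iff linorder_neqE_nat)
  then show ?thesis
    using that[of f n] f by blast
qed

section \<open>Two-connected edge sets in loopless maps\<close>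

locale loopless_map = alt_map M for M :: "'e emap" +
  assumes loopless: "loopless M"
begin

text \<open>Connectivity of an edge set is expressed with the vertices of the whole map and not with
  those of its submap, so that different edge sets can be compared.\<close>

definition incident :: "'e set \<Rightarrow> 'e edge_end set set" where
  "incident C = head M ` C \<union> tail M ` C"

definition adj :: "'e set \<Rightarrow> 'e edge_end set set \<Rightarrow> 'e edge_end set rel" where
  "adj C Z = {(u, v). u \<notin> Z \<and> v \<notin> Z \<and> (\<exists>e\<in>C. {u, v} = {head M e, tail M e})}"

definition linked :: "'e set \<Rightarrow> 'e edge_end set set \<Rightarrow> bool" where
  "linked C Z \<longleftrightarrow> (\<forall>u\<in>incident C - Z. \<forall>v\<in>incident C - Z. (u, v) \<in> (adj C Z)\<^sup>*)"

text \<open>\<open>Z\<close> is empty or a single vertex, so connectedness and the absence of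
  cutvertices become one condition.\<close>

definition two_connected :: "'e set \<Rightarrow> bool" where
  "two_connected C \<longleftrightarrow> C \<subseteq> E \<and> C \<noteq> {} \<and> (\<forall>Z z. Z \<subseteq> {z} \<longrightarrow> linked C Z)"

lemma sym_adj: "sym (adj C Z)"
  by (auto simp: sym_def adj_def insert_commute)

lemma adj_mono: "C \<subseteq> C' \<Longrightarrow> (adj C Z)\<^sup>* \<subseteq> (adj C' Z)\<^sup>*"
  by (rule rtrancl_mono) (auto simp: adj_def)

lemma adj_rtrancl_sym: "(u, v) \<in> (adj C Z)\<^sup>* \<Longrightarrow> (v, u) \<in> (adj C Z)\<^sup>*"
  using sym_rtrancl[OF sym_adj] by (rule symD)

lemma adj_edge:
  assumes "e \<in> C" "head M e \<notin> Z" "tail M e \<notin> Z"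
  shows "(tail M e, head M e) \<in> (adj C Z)\<^sup>*"
  using assms by (intro r_into_rtrancl) (auto simp: adj_def)

lemma head_ne_tail: "e \<in> E \<Longrightarrow> head M e \<noteq> tail M e"
  using loopless by (auto simp: loopless_def is_loop_def)

lemma head_submap: "C \<subseteq> E \<Longrightarrow> e \<in> C \<Longrightarrow> head (submap M C) e = head M e \<inter> C \<times> UNIV"
  and tail_submap: "C \<subseteq> E \<Longrightarrow> e \<in> C \<Longrightarrow> tail (submap M C) e = tail M e \<inter> C \<times> UNIV"
proof -
  have *: "orbit (first_return (C \<times> UNIV) (rot M)) (e, d) = orbit (rot M) (e, d) \<inter> C \<times> UNIV"
    if "C \<subseteq> E" "e \<in> C" for d
    using that finE finite_side finite_subset
    by (intro orbit_first_return rot_permutation) auto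
  show "C \<subseteq> E \<Longrightarrow> e \<in> C \<Longrightarrow> head (submap M C) e = head M e \<inter> C \<times> UNIV"
    "C \<subseteq> E \<Longrightarrow> e \<in> C \<Longrightarrow> tail (submap M C) e = tail M e \<inter> C \<times> UNIV"
    using * by (simp_all add: head_def tail_def rot_submap)
qed

lemma end_mem: "(e, Head) \<in> head M e" "(e, Tail) \<in> tail M e"
  unfolding head_def tail_def using permutation_self_in_orbit[OF rot_permutation] by auto

lemma incident_mem:
  assumes "v \<in> incident C"
  obtains e d where "e \<in> C" "v = orbit (rot M) (e, d)"
  using assms by (auto simp: incident_def head_def tail_def)

lemma orbit_rot_eq: "w \<in> orbit (rot M) z \<Longrightarrow> orbit (rot M) w = orbit (rot M) z"
  using rot_permutation by (metis eqcl_gr_iff_orbit orbit_eqI_eqcl)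

lemma incident_inter_inj:
  assumes "u \<in> incident C" "v \<in> incident C" "u \<inter> C \<times> UNIV = v \<inter> C \<times> UNIV"
  shows "u = v"
proof -
  obtain e d where "e \<in> C" "u = orbit (rot M) (e, d)"
    using incident_mem[OF assms(1)] .
  then have "(e, d) \<in> u \<inter> C \<times> UNIV"
    using permutation_self_in_orbit[OF rot_permutation] by auto
  moreover obtain e' d' where "v = orbit (rot M) (e', d')"
    using incident_mem[OF assms(2)] .
  ultimately show ?thesis
    using assms(3) \<open>u = _\<close> orbit_rot_eq by blast
qed

lemma two_connected_imp_nonseparable:
  assumes C: "two_connected C" and alt: "alternating_dimap (submap M C)"
  shows "nonseparable (submap M C)"
proof -
  let ?N = "submap M C"
  interpret N: alt_map ?N
    using alt by unfold_locales
  have sub: "C \<subseteq> E" and ne: "C \<noteq> {}"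
    using C by (auto simp: two_connected_def)
  \<comment> \<open>Vertices of the submap are traces of vertices of \<open>M\<close>, and an
    incident vertex is determined by its trace.\<close>
  define \<iota> where "\<iota> v = v \<inter> C \<times> (UNIV :: side set)" for v
  have verts: "verts ?N = \<iota> ` incident C"
  proof
    show "verts ?N \<subseteq> \<iota> ` incident C"
      unfolding N.verts_eq using sub by (auto simp: head_submap \<iota>_def incident_def)
    have "tail ?N e \<in> verts ?N" if "e \<in> C" for e
      using that by (auto simp: verts_def tail_def)
    then have "tail M e \<inter> C \<times> UNIV \<in> verts ?N" if "e \<in> C" for e
      using that tail_submap[OF sub] by simp
    moreover have "head M e \<inter> C \<times> UNIV \<in> verts ?N" if "e \<in> C" for e
      using that head_submap[OF sub] N.verts_eq by auto
    ultimately show "\<iota> ` incident C \<subseteq> verts ?N"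
      by (auto simp: incident_def \<iota>_def)
  qed
  have inj: "u = v" if "u \<in> incident C" "v \<in> incident C" "\<iota> u = \<iota> v" for u v
    using incident_inter_inj that by (auto simp: \<iota>_def)
  have path: "(\<iota> u, \<iota> v) \<in> {(u, v) \<in> (verts ?N - \<iota> ` Z) \<times> (verts ?N - \<iota> ` Z).
      \<exists>e\<in>C. {u, v} = {head ?N e, tail ?N e}}\<^sup>*"
    if "(u, v) \<in> (adj C Z)\<^sup>*" "Z \<subseteq> incident C" for u v Z
    using that(1)
  proof induction
    case (step v w)
    then obtain e where e: "e \<in> C" "{v, w} = {head M e, tail M e}" "v \<notin> Z" "w \<notin> Z"
      by (auto simp: adj_def)
    have "v \<in> incident C" "w \<in> incident C"
      using e by (auto simp: incident_def doubleton_eq_iff)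
    moreover have "\<iota> a \<notin> \<iota> ` Z" if "a \<in> incident C" "a \<notin> Z" for a
      using that \<open>Z \<subseteq> incident C\<close> inj by (metis imageE subsetD)
    ultimately have "\<iota> v \<in> verts ?N - \<iota> ` Z" "\<iota> w \<in> verts ?N - \<iota> ` Z"
      using verts e by simp_all
    moreover have "{\<iota> v, \<iota> w} = {head ?N e, tail ?N e}"
      using e sub by (auto simp: doubleton_eq_iff head_submap tail_submap \<iota>_def)
    ultimately show ?case
      using step.IH e(1) by (auto intro: rtrancl_into_rtrancl)
  qed simp
  have comp: "card (components ?N (verts ?N - \<iota> ` Z) C) \<le> 1"
    if Z: "Z \<subseteq> {z}" "Z \<subseteq> incident C" for Z z
    unfolding components_def
  proof (rule card_quotient_le_1)
    have C': "(a, b) \<in> (adj C Z)\<^sup>*" if "Z \<subseteq> {z}" "a \<in> incident C - Z" "b \<in> incident C - Z" for a b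
      using C that unfolding two_connected_def linked_def by blast
    fix u v assume "u \<in> verts ?N - \<iota> ` Z" "v \<in> verts ?N - \<iota> ` Z"
    then obtain u' v' where "u = \<iota> u'" "v = \<iota> v'" "u' \<in> incident C - Z" "v' \<in> incident C - Z"
      unfolding verts by auto
    then show "(u, v) \<in> {(u, v) \<in> (verts ?N - \<iota> ` Z) \<times> (verts ?N - \<iota> ` Z).
        \<exists>e\<in>C. {u, v} = {head ?N e, tail ?N e}}\<^sup>*"
      using path[of u' v' Z] Z by (simp add: C'[OF Z(1)])
  qed (auto simp: sym_def insert_commute)
  have "finite (verts ?N)"
    unfolding N.verts_eq using sub finE finite_subset by auto
  moreover have "verts ?N \<noteq> {}"
    unfolding N.verts_eq using ne by auto
  ultimately have "card (components ?N (verts ?N) C) \<noteq> 0"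
    unfolding components_def by (simp add: finite_quotient quotient_is_empty card_eq_0_iff quotientI
      quotient_def)
  then have one: "n_components ?N = 1"
    using comp[of "{}"] by (simp add: n_components_def)
  have "\<not> cutvertex ?N v" for v
  proof
    assume "cutvertex ?N v"
    then have v: "v \<in> verts ?N" "1 < card (components ?N (verts ?N - {v}) C)"
      using one by (auto simp: cutvertex_def)
    then obtain z where "z \<in> incident C" "v = \<iota> z"
      using verts by auto
    then show False
      using v comp[of "{z}" z] by simp
  qed
  moreover have "loopless ?N"
    unfolding loopless_def is_loop_def
  proof
    fix e assume e: "e \<in> edges ?N"
    then have "head M e \<in> incident C" "tail M e \<in> incident C" "e \<in> E" "e \<in> C"
      using sub by (auto simp: incident_def)
    then have "\<iota> (head M e) \<noteq> \<iota> (tail M e)"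
      using inj[of "head M e" "tail M e"] head_ne_tail[of e] by metis
    then show "head ?N e \<noteq> tail ?N e"
      using \<open>e \<in> C\<close> sub by (simp add: head_submap tail_submap \<iota>_def)
  qed
  ultimately show ?thesis
    using one by (simp add: nonseparable_def connected_map_def)
qed

lemma submap_permutes:
  assumes "C \<subseteq> E"
  shows "embedded_digraph (submap M C)"
proof -
  have "finite C"
    using assms finE finite_subset by auto
  then show ?thesis
    using finite_side first_return_permutes[OF rot_permutation, of "C \<times> UNIV"]
    by (simp add: embedded_digraph_def rot_submap ends_eq)
qed

text \<open>Each tail end directly follows the head end of the preceding edge on its c-face. A union
  of c-faces keeps or erases these two ends together, so the remaining ends still alternate.\<close>

lemma alternating_submap_closed:
  assumes C: "C \<subseteq> E" and closed: "\<And>e. e \<in> C \<longleftrightarrow> r e \<in> C"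
  shows "alternating_dimap (submap M C)"
  unfolding alternating_dimap_def
proof (intro conjI ballI)
  show "embedded_digraph (submap M C)"
    using C by (rule submap_permutes)
  let ?A = "C \<times> (UNIV :: side set)"
  fix z assume "z \<in> ends (submap M C)"
  then obtain e d where z: "z = (e, d)" "e \<in> C" "e \<in> E"
    using C by (cases z) auto
  show "snd (rot (submap M C) z) \<noteq> snd z"
  proof (cases d)
    case Head
    then have "first_return ?A (rot M) z = rot M z"
      using z closed by (intro first_return_1) (auto simp: rot_Head)
    then show ?thesis
      using z Head by (simp add: rot_submap rot_Head)
  next
    case Tail
    show ?thesis
    proof
      assume same: "snd (rot (submap M C) z) = snd z"
      obtain w where w: "rot M w = rot (submap M C) z" "w = z \<or> w \<notin> ?A"
        using first_return_last[OF rot_permutation, of z ?A] z by (auto simp: rot_submap)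
      have "rot M w \<in> ?A"
        using w(1) first_return_in[OF rot_permutation, of z ?A] z by (simp add: rot_submap)
      then obtain y where y: "rot M w = (y, Tail)" "y \<in> C"
        using same w(1) z Tail by (metis mem_Times_iff prod.collapse snd_conv)
      then have "w \<in> ends M"
        using C rot_ends[of w] by auto
      then obtain a x where w_eq: "w = (a, x)" "a \<in> E"
        by (cases w) auto
      have a: "w = (a, Head)" "r a = y"
        using w_eq y(1) by (cases x; simp add: rot_Head rot_Tail)+
      then have "a \<in> C"
        using y closed by blast
      then show False
        using w(2) a z Tail by auto
    qed
  qed
qed

section \<open>Directed cycles and the existence of blocks\<close>

definition simple_cycle :: "(nat \<Rightarrow> 'e) \<Rightarrow> nat \<Rightarrow> bool" where
  "simple_cycle c n \<longleftrightarrow> 0 < n \<and> (\<forall>i<n. c i \<in> E) \<and>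
     (\<forall>i<n. tail M (c (Suc i mod n)) = head M (c i)) \<and> inj_on (\<lambda>i. head M (c i)) {..<n}"

lemma simple_cycle_incident:
  assumes "simple_cycle c n"
  shows "incident (c ` {..<n}) = (\<lambda>i. head M (c i)) ` {..<n}"
proof -
  have "tail M (c j) \<in> (\<lambda>i. head M (c i)) ` {..<n}" if "j < n" for j
  proof -
    define i where "i = (if j = 0 then n - 1 else j - 1)"
    then have "Suc i mod n = j" "i < n"
      using that by auto
    then have "tail M (c j) = head M (c i)"
      using assms unfolding simple_cycle_def by metis
    then show ?thesis
      using \<open>i < n\<close> by simp
  qed
  then show ?thesis
    by (auto simp: incident_def)
qed

lemma simple_cycle_two_connected:
  assumes c: "simple_cycle c n"
  shows "two_connected (c ` {..<n})"
  unfolding two_connected_def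
proof (intro conjI allI impI)
  let ?C = "c ` {..<n}"
  have n: "0 < n"
    using c by (simp add: simple_cycle_def)
  show "?C \<subseteq> E" "?C \<noteq> {}"
    using c by (auto simp: simple_cycle_def)
  fix Z z assume Z: "Z \<subseteq> {z :: 'e edge_end set}"
  obtain k where k: "k < n" "\<And>i. i < n \<Longrightarrow> head M (c i) \<in> Z \<Longrightarrow> i = k"
  proof (cases "\<exists>k<n. head M (c k) \<in> Z")
    case True
    then obtain k where "k < n" "head M (c k) = z"
      using Z by auto
    then show ?thesis
      using that[of k] c Z unfolding simple_cycle_def inj_on_def
      by (metis lessThan_iff singletonD subsetD)
  next
    case False
    then show ?thesis
      using that[of 0] n by auto
  qed
  \<comment> \<open>The cycle is renumbered to start just after \<open>k\<close>. A removed vertex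
    can then only be the head of the last edge, at index \<open>n - 1\<close>, and the other heads
    form an unbroken path.\<close>
  define d where "d j = c ((k + 1 + j) mod n)" for j
  have d_in: "d j \<in> ?C" for j
    using n by (auto simp: d_def)
  have d_tail: "tail M (d (Suc j)) = head M (d j)" for j
  proof -
    have "Suc ((k + 1 + j) mod n) mod n = (k + 1 + Suc j) mod n"
      by (simp add: mod_Suc_eq)
    moreover have "(k + 1 + j) mod n < n"
      using n by simp
    ultimately show ?thesis
      using c unfolding simple_cycle_def d_def by metis
  qed
  have last: "j = n - 1" if "j < n" "head M (d j) \<in> Z" for j
  proof -
    have "(k + 1 + j) mod n = k"
      using k(2)[of "(k + 1 + j) mod n"] that(2) n by (simp add: d_def)
    show ?thesis
    proof (rule ccontr)
      assume "j \<noteq> n - 1"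
      then have j: "k + 1 + j < k + n"
        using that(1) by linarith
      show False
      proof (cases "k + 1 + j < n")
        case True
        then show ?thesis
          using \<open>(k + 1 + j) mod n = k\<close> by simp
      next
        case False
        then have "(k + 1 + j) mod n = k + 1 + j - n"
          using j k(1) by (simp add: le_mod_geq)
        then show ?thesis
          using \<open>(k + 1 + j) mod n = k\<close> j False by linarith
      qed
    qed
  qed
  have reach: "(head M (d 0), head M (d j)) \<in> (adj ?C Z)\<^sup>*" if "j < n" "head M (d j) \<notin> Z" for j
    using that
  proof (induction j)
    case (Suc j)
    then have "head M (d j) \<notin> Z"
      using last[of j] by auto
    then show ?case
      using Suc adj_edge[OF d_in, of "Suc j" Z] d_tail[of j] by (auto intro: rtrancl_trans)
  qed simp
  show "linked ?C Z"
    unfolding linked_def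
  proof (intro ballI)
    have ex: "\<exists>j<n. u = head M (d j)" if u: "u \<in> incident ?C" for u
    proof -
      obtain i where i: "i < n" "u = head M (c i)"
        using u simple_cycle_incident[OF c] by auto
      define j where "j = (i + n - (k + 1)) mod n"
      have "(k + 1 + j) mod n = (k + 1 + (i + n - (k + 1))) mod n"
        unfolding j_def by (rule mod_add_right_eq)
      also have "k + 1 + (i + n - (k + 1)) = i + n"
        using k(1) by linarith
      also have "(i + n) mod n = i"
        using i(1) by simp
      finally show ?thesis
        using i(2) n by (auto simp: d_def j_def intro!: exI[of _ j])
    qed
    fix u v assume "u \<in> incident ?C - Z" "v \<in> incident ?C - Z"
    then show "(u, v) \<in> (adj ?C Z)\<^sup>*"
      using ex[of u] ex[of v] reach by (metis DiffE adj_rtrancl_sym rtrancl_trans)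
  qed
qed

text \<open>Each vertex of the cycle keeps one incoming and one outgoing edge-end, and two such ends
  alternate.\<close>

lemma simple_cycle_alternating:
  assumes c: "simple_cycle c n"
  shows "alternating_dimap (submap M (c ` {..<n}))"
  unfolding alternating_dimap_def
proof (intro conjI ballI)
  let ?C = "c ` {..<n}" and ?A = "c ` {..<n} \<times> (UNIV :: side set)"
  let ?f = "first_return ?A (rot M)"
  have C: "?C \<subseteq> E"
    using c by (auto simp: simple_cycle_def)
  then show "embedded_digraph (submap M ?C)"
    by (rule submap_permutes)
  have inj_head: "a = b" if "a \<in> ?C" "b \<in> ?C" "head M a = head M b" for a b
    using c that unfolding simple_cycle_def inj_on_def by (metis imageE)
  have ex_succ: "\<exists>b\<in>?C. tail M b = head M a" if "a \<in> ?C" for a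
  proof -
    obtain i where i: "i < n" "a = c i"
      using \<open>a \<in> ?C\<close> by auto
    then have "tail M (c (Suc i mod n)) = head M a" "Suc i mod n < n"
      using c by (auto simp: simple_cycle_def)
    then show ?thesis
      by blast
  qed
  have ex_pred: "\<exists>b\<in>?C. head M b = tail M a" if "a \<in> ?C" for a
  proof -
    have "tail M a \<in> incident ?C"
      using that by (simp add: incident_def)
    then obtain i where "i < n" "tail M a = head M (c i)"
      unfolding simple_cycle_incident[OF c] by auto
    then show ?thesis
      by auto
  qed
  have inj_tail: "a = b" if ab: "a \<in> ?C" "b \<in> ?C" "tail M a = tail M b" for a b
  proof -
    have fin: "finite ?C"
      by simp
    have "head M ` ?C = tail M ` ?C"
    proof (intro equalityI image_subsetI)
      show "head M x \<in> tail M ` ?C" if "x \<in> ?C" for x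
        using ex_succ[OF that] by (auto intro: rev_image_eqI)
      show "tail M x \<in> head M ` ?C" if "x \<in> ?C" for x
        using ex_pred[OF that] by (auto intro: rev_image_eqI)
    qed
    moreover have "card (head M ` ?C) = card ?C"
      using inj_head by (intro card_image inj_onI)
    ultimately have "inj_on (tail M) ?C"
      using fin by (metis eq_card_imp_inj_on)
    then show ?thesis
      using ab by (auto dest: inj_onD)
  qed
  have perm: "permutation ?f"
    using first_return_permutes[OF rot_permutation, of ?A] finite_side
    by (intro permutes_imp_permutation[of ?A]) auto
  have orb: "orbit ?f z = orbit (rot M) z \<inter> ?A" if "z \<in> ?A" for z
    using that finite_side by (intro orbit_first_return rot_permutation) auto
  fix z assume "z \<in> ends (submap M ?C)"
  then obtain a d where z: "z = (a, d)" "a \<in> ?C"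
    by (cases z) auto
  then have zA: "z \<in> ?A"
    by simp
  show "snd (rot (submap M ?C) z) \<noteq> snd z"
    unfolding rot_submap
  proof
    assume same: "snd (?f z) = snd z"
    then obtain b where b: "?f z = (b, d)" "b \<in> ?C"
      using first_return_in[OF rot_permutation zA] z by (cases "?f z") auto
    then have "(b, d) \<in> orbit (rot M) (a, d)"
      using orb[OF zA] z orbit.base[of ?f z] by auto
    then have "orbit (rot M) (b, d) = orbit (rot M) (a, d)"
      by (rule orbit_rot_eq)
    then have "b = a"
      using inj_head[of b a] inj_tail[of b a] b z side_cases[of d] by (auto simp: head_def tail_def)
    then have single: "orbit (rot M) (a, d) \<inter> ?A = {(a, d)}"
      using orb[OF zA] b(1) z(1) orbit_eq_singleton_iff[of ?f "(a, d)"] by metis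
    show False
    proof (cases d)
      case Head
      obtain y where "y \<in> ?C" "tail M y = head M a"
        using ex_succ z by blast
      then have "(y, Tail) \<in> orbit (rot M) (a, d) \<inter> ?A"
        using end_mem(2)[of y] Head by (simp add: head_def)
      then show False
        unfolding single using Head by simp
    next
      case Tail
      obtain y where "y \<in> ?C" "head M y = tail M a"
        using ex_pred z by blast
      then have "(y, Head) \<in> orbit (rot M) (a, d) \<inter> ?A"
        using end_mem(1)[of y] Tail by (simp add: tail_def)
      then show False
        unfolding single using Tail by simp
    qed
  qed
qed

text \<open>The c-face of \<open>e\<close> gives a directed walk from its head to its tail. A
  shortest one repeats no vertex, and \<open>e\<close> closes it to a cycle.\<close>

lemma simple_cycle_through:
  assumes e: "e \<in> E"
  obtains c n where "simple_cycle c n" "e \<in> c ` {..<n}"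
proof -
  let ?R = "{(tail M a, head M a) | a. a \<in> E}"
  have next_head: "(head M z, head M (r z)) \<in> ?R" if "z \<in> E" for z
    using tail_rsucc[OF that] that by (metis (mono_tags, lifting) mem_Collect_eq r_in)
  have reach: "(head M e, head M z) \<in> ?R\<^sup>*" if "z \<in> orbit r e" for z
  proof -
    have "(head M e, head M z) \<in> ?R\<^sup>* \<and> z \<in> E"
      using that
    proof induction
      case base
      then show ?case
        using e r_into_rtrancl[OF next_head[OF e]] by simp
    next
      case (step z)
      then show ?case
        using rtrancl_into_rtrancl[OF _ next_head, of _ z] by simp
    qed
    then show ?thesis
      by simp
  qed
  obtain x where x: "r x = e"
    using pred_ex by blast
  have "x \<in> orbit r e"
    using x eqcl_gr_iff_orbit[OF r_perm, of x e] eqcl_gr_iff_orbit[OF r_perm, of e x]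
    by (metis eqcl_sym orbit.base)
  moreover have "tail M e = head M x"
    using x tail_rsucc[of x] e by auto
  ultimately have "(head M e, tail M e) \<in> ?R\<^sup>*"
    using reach[of x] by (simp only:)
  then obtain n f where f: "f 0 = head M e" "f n = tail M e"
    and path: "\<And>i. i < n \<Longrightarrow> (f i, f (Suc i)) \<in> ?R" and inj: "inj_on f {..n}"
    by (rule simple_path) (rule that)
  from path have "\<forall>i. \<exists>a. i < n \<longrightarrow> a \<in> E \<and> tail M a = f i \<and> head M a = f (Suc i)"
    by fastforce
  then obtain g where g: "\<And>i. i < n \<Longrightarrow> g i \<in> E \<and> tail M (g i) = f i \<and> head M (g i) = f (Suc i)"
    by metis
  define c where "c i = (case i of 0 \<Rightarrow> e | Suc j \<Rightarrow> g j)" for i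
  have head_c: "head M (c i) = f i" if "i \<le> n" for i
    using that g f(1) by (cases i) (auto simp: c_def)
  have tail_c: "tail M (c (Suc i mod Suc n)) = f i" if "i \<le> n" for i
    using that g f(2) by (cases "i = n") (auto simp: c_def)
  have "simple_cycle c (Suc n)"
    unfolding simple_cycle_def
  proof (intro conjI allI impI)
    show "c i \<in> E" if "i < Suc n" for i
      using that e g by (cases i) (auto simp: c_def)
    show "tail M (c (Suc i mod Suc n)) = head M (c i)" if "i < Suc n" for i
      using that head_c tail_c by simp
    show "inj_on (\<lambda>i. head M (c i)) {..<Suc n}"
      using inj head_c by (auto simp: inj_on_def)
  qed simp
  moreover have "e \<in> c ` {..<Suc n}"
    by (auto simp: c_def intro!: image_eqI[of _ _ 0])
  ultimately show ?thesis
    by (rule that)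
qed

lemma c_face_simple_cycle:
  assumes e: "e \<in> E" and inj: "inj_on (head M) (corb r e)"
  obtains c n where "simple_cycle c n" "corb r e = c ` {..<n}"
proof -
  have corb: "corb r e = orbit r e"
    using eqcl_gr_iff_orbit[OF r_perm] by (auto simp: mem_corb)
  define n where "n = funpow_dist1 r e e"
  have "e \<in> orbit r e"
    using permutation_self_in_orbit[OF r_perm] .
  then have n: "0 < n" "(r ^^ n) e = e" "orbit r e = (\<lambda>i. (r ^^ i) e) ` {0..<n}"
    "inj_on (\<lambda>i. (r ^^ i) e) {0..<n}"
    using funpow_dist1_prop[of e r e] orbit_conv_funpow_dist1[of e r] inj_on_funpow_dist1[of e r e]
    by (simp_all add: n_def)
  have in_corb: "(r ^^ i) e \<in> corb r e" for i
    by (induction i) (auto intro: corb_step)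
  have in_E: "(r ^^ i) e \<in> E" for i
    using in_corb corb_subset[OF r e] by blast
  have "simple_cycle (\<lambda>i. (r ^^ i) e) n"
    unfolding simple_cycle_def
  proof (intro conjI allI impI)
    show "tail M ((r ^^ (Suc i mod n)) e) = head M ((r ^^ i) e)" if "i < n" for i
    proof -
      have "(r ^^ (Suc i mod n)) e = (r ^^ Suc i) e"
        using n(2) by (rule funpow_mod_eq)
      then show ?thesis
        using tail_rsucc[OF in_E] by simp
    qed
    show "inj_on (\<lambda>i. head M ((r ^^ i) e)) {..<n}"
      using inj n(4) in_corb unfolding inj_on_def by (simp add: lessThan_atLeast0)
  qed (use n in_E in auto)
  moreover have "corb r e = (\<lambda>i. (r ^^ i) e) ` {..<n}"
    using n(3) corb by (simp add: lessThan_atLeast0)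
  ultimately show ?thesis
    by (rule that)
qed

text \<open>A directed cycle through \<open>e\<close> is nonseparable and alternating, and by
  finiteness it extends to a maximal such edge set.\<close>

lemma block_through:
  assumes "e \<in> E"
  obtains A where "is_block M A" "e \<in> A" "A \<subseteq> E" "alternating_dimap (submap M A)"
proof -
  let ?P = "\<lambda>A. A \<subseteq> E \<and> alternating_dimap (submap M A) \<and> nonseparable (submap M A)"
  obtain c n where c: "simple_cycle c n" "e \<in> c ` {..<n}"
    using simple_cycle_through[OF assms] .
  then have "?P (c ` {..<n})"
    using simple_cycle_two_connected simple_cycle_alternating two_connected_imp_nonseparable
    by (auto simp: two_connected_def)
  moreover have "finite {A. ?P A}"
    using finE by (auto intro: finite_subset[of _ "Pow E"])
  ultimately obtain A where A: "?P A" "c ` {..<n} \<subseteq> A" "\<And>B. ?P B \<Longrightarrow> A \<subseteq> B \<Longrightarrow> A = B"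
    using finite_has_maximal2[of "{A. ?P A}" "c ` {..<n}"] by (metis (no_types, lifting) mem_Collect_eq)
  then have "is_block M A"
    unfolding is_block_def by blast
  then show ?thesis
    using that A c(2) by blast
qed

text \<open>
  Two vertices of a c-face \<open>H\<close> that are connected outside of \<open>H\<close> lie on a ring of c-faces.
  Removing a vertex from a c-face leaves a path, and it breaks the ring at one place at most.
\<close>

lemma c_face_ring:
  assumes simple: "\<And>f. f \<in> E \<Longrightarrow> inj_on (head M) (corb r f)"
    and ab: "a \<in> corb r e" "b \<in> corb r e" "a \<noteq> b" and e: "e \<in> E"
    and conn: "(a, b) \<in> con r s (- corb r e)"
  obtains X where "corb r e \<subset> X" "X \<subseteq> E" "alternating_dimap (submap M X)"
    "nonseparable (submap M X)"
proof -
  let ?H = "corb r e"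
  have H: "?H \<subseteq> E"
    using corb_subset[OF r e] .
  have face: "two_connected (corb r f)" if "f \<in> E" for f
    using c_face_simple_cycle[OF that simple[OF that]] simple_cycle_two_connected by metis
  have "con r s (E - ?H) = con r s (- ?H)"
    using con_Int_E[of "- ?H"] by (simp add: Int_commute Diff_eq)
  then have "(head M a, head M b) \<in>
      {(u, v) \<in> verts M \<times> verts M. \<exists>f\<in>E - ?H. {u, v} = {head M f, tail M f}}\<^sup>*"
    using connected_iff[of "E - ?H" a b] ab H conn by auto
  then obtain n f where f: "f 0 = head M a" "f n = head M b"
    and path: "\<And>i. i < n \<Longrightarrow> (f i, f (Suc i)) \<in>
      {(u, v) \<in> verts M \<times> verts M. \<exists>f\<in>E - ?H. {u, v} = {head M f, tail M f}}"
    and inj: "inj_on f {..n}"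
    by (rule simple_path) (rule that)
  from path have "\<forall>i. \<exists>g. i < n \<longrightarrow> g \<in> E - ?H \<and> {f i, f (Suc i)} = {head M g, tail M g}"
    by fastforce
  then obtain g where g: "\<And>i. i < n \<Longrightarrow> g i \<in> E - ?H"
    "\<And>i. i < n \<Longrightarrow> {f i, f (Suc i)} = {head M (g i), tail M (g i)}"
    by metis
  \<comment> \<open>Whole c-faces are added and not just the edges of the path, because unions of
    c-faces are alternating.\<close>
  define X where "X = ?H \<union> (\<Union>i<n. corb r (g i))"
  have XE: "X \<subseteq> E"
    using H g(1) corb_subset[OF r] unfolding X_def by blast
  have HX: "?H \<subseteq> X"
    by (auto simp: X_def)
  have gX: "corb r (g i) \<subseteq> X" if "i < n" for i
    using that by (auto simp: X_def)
  have "head M a \<noteq> head M b"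
    using simple[OF e] ab by (auto dest: inj_onD)
  then have n0: "0 < n"
    using f(1,2) by (cases n) auto
  then have "g 0 \<in> X" "g 0 \<notin> ?H"
    using g(1)[of 0] gX[of 0] by auto
  then have "?H \<subset> X"
    using HX by blast
  moreover have "alternating_dimap (submap M X)"
    using XE by (rule alternating_submap_closed) (auto simp: X_def corb_step_iff)
  moreover have "two_connected X"
    unfolding two_connected_def
  proof (intro conjI allI impI)
    show "X \<subseteq> E"
      by (rule XE)
    show "X \<noteq> {}"
      using HX corb_self[of e r] by blast
    fix Z z assume Z: "Z \<subseteq> {z :: 'e edge_end set}"
    have linkH: "linked (corb r h) Z" if "h \<in> E" for h
      using face[OF that] Z unfolding two_connected_def by blast
    have step: "(f i, f (Suc i)) \<in> (adj X Z)\<^sup>*" if i: "i < n" "f i \<notin> Z" "f (Suc i) \<notin> Z" for i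
    proof -
      have "g i \<in> X"
        using gX[OF i(1)] by auto
      then show ?thesis
        using g(2)[OF i(1)] i by (intro r_into_rtrancl) (auto simp: adj_def)
    qed
    have fH: "f 0 \<in> incident ?H" "f n \<in> incident ?H"
      using f(1,2) ab by (auto simp: incident_def)
    have fg: "f i \<in> incident (corb r (g i))" "f (Suc i) \<in> incident (corb r (g i))" if "i < n" for i
      using g(2)[OF that] corb_self[of "g i" r] by (auto simp: incident_def doubleton_eq_iff)
    have left: "(f 0, f i) \<in> (adj X Z)\<^sup>*" if "i \<le> n" "\<And>j. j \<le> i \<Longrightarrow> f j \<notin> Z" for i
      using that
    proof (induction i)
      case (Suc i)
      then show ?case
        using step[of i] by (force intro: rtrancl_trans)
    qed simp
    have right: "(f (n - i), f n) \<in> (adj X Z)\<^sup>*" if "i \<le> n" "\<And>j. n - i \<le> j \<Longrightarrow> j \<le> n \<Longrightarrow> f j \<notin> Z" for i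
      using that
    proof (induction i)
      case (Suc i)
      then have "(f (n - Suc i), f (Suc (n - Suc i))) \<in> (adj X Z)\<^sup>*"
        by (intro step) auto
      moreover have "Suc (n - Suc i) = n - i"
        using Suc.prems by simp
      ultimately show ?case
        using Suc by (auto intro: rtrancl_trans)
    qed simp
    \<comment> \<open>From a c-face of the ring the path \<open>f\<close> leads to \<open>?H\<close>
      in both directions. As \<open>f\<close> is injective and \<open>Z\<close> has at most one
      vertex, one of the two ways is free.\<close>
    have to_H: "\<exists>w\<in>incident ?H - Z. (u, w) \<in> (adj X Z)\<^sup>*" if u: "u \<in> incident X - Z" for u
    proof (cases "u \<in> incident ?H")
      case False
      then obtain i where i: "i < n" "u \<in> incident (corb r (g i))"
        using u by (auto simp: X_def incident_def)
      have gE: "g i \<in> E"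
        using g(1)[OF i(1)] by simp
      have link: "(u, w) \<in> (adj X Z)\<^sup>*" if "w \<in> incident (corb r (g i)) - Z" for w
        using linkH[OF gE] that i(2) u adj_mono[OF gX[OF i(1)], of Z] unfolding linked_def by blast
      show ?thesis
      proof (cases "\<exists>j\<le>i. f j \<in> Z")
        case False
        then have "(u, f i) \<in> (adj X Z)\<^sup>*" "(f i, f 0) \<in> (adj X Z)\<^sup>*" "f 0 \<notin> Z"
          using link[of "f i"] fg(1)[OF i(1)] left[of i] i(1) adj_rtrancl_sym by auto
        then show ?thesis
          using fH(1) by (meson DiffI rtrancl_trans)
      next
        case True
        then obtain j where j: "j \<le> i" "f j \<in> Z"
          by auto
        have "f k \<notin> Z" if "Suc i \<le> k" "k \<le> n" for k
        proof
          assume "f k \<in> Z"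
          then have "f k = f j"
            using j Z by blast
          then have "k = j"
            using inj that j i(1) by (auto dest: inj_onD)
          then show False
            using that j by simp
        qed
        then have "f (Suc i) \<notin> Z" "f n \<notin> Z" "(f (Suc i), f n) \<in> (adj X Z)\<^sup>*"
          using i(1) right[of "n - Suc i"] by simp_all
        moreover have "(u, f (Suc i)) \<in> (adj X Z)\<^sup>*"
          using link fg(2)[OF i(1)] \<open>f (Suc i) \<notin> Z\<close> by blast
        ultimately show ?thesis
          using fH(2) by (metis DiffI rtrancl_trans)
      qed
    qed (use u in auto)
    show "linked X Z"
      unfolding linked_def
    proof (intro ballI)
      fix u v assume "u \<in> incident X - Z" "v \<in> incident X - Z"
      then obtain u' v' where "u' \<in> incident ?H - Z" "(u, u') \<in> (adj X Z)\<^sup>*"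
        "v' \<in> incident ?H - Z" "(v, v') \<in> (adj X Z)\<^sup>*"
        using to_H by meson
      moreover have "(u', v') \<in> (adj X Z)\<^sup>*"
        using calculation(1,3) linkH[OF e] adj_mono[OF HX, of Z] unfolding linked_def by blast
      ultimately show "(u, v) \<in> (adj X Z)\<^sup>*"
        by (meson adj_rtrancl_sym rtrancl_trans)
    qed
  qed
  ultimately show ?thesis
    using that two_connected_imp_nonseparable XE by blast
qed

end

lemma good_map_c_simple:
  assumes "c_simple S"
  shows "good_map S"
proof -
  interpret loopless_map S
    using assms by unfold_locales (auto simp: c_simple_def)
  have block_type: "c_cycle (submap S A) \<or> in_alt_c (submap S A)" if "is_block S A" for A
    using assms that by (simp add: c_simple_def)
  have apart: "\<not> within_c_face S B A" if "is_block S A" "is_block S B" "A \<noteq> B" for A B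
    using assms that by (simp add: c_simple_def)
  \<comment> \<open>If a c-face left the block \<open>A\<close> after \<open>a\<close>, then the
    block of \<open>r a\<close> would lie within the c-face of \<open>A\<close> through
    \<open>a\<close>.\<close>
  have block_closed: "r a \<in> A" if A: "is_block S A" "A \<subseteq> E" "alternating_dimap (submap S A)" "a \<in> A"
    for A a
  proof (rule ccontr)
    assume neg: "r a \<notin> A"
    have aE: "a \<in> E" "r a \<in> E"
      using A by auto
    obtain B where B: "is_block S B" "r a \<in> B"
      using block_through[OF aE(2)] by metis
    interpret N: alt_map "submap S A"
      using A(3) by unfold_locales
    let ?g = "face_of (submap S A) (a, Tail)" and ?g' = "face_of S (a, Tail)"
    have mem: "(a, Tail) \<in> ?g" "(r a, Tail) \<in> ?g'"
      using A(4) aE N.face_Tail[of a] face_Tail[of a] permutation_self_in_orbit[OF N.r_perm]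
        orbit.base[of r a] by auto
    have g: "?g \<in> faces (submap S A)" "?g' \<in> faces S"
      using A(4) aE by (auto simp: faces_def)
    then have "c_face (submap S A) ?g"
      using N.face_Tail[of a] A(4) by (auto simp: c_face_def)
    moreover have "within_face S B A ?g"
      unfolding within_face_def subface_def using g mem B(2) by (metis (no_types, lifting)
        IntI empty_iff fst_conv imageI rtrancl.rtrancl_refl)
    ultimately have "within_c_face S B A"
      by (auto simp: within_c_face_def)
    then show False
      using apart[OF A(1) B(1)] B(2) neg by blast
  qed
  \<comment> \<open>Blocks contain whole c-faces. In an \<open>alt_c\<close> block these have two
    edges; a c-cycle block is a single c-face, and having as many vertices as edges makes the heads
    distinct.\<close>
  have c_faces: "r (r e) = e \<or> is_block S (corb r e) \<and> inj_on (head S) (corb r e)" if e: "e \<in> E" for e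
  proof -
    obtain A where A: "is_block S A" "e \<in> A" "A \<subseteq> E" "alternating_dimap (submap S A)"
      using block_through[OF e] .
    interpret N: alt_map "submap S A"
      using A(4) by unfold_locales
    have rN: "rsucc (submap S A) a = r a" if "a \<in> A" for a
    proof -
      have "rot (submap S A) (a, Head) = rot S (a, Head)"
        unfolding rot_submap using that A(3) block_closed[OF A(1,3,4) that]
        by (intro first_return_1) (auto simp: rot_Head)
      then show ?thesis
        by (simp add: rsucc_eq)
    qed
    from block_type[OF A(1)] show ?thesis
    proof
      assume "in_alt_c (submap S A)"
      then obtain G :: "'a emap" and f where f: "bij_betw f (ends G) A"
        "\<forall>d\<in>ends (alt_c G). rot (submap S A) (map_prod f id d) = map_prod f id (rot (alt_c G) d)"
        by (auto simp: in_alt_c_def map_iso_def alt_c_def)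
      obtain h where h: "h \<in> ends G" "e = f h"
        using f(1) A(2) by (auto simp: bij_betw_def)
      have "rsucc (submap S A) (f h) = f (opp h)" if "h \<in> ends G" for h
        using f(2) that unfolding rsucc_eq by (force simp: alt_c_def ends_eq)
      then have "rsucc (submap S A) (rsucc (submap S A) e) = e"
        using h by simp
      then show ?thesis
        using rN A(2) block_closed[OF A(1,3,4)] by metis
    next
      assume "c_cycle (submap S A)"
      then obtain g where g: "c_face (submap S A) g" "fst ` g = A"
        and card: "card (verts (submap S A)) = card A"
        by (auto simp: c_cycle_def)
      obtain z d where z: "z \<in> A" "g = face_of (submap S A) (z, d)"
        using g(1) by (auto simp: c_face_def faces_def ends_eq)
      have "d = Tail"
        using z g(1) N.face_Head[of z] permutation_self_in_orbit[OF N.s_perm, of z] side_cases[of d]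
        by (auto simp: c_face_def)
      then have A_orbit: "A = orbit (rsucc (submap S A)) z"
        using z g(2) N.face_Tail[of z] by (simp add: image_image)
      have A_sub: "y \<in> corb r z" if "y \<in> A" for y
      proof -
        have "y \<in> orbit (rsucc (submap S A)) z"
          using that A_orbit by simp
        then have "y \<in> corb r z \<and> y \<in> A"
          by induction (use z(1) rN block_closed[OF A(1,3,4)] in \<open>auto intro: corb_step\<close>)
        then show ?thesis
          by simp
      qed
      have "y \<in> A" if "y \<in> orbit r e" for y
        using that by induction (use A(2) block_closed[OF A(1,3,4)] in auto)
      then have "corb r e \<subseteq> A"
        by (auto simp: mem_corb eqcl_gr_iff_orbit[OF r_perm])
      then have corb: "corb r e = A"
        using A_sub corb_eq[OF A_sub[OF A(2)]] by auto
      have "card (head (submap S A) ` A) = card A"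
        using card N.verts_eq by simp
      then have "inj_on (head (submap S A)) A"
        using N.finE by (intro eq_card_imp_inj_on) simp_all
      then have "inj_on (head S) A"
        using A(3) by (auto simp: inj_on_def head_submap)
      then show ?thesis
        using A(1) corb by simp
    qed
  qed
  have simple: "inj_on (head S) (corb r e)" if e: "e \<in> E" for e
  proof (cases "r (r e) = e")
    case True
    have "r e \<in> E"
      using e by simp
    then have "head S (r e) = tail S e"
      using tail_rsucc[of "r e"] True by simp
    then have "head S (r e) \<noteq> head S e"
      using head_ne_tail[OF e] by simp
    then show ?thesis
      unfolding corb_two[OF True] by (auto simp: inj_on_def)
  qed (use c_faces[OF e] in simp)
  have "kind r s (corb r e)" if e: "e \<in> E" for e
  proof (cases "r (r e) = e")
    case True
    then have "\<forall>x\<in>corb r e. r (r x) = x"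
      using corb_two[OF True] by auto
    then show ?thesis
      by (simp add: kind_def)
  next
    case False
    then have block: "is_block S (corb r e)"
      using c_faces[OF e] by simp
    \<comment> \<open>Another connection between two vertices of the c-face would give a ring of
      c-faces, which is a larger nonseparable alternating submap, against the maximality of the
      block.\<close>
    have "a = b" if ab: "a \<in> corb r e" "b \<in> corb r e" "(a, b) \<in> con r s (- corb r e)" for a b
    proof (rule ccontr)
      assume "a \<noteq> b"
      then obtain X where X: "corb r e \<subset> X" "X \<subseteq> E" "alternating_dimap (submap S X)"
        "nonseparable (submap S X)"
        using c_face_ring[OF simple ab(1,2) _ e ab(3)] by metis
      moreover have "\<not> is_loop S f" if "f \<in> E" for f
        using loopless that by (simp add: loopless_def)
      ultimately show False
        using block unfolding is_block_def by blast
    qed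
    then show ?thesis
      by (simp add: kind_def)
  qed
  then show ?thesis
    using assms plane_iff alt fin r s by (simp add: good_map_def good_def c_simple_def)
qed

theorem theorem7p18:
  fixes D S1 S2 :: "'e emap"
  assumes "c_alternating S1" and "c_alternating S2"
    and "c_union D S1 S2"
  shows "Tc_well_defined S1 \<and> Tc_well_defined S2 \<and> Tc_well_defined D \<and>
    Tc D = Tc S1 * Tc S2"
proof -
  have good: "good_map S" if "c_alternating S" for S :: "'e emap"
    using that good_map_adds_c_multiloops good_map_c_simple by (auto simp: c_alternating_def)
  then have "good_map D \<and> tval D = tval S1 * tval S2"
    using assms by (intro tval_c_union)
  then show ?thesis
    using good_map_Tc good[OF assms(1)] good[OF assms(2)] by metis
qed

end
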